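(* Let $s>r>0$ and $B\ge 1$. The minimax rate of testing between $H_0: f\in\Sigma(s)$ and $H_1: f\in\tilde\Sigma(r,\rho_n)$ equals $r_n(r)$, and an adaptive and honest confidence band over $\Sigma(s)\cup\tilde\Sigma(r,\rho_n)$ exists if and only if $\rho_n$ is at least of the order of this rate, in the following precise sense. (a) Let $\rho_n\ge 0$ be a sequence of real numbers and suppose that $C_n$ is a confidence band that is asymptotically honest with level $\alpha<0.5$ over $\Sigma(s)\cup\tilde\Sigma(r,\rho_n)$ and that is adaptive in the sense that there is a finite constant $L$, independent of $n$, such that for every $n$ large enough $$\sup_{f\in\Sigma(s)}E_f|C_n|\le L\,r_n(s),\qquad \sup_{f\in\tilde\Sigma(r,\rho_n)}E_f|C_n|\le L\,r_n(r).$$ Then necessarily $$\liminf_n\frac{\rho_n}{r_n(r)}>0.$$ (b) Suppose $B,r,s$ and $0<\alpha<1$ are given. Then there exist a sequence $\rho_n$ satisfying $$\limsup_n\frac{\rho_n}{r_n(r)}<\infty$$ and a confidence band $C_n=C_n(B,r,s,\alpha;X_1,\ldots,X_n)$ that is asymptotically honest with level $\alpha$ over $\Sigma(s)\cup\tilde\Sigma(r,\rho_n)$ and adaptive in the sense that there is a finite constant $L$, independent of $n$, such that the two inequalities displayed in (a) hold for every $n$ large enough. (c) Let $t>s$ be arbitrary. Claims (a) and (b) still hold true if $\Sigma(s)$ is replaced (in the union $\Sigma(s)\cup\tilde\Sigma(r,\rho_n)$ over which honesty is required and in the first adaptivity supremum) by the set $$\Bigl\{f\in\Sigma(s):\ \inf_{g\in\Sigma(t)}\|g-f\|_\infty\ge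 B\,r_n(s)/2\Bigr\}.$$
   Context: Observations: $X_1,\ldots,X_n$ are i.i.d. random variables with values in $[0,1]$ and common probability density $f$; $\Pr_f$ and $E_f$ denote the joint law and the corresponding expectation. $\|\cdot\|_\infty$ is the supremum norm on $[0,1]$. Hölder norm: fix an $S$-regular Daubechies wavelet basis of $L^2([0,1])$ (boundary-corrected), with $S$ larger than all smoothness indices considered: scaling functions $\phi_k$, $k=1,\ldots,N$, and wavelets $\psi_{lk}=2^{l/2}\psi_k(2^l\cdot)$, $l\ge J_0$, $k=1,\ldots,2^l$, with $\phi_k,\psi_k$ compactly supported and $S$ times continuously differentiable. For continuous $f$ on $[0,1]$ put $\alpha_k(f)=\int f\phi_k$, $\beta_{lk}(f)=\int f\psi_{lk}$ and $\|f\|_{s,\infty}=\max\bigl(\sup_k|\alpha_k(f)|,\ \sup_{k,l}2^{l(s+1/2)}|\beta_{lk}(f)|\bigr)$. Classes of densities: for $B\ge1$, $\Sigma(s)=\Sigma(s,B)=\{f:[0,1]\to[0,\infty)\text{ continuous},\ \int_0^1 f=1,\ \|f\|_{s,\infty}\le B\}$, and for $s>r$ and $\rho_n\ge0$, $\tilde\Sigma(r,\rho_n)=\{f\in\Sigma(r,B):\ \inf_{g\in\Sigma(s,B)}\|g-f\|_\infty\ge\rho_n\}$. Rate: $r_n(s)=(\log n/n)^{s/(2s+1)}$. Confidence band: $C_n=C_n(X_1,\ldots,X_n)$ is a family of random intervals $\{C_n(y)=[c_n(y),c_n'(y)]\}_{y\in[0,1]}$; its maximal diameter is $|C_n|=\sup_{y\in[0,1]}|c_n'(y)-c_n(y)|$.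 $\{f\in C_n\}$ means $f(y)\in C_n(y)$ for all $y\in[0,1]$. $C_n$ is asymptotically honest with level $\alpha$ for a family $\mathcal P$ of densities (possibly depending on $n$) if $\liminf_n\inf_{f\in\mathcal P}\Pr_f(f\in C_n)\ge 1-\alpha$. Minimax rate of testing (in the sense of Ingster): a test is a measurable function $\Psi$ of $X_1,\ldots,X_n$ with values in $\{0,1\}$. A sequence $\rho_n^*$ is the minimax rate of testing between $H_0: f\in\Sigma(s)$ and $H_1: f\in\tilde\Sigma(r,\rho_n)$ if (i) for every $\eta>0$ there are a constant $L$ and tests $\Psi_n$ such that, for $\rho_n=L\rho_n^*$, $\limsup_n\bigl(\sup_{f\in\Sigma(s)}E_f\Psi_n+\sup_{f\in\tilde\Sigma(r,\rho_n)}E_f(1-\Psi_n)\bigr)\le\eta$; and (ii) whenever $\rho_n=o(\rho_n^* )$, $\liminf_n\inf_{\Psi}\bigl(\sup_{f\in\Sigma(s)}E_f\Psi+\sup_{f\in\tilde\Sigma(r,\rho_n)}E_f(1-\Psi)\bigr)\ge1$, the infimum being over all tests. *)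

theory Defs
  imports "HOL-Probability.Probability" "HOL-Library.Landau_Symbols"
begin

section \<open>Wavelet bases on the unit interval\<close>

text \<open>
  Functions on \<open>[0,1]\<close> are represented by functions of type \<open>real \<Rightarrow> real\<close>; everything
  below depends only on their values on \<open>{0..1}\<close>.
\<close>

abbreviation leb01 :: "real measure" where
  "leb01 \<equiv> restrict_space lborel {0..1}"

definition times_cont_diff :: "nat \<Rightarrow> (real \<Rightarrow> real) \<Rightarrow> bool" where
  "times_cont_diff S f \<longleftrightarrow>
     (\<forall>i<S. \<forall>x. (deriv ^^ i) f field_differentiable at x) \<and> continuous_on UNIV ((deriv ^^ S) f)"

text \<open>
  Daubechies' orthonormal filters of length \<open>2M\<close> with \<open>M\<close> vanishing moments (every choice of
  phase is allowed), shifted so that scaling function and wavelet are both supported in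
  \<open>[1 - M, M]\<close>.
\<close>

definition daubechies_filter :: "nat \<Rightarrow> (int \<Rightarrow> real) \<Rightarrow> bool" where
  "daubechies_filter M h \<longleftrightarrow>
     M \<ge> 1 \<and>
     (\<forall>k. k \<notin> {1 - int M..int M} \<longrightarrow> h k = 0) \<and>
     (\<Sum>k\<in>{1 - int M..int M}. h k) = sqrt 2 \<and>
     (\<forall>m. (\<Sum>k\<in>{1 - int M..int M}. h k * h (k + 2 * m)) = (if m = 0 then 1 else 0)) \<and>
     (\<forall>p<M. (\<Sum>k\<in>{1 - int M..int M}. (-1) powi k * of_int k ^ p * h k) = 0)"

definition daubechies_scaling :: "nat \<Rightarrow> (int \<Rightarrow> real) \<Rightarrow> (real \<Rightarrow> real) \<Rightarrow> bool" where
  "daubechies_scaling M h \<phi> \<longleftrightarrow>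
     (\<forall>x. x \<notin> {1 - real M..real M} \<longrightarrow> \<phi> x = 0) \<and>
     (\<forall>x. \<phi> x = sqrt 2 * (\<Sum>k\<in>{1 - int M..int M}. h k * \<phi> (2 * x - of_int k))) \<and>
     integrable lborel \<phi> \<and> (LINT x|lborel. \<phi> x) = 1"

definition daubechies_wavelet :: "nat \<Rightarrow> (int \<Rightarrow> real) \<Rightarrow> (real \<Rightarrow> real) \<Rightarrow> real \<Rightarrow> real" where
  "daubechies_wavelet M h \<phi> x =
     sqrt 2 * (\<Sum>k\<in>{1 - int M..int M}. (-1) powi k * h (1 - k) * \<phi> (2 * x - of_int k))"

text \<open>
  Finite linear combinations of the integer translates of \<open>\<phi> (a \<cdot>)\<close>. The edge functions below
  are taken from such spans, so they are compactly supported and as smooth as \<open>\<phi>\<close>.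
\<close>

definition shift_span :: "real \<Rightarrow> (real \<Rightarrow> real) \<Rightarrow> (real \<Rightarrow> real) set" where
  "shift_span a \<phi> = {g. \<exists>A c. finite A \<and> g = (\<lambda>x. \<Sum>m\<in>A. c m * \<phi> (a * x - of_int (m::int)))}"

text \<open>
  The \<open>2 ^ l\<close> functions of level \<open>l\<close>, indexed by \<open>k = 1, \<dots>, 2 ^ l\<close>: \<open>M\<close> left edge functions,
  the translates \<open>g (2 ^ l x - m)\<close> with \<open>M \<le> m < 2 ^ l - M\<close>, and \<open>M\<close> right edge functions
  (numbered from the end point \<open>1\<close> inwards).
\<close>

definition boundary_corrected ::
    "nat \<Rightarrow> (real \<Rightarrow> real) \<Rightarrow> (nat \<Rightarrow> real \<Rightarrow> real) \<Rightarrow> (nat \<Rightarrow> real \<Rightarrow> real) \<Rightarrow>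
     nat \<Rightarrow> nat \<Rightarrow> real \<Rightarrow> real" where
  "boundary_corrected M g gL gR l k x =
     2 powr (real l / 2) *
       (if k \<le> M then gL k (2 ^ l * x)
        else if k + M \<le> 2 ^ l then g (2 ^ l * x - (real k - 1))
        else gR (2 ^ l + 1 - k) (2 ^ l * (x - 1)))"

record wavelet_system =
  base_level :: nat                           \<comment> \<open>\<open>J\<^sub>0\<close>\<close>
  num_scal :: nat                             \<comment> \<open>\<open>N\<close>\<close>
  scal :: "nat \<Rightarrow> real \<Rightarrow> real"               \<comment> \<open>\<open>\<phi>\<^sub>k\<close>, \<open>k = 1, \<dots>, N\<close>\<close>
  wav :: "nat \<Rightarrow> nat \<Rightarrow> real \<Rightarrow> real"         \<comment> \<open>\<open>\<psi>\<^sub>l\<^sub>k\<close>, \<open>l \<ge> J\<^sub>0\<close>, \<open>k = 1, \<dots>, 2 ^ l\<close>\<close>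

definition scal_coeff :: "wavelet_system \<Rightarrow> nat \<Rightarrow> (real \<Rightarrow> real) \<Rightarrow> real" where
  "scal_coeff W k f = (LINT x|leb01. f x * scal W k x)"

definition wav_coeff :: "wavelet_system \<Rightarrow> nat \<Rightarrow> nat \<Rightarrow> (real \<Rightarrow> real) \<Rightarrow> real" where
  "wav_coeff W l k f = (LINT x|leb01. f x * wav W l k x)"

definition wavelet_partial_sum :: "wavelet_system \<Rightarrow> nat \<Rightarrow> (real \<Rightarrow> real) \<Rightarrow> real \<Rightarrow> real" where
  "wavelet_partial_sum W J f x =
     (\<Sum>k\<in>{1..num_scal W}. scal_coeff W k f * scal W k x) +
     (\<Sum>l\<in>{base_level W..<J}. \<Sum>k\<in>{1..2 ^ l}. wav_coeff W l k f * wav W l k x)"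

definition orthonormal_basis_L2 :: "wavelet_system \<Rightarrow> bool" where
  "orthonormal_basis_L2 W \<longleftrightarrow>
     (\<forall>k\<in>{1..num_scal W}. \<forall>k'\<in>{1..num_scal W}.
        (LINT x|leb01. scal W k x * scal W k' x) = (if k = k' then 1 else 0)) \<and>
     (\<forall>k\<in>{1..num_scal W}. \<forall>l\<ge>base_level W. \<forall>k'\<in>{1..2 ^ l}.
        (LINT x|leb01. scal W k x * wav W l k' x) = 0) \<and>
     (\<forall>l\<ge>base_level W. \<forall>l'\<ge>base_level W. \<forall>k\<in>{1..2 ^ l}. \<forall>k'\<in>{1..2 ^ l'}.
        (LINT x|leb01. wav W l k x * wav W l' k' x) = (if l = l' \<and> k = k' then 1 else 0)) \<and>
     (\<forall>f\<in>borel_measurable leb01. integrable leb01 (\<lambda>x. (f x)\<^sup>2) \<longrightarrow>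
        (\<lambda>J. LINT x|leb01. (f x - wavelet_partial_sum W J f x)\<^sup>2) \<longlonglongrightarrow> 0)"

text \<open>
  Boundary-corrected Daubechies bases in the sense of Cohen, Daubechies and Vial: in the interior
  the functions are dilated translates of the Daubechies scaling function and wavelet; near each
  end point there are \<open>M\<close> edge functions, built from restrictions of translates of \<open>\<phi>\<close>, and all
  wavelets, including the edge wavelets, retain the \<open>M\<close> vanishing moments on \<open>[0,1]\<close>.
\<close>

definition daubechies_basis :: "nat \<Rightarrow> wavelet_system \<Rightarrow> bool" where
  "daubechies_basis S W \<longleftrightarrow>
     (\<exists>M h \<phi> \<phi>L \<phi>R \<psi>L \<psi>R.
        daubechies_filter M h \<and> daubechies_scaling M h \<phi> \<and> times_cont_diff S \<phi> \<and>
        2 * M \<le> 2 ^ base_level W \<and> num_scal W = 2 ^ base_level W \<and>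
        (\<forall>k\<in>{1..M}. \<phi>L k \<in> shift_span 1 \<phi> \<and> \<phi>R k \<in> shift_span 1 \<phi> \<and>
                     \<psi>L k \<in> shift_span 2 \<phi> \<and> \<psi>R k \<in> shift_span 2 \<phi>) \<and>
        (\<forall>k\<in>{1..num_scal W}. \<forall>x\<in>{0..1}.
           scal W k x = boundary_corrected M \<phi> \<phi>L \<phi>R (base_level W) k x) \<and>
        (\<forall>l\<ge>base_level W. \<forall>k\<in>{1..2 ^ l}. \<forall>x\<in>{0..1}.
           wav W l k x = boundary_corrected M (daubechies_wavelet M h \<phi>) \<psi>L \<psi>R l k x) \<and>
        (\<forall>l\<ge>base_level W. \<forall>k\<in>{1..2 ^ l}. \<forall>p<M. (LINT x|leb01. x ^ p * wav W l k x) = 0)) \<and>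
     orthonormal_basis_L2 W"


section \<open>Classes of densities\<close>

definition holder_norm :: "wavelet_system \<Rightarrow> real \<Rightarrow> (real \<Rightarrow> real) \<Rightarrow> ennreal" where
  "holder_norm W s f =
     max (SUP k\<in>{1..num_scal W}. ennreal \<bar>scal_coeff W k f\<bar>)
         (SUP l\<in>{base_level W..}. SUP k\<in>{1..2 ^ l}.
            ennreal (2 powr (real l * (s + 1/2)) * \<bar>wav_coeff W l k f\<bar>))"

definition cont_densities :: "(real \<Rightarrow> real) set" where
  "cont_densities = {f. continuous_on {0..1} f \<and> (\<forall>x\<in>{0..1}. 0 \<le> f x) \<and> (LINT x|leb01. f x) = 1}"

definition holder_class :: "wavelet_system \<Rightarrow> real \<Rightarrow> real \<Rightarrow> (real \<Rightarrow> real) set" where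
  "holder_class W B s = {f \<in> cont_densities. holder_norm W s f \<le> ennreal B}"

definition sup_dist :: "(real \<Rightarrow> real) \<Rightarrow> (real \<Rightarrow> real) \<Rightarrow> ennreal" where
  "sup_dist g f = (SUP x\<in>{0..1}. ennreal \<bar>g x - f x\<bar>)"

definition separated_class ::
    "wavelet_system \<Rightarrow> real \<Rightarrow> real \<Rightarrow> real \<Rightarrow> real \<Rightarrow> (real \<Rightarrow> real) set" where
  "separated_class W B r s \<rho> =
     {f \<in> holder_class W B r. (INF g\<in>holder_class W B s. sup_dist g f) \<ge> ennreal \<rho>}"

definition rate :: "real \<Rightarrow> nat \<Rightarrow> real" where
  "rate s n = (ln (real n) / real n) powr (s / (2 * s + 1))"


section \<open>Sampling model, tests and confidence bands\<close>

text \<open>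
  The observations \<open>X 1, \<dots>, X n\<close> are the coordinates on \<open>[0,1]\<^sup>n\<close>; under \<open>sample_law n f\<close>
  they are i.i.d. with density \<open>f\<close>.
\<close>

definition sample_space :: "nat \<Rightarrow> (nat \<Rightarrow> real) measure" where
  "sample_space n = (\<Pi>\<^sub>M i\<in>{1..n}. leb01)"

definition sample_law :: "nat \<Rightarrow> (real \<Rightarrow> real) \<Rightarrow> (nat \<Rightarrow> real) measure" where
  "sample_law n f = (\<Pi>\<^sub>M i\<in>{1..n}. density leb01 (\<lambda>x. ennreal (f x)))"

definition tests :: "nat \<Rightarrow> ((nat \<Rightarrow> real) \<Rightarrow> real) set" where
  "tests n = {\<Psi> \<in> borel_measurable (sample_space n). \<forall>X\<in>space (sample_space n). \<Psi> X \<in> {0, 1}}"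

definition test_error ::
    "nat \<Rightarrow> (real \<Rightarrow> real) set \<Rightarrow> (real \<Rightarrow> real) set \<Rightarrow> ((nat \<Rightarrow> real) \<Rightarrow> real) \<Rightarrow> ennreal" where
  "test_error n H0 H1 \<Psi> =
     (SUP f\<in>H0. \<integral>\<^sup>+X. ennreal (\<Psi> X) \<partial>sample_law n f) +
     (SUP f\<in>H1. \<integral>\<^sup>+X. ennreal (1 - \<Psi> X) \<partial>sample_law n f)"

text \<open>The alternative \<open>H1 \<rho>\<close> depends on the separation parameter \<open>\<rho>\<close>.\<close>

definition minimax_testing_rate ::
    "(real \<Rightarrow> real) set \<Rightarrow> (real \<Rightarrow> (real \<Rightarrow> real) set) \<Rightarrow> (nat \<Rightarrow> real) \<Rightarrow> bool" where
  "minimax_testing_rate H0 H1 \<rho>' \<longleftrightarrow>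
     (\<forall>\<eta>>0. \<exists>L>0. \<exists>\<Psi>. (\<forall>n. \<Psi> n \<in> tests n) \<and>
        limsup (\<lambda>n. test_error n H0 (H1 (L * \<rho>' n)) (\<Psi> n)) \<le> ennreal \<eta>) \<and>
     (\<forall>\<rho>. (\<forall>n. 0 \<le> \<rho> n) \<and> \<rho> \<in> o(\<rho>') \<longrightarrow>
        liminf (\<lambda>n. INF \<Psi>\<in>tests n. test_error n H0 (H1 (\<rho> n)) \<Psi>) \<ge> 1)"

text \<open>
  A band at sample size \<open>n\<close> is given by its lower and upper end points \<open>lo n X y\<close> and \<open>up n X y\<close>
  at the data \<open>X\<close>.
\<close>

definition in_band ::
    "nat \<Rightarrow> (nat \<Rightarrow> (nat \<Rightarrow> real) \<Rightarrow> real \<Rightarrow> real) \<Rightarrow> (nat \<Rightarrow> (nat \<Rightarrow> real) \<Rightarrow> real \<Rightarrow> real) \<Rightarrow>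
     (real \<Rightarrow> real) \<Rightarrow> (nat \<Rightarrow> real) set" where
  "in_band n lo up f = {X \<in> space (sample_space n). \<forall>y\<in>{0..1}. f y \<in> {lo n X y..up n X y}}"

definition diameter ::
    "nat \<Rightarrow> (nat \<Rightarrow> (nat \<Rightarrow> real) \<Rightarrow> real \<Rightarrow> real) \<Rightarrow> (nat \<Rightarrow> (nat \<Rightarrow> real) \<Rightarrow> real \<Rightarrow> real) \<Rightarrow>
     (nat \<Rightarrow> real) \<Rightarrow> ennreal" where
  "diameter n lo up X = (SUP y\<in>{0..1}. ennreal \<bar>up n X y - lo n X y\<bar>)"

text \<open>
  Coverage and diameter involve uncountably many \<open>y\<close>, so the measurability that makes the
  coverage probabilities and the expected diameter meaningful is part of the definition.
\<close>

definition confidence_band ::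
    "(nat \<Rightarrow> (nat \<Rightarrow> real) \<Rightarrow> real \<Rightarrow> real) \<Rightarrow> (nat \<Rightarrow> (nat \<Rightarrow> real) \<Rightarrow> real \<Rightarrow> real) \<Rightarrow> bool" where
  "confidence_band lo up \<longleftrightarrow>
     (\<forall>n. (\<forall>y\<in>{0..1}. (\<lambda>X. lo n X y) \<in> borel_measurable (sample_space n) \<and>
                       (\<lambda>X. up n X y) \<in> borel_measurable (sample_space n)) \<and>
          (\<forall>X\<in>space (sample_space n). \<forall>y\<in>{0..1}. lo n X y \<le> up n X y) \<and>
          (\<forall>f\<in>cont_densities. in_band n lo up f \<in> sets (sample_space n)) \<and>
          diameter n lo up \<in> borel_measurable (sample_space n))"

definition asymp_honest ::
    "real \<Rightarrow> (nat \<Rightarrow> (real \<Rightarrow> real) set) \<Rightarrow>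
     (nat \<Rightarrow> (nat \<Rightarrow> real) \<Rightarrow> real \<Rightarrow> real) \<Rightarrow> (nat \<Rightarrow> (nat \<Rightarrow> real) \<Rightarrow> real \<Rightarrow> real) \<Rightarrow> bool" where
  "asymp_honest \<alpha> P lo up \<longleftrightarrow>
     liminf (\<lambda>n. INF f\<in>P n. emeasure (sample_law n f) (in_band n lo up f)) \<ge> ennreal (1 - \<alpha>)"

definition expected_diameter ::
    "nat \<Rightarrow> (nat \<Rightarrow> (nat \<Rightarrow> real) \<Rightarrow> real \<Rightarrow> real) \<Rightarrow> (nat \<Rightarrow> (nat \<Rightarrow> real) \<Rightarrow> real \<Rightarrow> real) \<Rightarrow>
     (real \<Rightarrow> real) \<Rightarrow> ennreal" where
  "expected_diameter n lo up f = (\<integral>\<^sup>+X. diameter n lo up X \<partial>sample_law n f)"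

definition adaptive ::
    "real \<Rightarrow> real \<Rightarrow> (nat \<Rightarrow> (real \<Rightarrow> real) set) \<Rightarrow> (nat \<Rightarrow> (real \<Rightarrow> real) set) \<Rightarrow>
     (nat \<Rightarrow> (nat \<Rightarrow> real) \<Rightarrow> real \<Rightarrow> real) \<Rightarrow> (nat \<Rightarrow> (nat \<Rightarrow> real) \<Rightarrow> real \<Rightarrow> real) \<Rightarrow> bool" where
  "adaptive s r P0 P1 lo up \<longleftrightarrow>
     (\<exists>L::real. \<forall>\<^sub>F n in sequentially.
        (SUP f\<in>P0 n. expected_diameter n lo up f) \<le> ennreal (L * rate s n) \<and>
        (SUP f\<in>P1 n. expected_diameter n lo up f) \<le> ennreal (L * rate r n))"

end

theory Submission
  imports Defs "HOL-Real_Asymp.Real_Asymp"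
begin

text \<open>
  Upper bounds: at resolution \<open>2 ^ J \<approx> (n / ln n) powr (1 / (2 r + 1))\<close> the linear wavelet
  estimator is within \<open>D * rate r n\<close> of every \<open>f \<in> \<Sigma>(r)\<close> in supremum norm, outside an event of
  probability \<open>D / n\<close> (Bernstein's inequality for each empirical coefficient). The test accepts
  \<open>\<Sigma>(s)\<close> iff this estimator is \<open>D * rate r n\<close>-close to \<open>\<Sigma>(s)\<close>; the band is centred at the
  estimator for smoothness \<open>s\<close> or \<open>r\<close> according to the outcome. The polynomially small error of the
  test keeps the expected diameter over \<open>\<Sigma>(s)\<close> of order \<open>rate s n\<close>.

  Lower bounds: perturbing one density \<open>f0 \<in> \<Sigma>(s)\<close> by a small multiple of one of about \<open>2 ^ J\<close>
  disjointly supported wavelets of level \<open>J\<close> moves it \<open>c * rate r n\<close> away from \<open>\<Sigma>(s)\<close>, but the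
  chi-square divergence between \<open>f0\<close> and the uniform mixture of the perturbed laws tends to 0. A band
  that is honest over the perturbed densities and short under \<open>f0\<close> would tell the two apart. Part (c)
  contains the lower bound of (a), and the upper bound of (b) contains that of (c), by monotonicity.
\<close>

section \<open>Localized wavelet bases\<close>

text \<open>Measurability shapes the upper bounds: closeness to a class, coverage and diameter all
  quantify over uncountable sets. Rounding the empirical coefficient sums to integers leaves the
  estimator countably many values, so every function of it is measurable; the cost 1/n stays below
  the stochastic error. Completeness of the basis is given in L2, while all errors are in supremum
  norm. Decay of the coefficients makes the expansion converge uniformly, and continuity identifies
  its limit. Separation from a smoothness class is read off a single coefficient: an interior
  wavelet of level l has L1 norm of order 2 powr (- l/2), so functions that are close in supremum
  norm have close coefficients. The uniform density cannot serve as f0 in (c), since it lies in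
  \<Sigma>(t) itself. Hence f0 carries one wavelet of a fixed level, with the largest coefficient
  that \<Sigma>(s) allows there. The amplitude of the perturbations is tuned so that the chi-square
  numerator grows at most like n powr \<gamma>, where \<gamma> is half the exponent 1 / (2 r + 1)
  that governs, up to logarithms, the number of perturbations.\<close>

lemma prob_space_leb01: "prob_space leb01"
  by (intro prob_spaceI) (simp add: emeasure_restrict_space space_restrict_space)

lemma space_leb01 [simp]: "space leb01 = {0..1}"
  by (simp add: space_restrict_space)

lemma borel_measurable_leb01:
  fixes f :: "real \<Rightarrow> real"
  assumes "continuous_on {0..1} f"
  shows "f \<in> borel_measurable leb01"
proof -
  have "f \<in> borel_measurable (restrict_space borel {0..1})"
    by (rule borel_measurable_continuous_on_restrict[OF assms])
  then show ?thesis
    by (simp add: measurable_def space_restrict_space sets_restrict_space)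
qed

lemma integrable_leb01:
  fixes f :: "real \<Rightarrow> real"
  assumes "continuous_on {0..1} f"
  shows "integrable leb01 f"
  using borel_integrable_atLeastAtMost'[OF assms]
  by (simp add: integrable_restrict_space set_integrable_def)

lemma LINT_leb01_eq_integral:
  fixes f :: "real \<Rightarrow> real"
  assumes "continuous_on {0..1} f"
  shows "(LINT x|leb01. f x) = integral {0..1} f"
  using set_borel_integral_eq_integral(2)[OF borel_integrable_atLeastAtMost'[OF assms]]
  by (simp add: integral_restrict_space set_lebesgue_integral_def)

lemma LINT_leb01_mono:
  fixes f g :: "real \<Rightarrow> real"
  assumes "continuous_on {0..1} f" "continuous_on {0..1} g" "\<And>x. x \<in> {0..1} \<Longrightarrow> f x \<le> g x"
  shows "(LINT x|leb01. f x) \<le> (LINT x|leb01. g x)"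
  by (rule integral_mono) (use assms in \<open>auto intro: integrable_leb01\<close>)

lemma measure_leb01 [simp]: "measure leb01 {0..1} = 1"
  using prob_space.prob_space[OF prob_space_leb01] by simp

text \<open>Continuity upgrades vanishing almost everywhere to vanishing at every point. This turns
  completeness in L2 into a pointwise statement about the wavelet series.\<close>

lemma LINT_leb01_square_eq_0:
  fixes f :: "real \<Rightarrow> real"
  assumes f: "continuous_on {0..1} f" and 0: "(LINT x|leb01. (f x)\<^sup>2) = 0" and x: "x \<in> {0..1}"
  shows "f x = 0"
proof -
  have c: "continuous_on (cbox 0 1) (\<lambda>x. (f x)\<^sup>2)"
    using f by (auto intro!: continuous_intros)
  have "integral (cbox 0 1) (\<lambda>x. (f x)\<^sup>2) = 0"
    using 0 LINT_leb01_eq_integral[of "\<lambda>x. (f x)\<^sup>2"] c by simp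
  then have "\<forall>x\<in>cbox 0 1. (f x)\<^sup>2 = 0"
    using integral_cbox_eq_0_iff[OF c] by simp
  then show ?thesis using x by simp
qed

text \<open>Counts the translates of one level that can be nonzero at a given point, with
  \<open>y\<close> the point rescaled by \<open>2 ^ l\<close>; the bound does not depend on the
  level.\<close>

lemma card_nat_ball_le:
  fixes y :: real and M :: nat
  assumes "y \<ge> 0"
  shows "finite {k::nat. \<bar>y - real k\<bar> \<le> real M}" "card {k::nat. \<bar>y - real k\<bar> \<le> real M} \<le> 2 * M + 1"
proof -
  \<comment> \<open>The subtraction truncates at 0, which is harmless because \<open>k\<close> is a
    natural number.\<close>
  let ?A = "{nat \<lceil>y\<rceil> - M..nat \<lceil>y\<rceil> + M}"
  have sub: "{k::nat. \<bar>y - real k\<bar> \<le> real M} \<subseteq> ?A"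
  proof
    fix k assume "k \<in> {k::nat. \<bar>y - real k\<bar> \<le> real M}"
    then have "real k \<le> y + real M" "y \<le> real (k + M)" by auto
    then have "real k \<le> real (nat \<lceil>y\<rceil> + M)" "\<lceil>y\<rceil> \<le> int (k + M)"
      using assms by (auto simp: ceiling_le_iff) linarith
    then have "k \<le> nat \<lceil>y\<rceil> + M" "nat \<lceil>y\<rceil> \<le> k + M" by linarith+
    then have "k \<le> nat \<lceil>y\<rceil> + M" "nat \<lceil>y\<rceil> - M \<le> k" by linarith+
    then show "k \<in> ?A" by (simp only: atLeastAtMost_iff)
  qed
  show "finite {k::nat. \<bar>y - real k\<bar> \<le> real M}" by (rule finite_subset[OF sub]) simp
  have "card {k::nat. \<bar>y - real k\<bar> \<le> real M} \<le> card ?A" by (rule card_mono[OF _ sub]) simp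
  also have "\<dots> \<le> 2 * M + 1" by simp
  finally show "card {k::nat. \<bar>y - real k\<bar> \<le> real M} \<le> 2 * M + 1" .
qed

text \<open>At each point at most \<open>4 * M + 1\<close> functions of a level are nonzero: the
  \<open>2 * M\<close> edge functions and at most \<open>2 * M + 1\<close> interior translates. Each
  is at most \<open>b * 2 powr (l / 2)\<close>.\<close>

lemma sum_boundary_corrected_le:
  fixes g :: "real \<Rightarrow> real"
  assumes x: "x \<in> {0..1}"
    and supp: "\<And>x. x \<notin> {1 - real M..real M} \<Longrightarrow> g x = 0"
    and g: "\<And>x. \<bar>g x\<bar> \<le> b"
    and gL: "\<And>k x. k \<in> {1..M} \<Longrightarrow> \<bar>gL k x\<bar> \<le> b"
    and gR: "\<And>k x. k \<in> {1..M} \<Longrightarrow> \<bar>gR k x\<bar> \<le> b"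
  shows "(\<Sum>k\<in>{1..2 ^ l}. \<bar>boundary_corrected M g gL gR l k x\<bar>) \<le> (4 * real M + 1) * b * 2 powr (l / 2)"
proof -
  let ?y = "2 ^ l * x"
  have b: "b \<ge> 0" using g[of 0] by linarith
  define A where "A = {k::nat. \<bar>?y - real k\<bar> \<le> real M}"
  have y: "?y \<ge> 0" using x by simp
  let ?S = "{1..M} \<union> {2 ^ l + 1 - M..2 ^ l} \<union> A"
  have fin: "finite ?S" using card_nat_ball_le(1)[OF y] by (auto simp: A_def)
  have "card ?S \<le> card {1..M} + card {2 ^ l + 1 - M..2 ^ l} + card A"
    using card_Un_le[of "{1..M} \<union> {2 ^ l + 1 - M..2 ^ l}" A] card_Un_le[of "{1..M}" "{2 ^ l + 1 - M..2 ^ l}"]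
    by linarith
  also have "\<dots> \<le> M + M + (2 * M + 1)"
    using card_nat_ball_le(2)[OF y, of M] unfolding A_def by (intro add_mono) auto
  finally have card: "real (card ?S) \<le> 4 * M + 1" by linarith
  have bnd: "\<bar>boundary_corrected M g gL gR l k x\<bar> \<le> 2 powr (l / 2) * b" if "k \<in> {1..2 ^ l}" for k
  proof -
    have "2 ^ l + 1 - k \<in> {1..M}" if "\<not> k + M \<le> 2 ^ l" using that \<open>k \<in> {1..2 ^ l}\<close> by auto
    then show ?thesis
      using that g gL[of k] gR[of "2 ^ l + 1 - k"] unfolding boundary_corrected_def
      by (auto simp: abs_mult simp del: Suc_diff_le intro!: mult_left_mono)
  qed
  have zero: "boundary_corrected M g gL gR l k x = 0" if "k \<in> {1..2 ^ l}" "k \<notin> ?S" for k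
  proof -
    have "k \<notin> A" "\<not> k \<le> M" "k + M \<le> 2 ^ l" using that by auto
    \<comment> \<open>Index \<open>k\<close> belongs to the translate by k - 1, so the support
      \<open>{1 - M..M}\<close> of \<open>g\<close> forces -M <= y - k <= M - 1.\<close>
    moreover have "g (?y - (real k - 1)) = 0"
      using \<open>k \<notin> A\<close> by (intro supp) (auto simp: A_def abs_le_iff)
    ultimately show ?thesis by (simp add: boundary_corrected_def)
  qed
  have "(\<Sum>k\<in>{1..2 ^ l}. \<bar>boundary_corrected M g gL gR l k x\<bar>)
      = (\<Sum>k\<in>{1..2 ^ l} \<inter> ?S. \<bar>boundary_corrected M g gL gR l k x\<bar>)"
    by (rule sum.mono_neutral_right) (use zero in auto)
  also have "\<dots> \<le> (\<Sum>k\<in>{1..2 ^ l} \<inter> ?S. 2 powr (l / 2) * b)"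
    by (rule sum_mono) (use bnd in auto)
  also have "\<dots> \<le> (\<Sum>k\<in>?S. 2 powr (l / 2) * b)"
    by (rule sum_mono2[OF fin]) (use b in auto)
  also have "\<dots> \<le> (4 * real M + 1) * (2 powr (l / 2) * b)"
    using card b by (simp add: mult_right_mono)
  finally show ?thesis by (simp add: algebra_simps)
qed

lemma continuous_on_boundary_corrected:
  fixes g :: "real \<Rightarrow> real"
  assumes "continuous_on UNIV g" "\<And>k. k \<in> {1..M} \<Longrightarrow> continuous_on UNIV (gL k)"
    "\<And>k. k \<in> {1..M} \<Longrightarrow> continuous_on UNIV (gR k)" "k \<in> {1..2 ^ l}"
  shows "continuous_on A (boundary_corrected M g gL gR l k)"
proof -
  have *: "continuous_on A (\<lambda>x. h (a * x + c))" if "continuous_on UNIV h" for h :: "real \<Rightarrow> real" and a c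
    by (rule continuous_on_compose2[OF that]) (auto intro!: continuous_intros)
  have "continuous_on A (\<lambda>x. gL k (2 ^ l * x))" if "k \<le> M"
    using *[of "gL k" "2 ^ l" 0] assms that by auto
  moreover have "continuous_on A (\<lambda>x. g (2 ^ l * x - (real k - 1)))"
    using *[OF assms(1), of "2 ^ l" "1 - real k"] by (simp add: algebra_simps)
  moreover have "continuous_on A (\<lambda>x. gR (2 ^ l + 1 - k) (2 ^ l * (x - 1)))" if "\<not> k \<le> M" "\<not> k + M \<le> 2 ^ l"
  proof -
    have "2 ^ l + 1 - k \<in> {1..M}" using that assms(4) by auto
    from *[OF assms(3)[OF this], of "2 ^ l" "- (2 ^ l)"] show ?thesis by (simp add: algebra_simps)
  qed
  ultimately show ?thesis
    unfolding boundary_corrected_def[abs_def]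
    by (cases "k \<le> M"; cases "k + M \<le> 2 ^ l") (auto intro!: continuous_intros)
qed

lemma shift_span_bounded:
  assumes "g \<in> shift_span a \<phi>" "\<And>x. \<bar>\<phi> x\<bar> \<le> b"
  shows "\<exists>b'. \<forall>x. \<bar>g x\<bar> \<le> b'"
proof -
  obtain A c where g: "finite A" "g = (\<lambda>x. \<Sum>m\<in>A. c m * \<phi> (a * x - of_int (m::int)))"
    using assms(1) by (auto simp: shift_span_def)
  have "\<bar>g x\<bar> \<le> (\<Sum>m\<in>A. \<bar>c m\<bar> * b)" for x
    unfolding g(2) using assms(2)
    by (intro order_trans[OF sum_abs] sum_mono) (auto simp: abs_mult intro: mult_left_mono)
  then show ?thesis by blast
qed

lemma shift_span_continuous:
  assumes "g \<in> shift_span a \<phi>" "continuous_on UNIV \<phi>"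
  shows "continuous_on UNIV g"
proof -
  obtain A c where g: "finite A" "g = (\<lambda>x. \<Sum>m\<in>A. c m * \<phi> (a * x - of_int (m::int)))"
    using assms(1) by (auto simp: shift_span_def)
  show ?thesis unfolding g(2)
    by (intro continuous_intros continuous_on_compose2[OF assms(2)]) auto
qed

lemma daubechies_wavelet_in_shift_span: "daubechies_wavelet M h \<phi> \<in> shift_span 2 \<phi>"
proof -
  have "finite {1 - int M..int M}" "daubechies_wavelet M h \<phi> =
    (\<lambda>x. \<Sum>k\<in>{1 - int M..int M}. (sqrt 2 * ((-1) powi k * h (1 - k))) * \<phi> (2 * x - of_int k))"
    by (auto simp: daubechies_wavelet_def[abs_def] sum_distrib_left mult.assoc)
  then show ?thesis unfolding shift_span_def by (intro CollectI exI conjI)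
qed

text \<open>If \<open>2 * x - k\<close> and \<open>k\<close> both lie in \<open>{1 - M..M}\<close>,
  then so does their average \<open>x\<close>.\<close>

lemma daubechies_wavelet_support:
  assumes supp: "\<And>x. x \<notin> {1 - real M..real M} \<Longrightarrow> \<phi> x = 0" and x: "x \<notin> {1 - real M..real M}"
  shows "daubechies_wavelet M h \<phi> x = 0"
proof -
  have "\<phi> (2 * x - of_int k) = 0" if "k \<in> {1 - int M..int M}" for k
  proof (rule supp)
    have "1 - real M \<le> of_int k" "of_int k \<le> real M" using that by auto
    then show "2 * x - of_int k \<notin> {1 - real M..real M}" using x by auto
  qed
  then show ?thesis by (simp add: daubechies_wavelet_def)
qed

text \<open>The few properties of the wavelet basis on which the argument rests; \<open>C\<close> bounds the
  \<open>\<ell>\<^sub>1\<close>-norms over one level, and the interior wavelets live on intervals of length \<open>2 M / 2 ^ l\<close>.\<close>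

locale localized_wavelets =
  fixes W :: wavelet_system and M :: nat and C :: real
  assumes M_pos: "M \<ge> 1" and C_ge_1: "C \<ge> 1"
    and continuous_scal: "k \<in> {1..num_scal W} \<Longrightarrow> continuous_on {0..1} (scal W k)"
    and continuous_wav: "l \<ge> base_level W \<Longrightarrow> k \<in> {1..2 ^ l} \<Longrightarrow> continuous_on {0..1} (wav W l k)"
    and sum_scal_le: "x \<in> {0..1} \<Longrightarrow> (\<Sum>k\<in>{1..num_scal W}. \<bar>scal W k x\<bar>) \<le> C"
    and sum_wav_le: "x \<in> {0..1} \<Longrightarrow> l \<ge> base_level W \<Longrightarrow>
      (\<Sum>k\<in>{1..2 ^ l}. \<bar>wav W l k x\<bar>) \<le> C * 2 powr (l / 2)"
    and LINT_wav: "l \<ge> base_level W \<Longrightarrow> k \<in> {1..2 ^ l} \<Longrightarrow> (LINT x|leb01. wav W l k x) = 0"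
    and wav_support: "l \<ge> base_level W \<Longrightarrow> M < k \<Longrightarrow> k + M \<le> 2 ^ l \<Longrightarrow> x \<in> {0..1} \<Longrightarrow>
      wav W l k x \<noteq> 0 \<Longrightarrow> \<bar>2 ^ l * x - real k\<bar> \<le> real M"
    and basis: "orthonormal_basis_L2 W"

text \<open>Differentiability makes \<phi> continuous and compact support makes it bounded. Both
  properties pass to the finitely many functions from which all levels arise by dilation and
  translation, so one constant serves every level.\<close>

lemma daubechies_basis_localized:
  assumes W: "daubechies_basis S W" and S: "S > 0"
  shows "\<exists>M C. localized_wavelets W M C"
proof -
  obtain M h \<phi> \<phi>L \<phi>R \<psi>L \<psi>R where
    filter: "daubechies_filter M h" and scaling: "daubechies_scaling M h \<phi>"
    and smooth: "times_cont_diff S \<phi>" and N: "num_scal W = 2 ^ base_level W"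
    and edge0: "\<forall>k\<in>{1..M}. \<phi>L k \<in> shift_span 1 \<phi> \<and> \<phi>R k \<in> shift_span 1 \<phi> \<and>
                     \<psi>L k \<in> shift_span 2 \<phi> \<and> \<psi>R k \<in> shift_span 2 \<phi>"
    and scal0: "\<forall>k\<in>{1..num_scal W}. \<forall>x\<in>{0..1}.
       scal W k x = boundary_corrected M \<phi> \<phi>L \<phi>R (base_level W) k x"
    and wav0: "\<forall>l\<ge>base_level W. \<forall>k\<in>{1..2 ^ l}. \<forall>x\<in>{0..1}.
       wav W l k x = boundary_corrected M (daubechies_wavelet M h \<phi>) \<psi>L \<psi>R l k x"
    and mom0: "\<forall>l\<ge>base_level W. \<forall>k\<in>{1..2 ^ l}. \<forall>p<M. (LINT x|leb01. x ^ p * wav W l k x) = 0"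
    and basis: "orthonormal_basis_L2 W"
    using W unfolding daubechies_basis_def by (elim exE conjE) (rule that)
  note scal = scal0[rule_format] and wav = wav0[rule_format] and mom = mom0[rule_format]
  have edge: "\<phi>L k \<in> shift_span 1 \<phi>" "\<phi>R k \<in> shift_span 1 \<phi>"
      "\<psi>L k \<in> shift_span 2 \<phi>" "\<psi>R k \<in> shift_span 2 \<phi>" if "k \<in> {1..M}" for k
    using edge0 that by blast+
  have M: "M \<ge> 1" using filter by (simp add: daubechies_filter_def)
  have supp: "\<phi> x = 0" if "x \<notin> {1 - real M..real M}" for x
    using scaling that unfolding daubechies_scaling_def by blast
  have cont: "continuous_on UNIV \<phi>"
  proof (intro continuous_at_imp_continuous_on ballI field_differentiable_imp_continuous_at)
    fix x show "\<phi> field_differentiable at x"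
      using smooth S unfolding times_cont_diff_def by (metis funpow_0)
  qed
  have "bounded (\<phi> ` {1 - real M..real M})"
    by (intro compact_imp_bounded compact_continuous_image continuous_on_subset[OF cont]) auto
  then obtain b0 where b0: "\<And>x. x \<in> {1 - real M..real M} \<Longrightarrow> \<bar>\<phi> x\<bar> \<le> b0"
    unfolding bounded_iff by (metis imageI real_norm_def)
  have b0': "\<bar>\<phi> x\<bar> \<le> max 0 b0" for x using b0[of x] supp[of x] by fastforce
  let ?\<psi> = "daubechies_wavelet M h \<phi>"
  have \<psi>: "?\<psi> \<in> shift_span 2 \<phi>" by (rule daubechies_wavelet_in_shift_span)
  define F where "F = {\<phi>, ?\<psi>} \<union> \<phi>L ` {1..M} \<union> \<phi>R ` {1..M} \<union> \<psi>L ` {1..M} \<union> \<psi>R ` {1..M}"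
  have F_cases: "g = \<phi> \<or> g \<in> shift_span 1 \<phi> \<or> g \<in> shift_span 2 \<phi>" if "g \<in> F" for g
    using that edge \<psi> by (auto simp: F_def)
  have F_cont: "continuous_on UNIV g" if "g \<in> F" for g
    using F_cases[OF that] shift_span_continuous[of g 1 \<phi>] shift_span_continuous[of g 2 \<phi>] cont by auto
  have "\<exists>b. \<forall>x. \<bar>g x\<bar> \<le> b" if "g \<in> F" for g
    using F_cases[OF that] shift_span_bounded[of g 1 \<phi>, OF _ b0'] shift_span_bounded[of g 2 \<phi>, OF _ b0']
    by (elim disjE) (use b0' in auto)
  then have "\<forall>g\<in>F. \<exists>b. \<forall>x. \<bar>g x\<bar> \<le> b" by blast
  from bchoice[OF this] obtain bd where bd: "\<And>g x. g \<in> F \<Longrightarrow> \<bar>g x\<bar> \<le> bd g" by auto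
  define b where "b = (\<Sum>g\<in>F. \<bar>bd g\<bar>)"
  have "finite F" by (simp add: F_def)
  then have b: "\<bar>g x\<bar> \<le> b" if "g \<in> F" for g x
    using bd[OF that, of x] member_le_sum[of g F "\<lambda>g. \<bar>bd g\<bar>"] that by (auto simp: b_def)
  \<comment> \<open>The first summand serves the scaling functions, which live at the fixed base
    level, the second serves the wavelets, and the final 1 gives \<open>C \<ge> 1\<close>.\<close>
  define C where "C = (4 * real M + 1) * b * 2 powr (base_level W / 2) + (4 * real M + 1) * b + 1"
  have bpos: "b \<ge> 0" by (simp add: b_def sum_nonneg)
  have inF: "\<phi> \<in> F" "?\<psi> \<in> F" "\<And>k. k \<in> {1..M} \<Longrightarrow> \<phi>L k \<in> F" "\<And>k. k \<in> {1..M} \<Longrightarrow> \<phi>R k \<in> F"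
    "\<And>k. k \<in> {1..M} \<Longrightarrow> \<psi>L k \<in> F" "\<And>k. k \<in> {1..M} \<Longrightarrow> \<psi>R k \<in> F"
    by (auto simp: F_def)
  have "localized_wavelets W M C"
  proof
    show "continuous_on {0..1} (scal W k)" if "k \<in> {1..num_scal W}" for k
      using scal[OF that] continuous_on_boundary_corrected[of \<phi> M \<phi>L \<phi>R k "base_level W" "{0..1}"] inF F_cont that
      by (subst continuous_on_cong[OF refl]) (auto simp: N)
    show "continuous_on {0..1} (wav W l k)" if "l \<ge> base_level W" "k \<in> {1..2 ^ l}" for l k
      using wav[OF that] continuous_on_boundary_corrected[of ?\<psi> M \<psi>L \<psi>R k l "{0..1}"] inF F_cont that
      by (subst continuous_on_cong[OF refl]) auto
    show "(\<Sum>k\<in>{1..num_scal W}. \<bar>scal W k x\<bar>) \<le> C" if "x \<in> {0..1}" for x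
    proof -
      have "(\<Sum>k\<in>{1..num_scal W}. \<bar>scal W k x\<bar>)
          = (\<Sum>k\<in>{1..2 ^ base_level W}. \<bar>boundary_corrected M \<phi> \<phi>L \<phi>R (base_level W) k x\<bar>)"
        using scal that by (intro sum.cong) (auto simp: N)
      also have "\<dots> \<le> (4 * real M + 1) * b * 2 powr (base_level W / 2)"
        by (intro sum_boundary_corrected_le[OF that] supp b inF)
      also have "\<dots> \<le> C" using bpos by (simp add: C_def)
      finally show ?thesis .
    qed
    show "(\<Sum>k\<in>{1..2 ^ l}. \<bar>wav W l k x\<bar>) \<le> C * 2 powr (l / 2)" if "x \<in> {0..1}" "l \<ge> base_level W" for x l
    proof -
      have "(\<Sum>k\<in>{1..2 ^ l}. \<bar>wav W l k x\<bar>)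
          = (\<Sum>k\<in>{1..2 ^ l}. \<bar>boundary_corrected M ?\<psi> \<psi>L \<psi>R l k x\<bar>)"
        using wav that by (intro sum.cong) auto
      also have "\<dots> \<le> (4 * real M + 1) * b * 2 powr (l / 2)"
        by (intro sum_boundary_corrected_le[OF that(1)] daubechies_wavelet_support[OF supp] b inF)
      also have "\<dots> \<le> C * 2 powr (l / 2)" using bpos by (intro mult_right_mono) (auto simp: C_def)
      finally show ?thesis .
    qed
    show "(LINT x|leb01. wav W l k x) = 0" if "l \<ge> base_level W" "k \<in> {1..2 ^ l}" for l k
      \<comment> \<open>The moment of order 0, available because \<open>M \<ge> 1\<close>.\<close>
      using mom[OF that, of 0] M by simp
    show "\<bar>2 ^ l * x - real k\<bar> \<le> real M"
      if "l \<ge> base_level W" "M < k" "k + M \<le> 2 ^ l" "x \<in> {0..1}" "wav W l k x \<noteq> 0" for l k x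
    proof -
      have "wav W l k x = 2 powr (l / 2) * ?\<psi> (2 ^ l * x - (real k - 1))"
        using wav[of l k x] that by (simp add: boundary_corrected_def)
      then have "2 ^ l * x - (real k - 1) \<in> {1 - real M..real M}"
        using that daubechies_wavelet_support[OF supp, where x="2 ^ l * x - (real k - 1)"] by fastforce
      then show ?thesis by auto
    qed
  qed (use M basis bpos in \<open>auto simp: C_def\<close>)
  then show ?thesis by blast
qed

section \<open>Wavelet expansions\<close>

text \<open>\<open>None\<close> tags the scaling functions and \<open>Some l\<close> the wavelets of
  level \<open>l\<close>, so that a truncated basis is one finite family and sums over it need no
  case split.\<close>

definition elem :: "wavelet_system \<Rightarrow> nat option \<times> nat \<Rightarrow> real \<Rightarrow> real" where
  "elem W i = (case fst i of None \<Rightarrow> scal W (snd i) | Some l \<Rightarrow> wav W l (snd i))"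

definition coeff :: "wavelet_system \<Rightarrow> nat option \<times> nat \<Rightarrow> (real \<Rightarrow> real) \<Rightarrow> real" where
  "coeff W i f = (LINT x|leb01. f x * elem W i x)"

definition idx :: "wavelet_system \<Rightarrow> nat \<Rightarrow> (nat option \<times> nat) set" where
  "idx W J = Pair None ` {1..num_scal W} \<union> (\<Union>l\<in>{base_level W..<J}. Pair (Some l) ` {1..2 ^ l})"

lemma finite_idx [simp]: "finite (idx W J)"
  by (auto simp: idx_def)

lemma sum_idx:
  fixes h :: "nat option \<times> nat \<Rightarrow> 'a::comm_monoid_add"
  shows "(\<Sum>i\<in>idx W J. h i) =
    (\<Sum>k\<in>{1..num_scal W}. h (None, k)) + (\<Sum>l\<in>{base_level W..<J}. \<Sum>k\<in>{1..2 ^ l}. h (Some l, k))"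
proof -
  have "(\<Sum>i\<in>idx W J. h i) = (\<Sum>i\<in>Pair None ` {1..num_scal W}. h i)
      + (\<Sum>i\<in>(\<Union>l\<in>{base_level W..<J}. Pair (Some l) ` {1..2 ^ l}). h i)"
    unfolding idx_def by (intro sum.union_disjoint) auto
  also have "(\<Sum>i\<in>(\<Union>l\<in>{base_level W..<J}. Pair (Some l) ` {1..2 ^ l}). h i)
      = (\<Sum>l\<in>{base_level W..<J}. \<Sum>i\<in>Pair (Some l) ` {1..2 ^ l}. h i)"
    by (intro sum.UNION_disjoint) auto
  finally show ?thesis by (simp add: sum.reindex inj_on_def)
qed

lemma wavelet_partial_sum_eq: "wavelet_partial_sum W J f x = (\<Sum>i\<in>idx W J. coeff W i f * elem W i x)"
  by (simp add: wavelet_partial_sum_def sum_idx coeff_def elem_def scal_coeff_def wav_coeff_def)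

lemma card_idx_le: "card (idx W J) \<le> num_scal W + 2 ^ J"
proof -
  have "card (idx W J) = num_scal W + (\<Sum>l\<in>{base_level W..<J}. 2 ^ l)"
    using sum_idx[of "\<lambda>_. 1::nat" W J] by simp
  also have "(\<Sum>l\<in>{base_level W..<J}. 2 ^ l) \<le> (\<Sum>l\<in>{..<J}. (2::nat) ^ l)"
    by (rule sum_mono2) auto
  also have "\<dots> \<le> 2 ^ J" by (induction J) auto
  finally show ?thesis by simp
qed

text \<open>A geometric sum of ratio sqrt 2. The induction step needs 3 + 1 <= 3 * sqrt 2, which is
  (4/3)^2 <= 2.\<close>

lemma sum_powr_half_le: "(\<Sum>l<J. 2 powr (real l / 2)) \<le> 3 * 2 powr (real J / 2)"
proof (induction J)
  case (Suc J)
  have "(4/3)^2 \<le> (2::real)" by (simp add: power2_eq_square)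
  then have "4/3 \<le> sqrt 2" by (intro real_le_rsqrt)
  then have "4/3 \<le> 2 powr (1/2 :: real)" by (simp add: powr_half_sqrt)
  then have "2 powr (real J / 2) * 4 \<le> 2 powr (real J / 2) * (3 * 2 powr (1/2))"
    by (intro mult_left_mono) auto
  also have "\<dots> = 3 * 2 powr (real (Suc J) / 2)"
    by (simp add: powr_add[symmetric] add_divide_distrib add.commute)
  finally show ?case using Suc by simp
qed simp

context localized_wavelets
begin

lemma continuous_elem: "i \<in> idx W J \<Longrightarrow> continuous_on {0..1} (elem W i)"
  by (auto simp: idx_def elem_def intro!: continuous_scal continuous_wav)

text \<open>The levels grow geometrically, so the top one dominates. This bound is what converts a
  uniform error of the coefficients into an error in supremum norm.\<close>

lemma sum_elem_le:
  assumes x: "x \<in> {0..1}"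
  shows "(\<Sum>i\<in>idx W J. \<bar>elem W i x\<bar>) \<le> 4 * C * 2 powr (J / 2)"
proof -
  have "(\<Sum>i\<in>idx W J. \<bar>elem W i x\<bar>) \<le> C + (\<Sum>l\<in>{base_level W..<J}. C * 2 powr (real l / 2))"
    unfolding sum_idx elem_def by (intro add_mono sum_mono) (auto intro!: sum_scal_le[OF x] sum_wav_le[OF x] simp del: One_nat_def)
  also have "(\<Sum>l\<in>{base_level W..<J}. C * 2 powr (real l / 2)) \<le> (\<Sum>l<J. C * 2 powr (real l / 2))"
    by (rule sum_mono2) (use C_ge_1 in auto)
  also have "\<dots> \<le> C * (3 * 2 powr (J / 2))"
    unfolding sum_distrib_left[symmetric] using sum_powr_half_le C_ge_1 by (intro mult_left_mono) auto
  finally have "(\<Sum>i\<in>idx W J. \<bar>elem W i x\<bar>) \<le> C + C * (3 * 2 powr (J / 2))" by simp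
  moreover have "C \<le> C * 2 powr (J / 2)" using C_ge_1 by (simp add: ge_one_powr_ge_zero)
  ultimately show ?thesis by (simp add: algebra_simps)
qed

lemma abs_elem_le:
  assumes "x \<in> {0..1}" "i \<in> idx W J"
  shows "\<bar>elem W i x\<bar> \<le> 4 * C * 2 powr (J / 2)"
  using sum_elem_le[OF assms(1), of J] member_le_sum[OF assms(2), of "\<lambda>i. \<bar>elem W i x\<bar>"] by simp

lemma abs_wav_le:
  assumes "x \<in> {0..1}" "l \<ge> base_level W" "k \<in> {1..2 ^ l}"
  shows "\<bar>wav W l k x\<bar> \<le> C * 2 powr (l / 2)"
  using sum_wav_le[OF assms(1,2)] member_le_sum[OF assms(3), of "\<lambda>k. \<bar>wav W l k x\<bar>"] by simp

lemma LINT_elem_square: "i \<in> idx W J \<Longrightarrow> (LINT x|leb01. (elem W i x)\<^sup>2) = 1"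
  using basis by (auto simp: idx_def elem_def orthonormal_basis_L2_def power2_eq_square)

lemma LINT_wav_wav:
  assumes "l \<ge> base_level W" "l' \<ge> base_level W" "k \<in> {1..2 ^ l}" "k' \<in> {1..2 ^ l'}"
  shows "(LINT x|leb01. wav W l k x * wav W l' k' x) = (if l = l' \<and> k = k' then 1 else 0)"
  using basis assms unfolding orthonormal_basis_L2_def by blast

lemma LINT_scal_wav:
  assumes "l \<ge> base_level W" "k \<in> {1..num_scal W}" "k' \<in> {1..2 ^ l}"
  shows "(LINT x|leb01. scal W k x * wav W l k' x) = 0"
  using basis assms unfolding orthonormal_basis_L2_def by blast

lemma holder_class_cont: "f \<in> holder_class W B s \<Longrightarrow> continuous_on {0..1} f"
  by (simp add: holder_class_def cont_densities_def)

lemma holder_class_scal_coeff: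
  assumes "f \<in> holder_class W B s" "k \<in> {1..num_scal W}" "B \<ge> 0"
  shows "\<bar>scal_coeff W k f\<bar> \<le> B"
proof -
  have "(SUP k\<in>{1..num_scal W}. ennreal \<bar>scal_coeff W k f\<bar>) \<le> ennreal B"
    using assms(1) by (simp add: holder_class_def holder_norm_def)
  then have "ennreal \<bar>scal_coeff W k f\<bar> \<le> ennreal B" using assms(2) by (metis SUP_le_iff)
  then show ?thesis using assms(3) by simp
qed

lemma holder_class_wav_coeff:
  assumes "f \<in> holder_class W B s" "l \<ge> base_level W" "k \<in> {1..2 ^ l}" "B \<ge> 0"
  shows "\<bar>wav_coeff W l k f\<bar> \<le> B * 2 powr (- (real l * (s + 1/2)))"
proof -
  have "(SUP l\<in>{base_level W..}. SUP k\<in>{1..2 ^ l}.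
            ennreal (2 powr (real l * (s + 1/2)) * \<bar>wav_coeff W l k f\<bar>)) \<le> ennreal B"
    using assms(1) by (simp add: holder_class_def holder_norm_def)
  then have "ennreal (2 powr (real l * (s + 1/2)) * \<bar>wav_coeff W l k f\<bar>) \<le> ennreal B"
    using assms(2,3) by (metis (no_types, lifting) SUP_le_iff atLeast_iff)
  then have "2 powr (real l * (s + 1/2)) * \<bar>wav_coeff W l k f\<bar> \<le> B" using assms(4) by simp
  then have "\<bar>wav_coeff W l k f\<bar> \<le> B / 2 powr (real l * (s + 1/2))"
    by (simp add: pos_le_divide_eq mult.commute)
  then show ?thesis by (simp only: powr_minus divide_inverse)
qed

lemma holder_classI:
  assumes "f \<in> cont_densities" "\<And>k. k \<in> {1..num_scal W} \<Longrightarrow> \<bar>scal_coeff W k f\<bar> \<le> B"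
    "\<And>l k. l \<ge> base_level W \<Longrightarrow> k \<in> {1..2 ^ l} \<Longrightarrow> \<bar>wav_coeff W l k f\<bar> \<le> B * 2 powr (- (real l * (s + 1/2)))"
  shows "f \<in> holder_class W B s"
proof -
  have "2 powr (real l * (s + 1/2)) * \<bar>wav_coeff W l k f\<bar> \<le> B"
    if "l \<ge> base_level W" "k \<in> {1..2 ^ l}" for l k
  proof -
    have "\<bar>wav_coeff W l k f\<bar> \<le> B / 2 powr (real l * (s + 1/2))"
      using assms(3)[OF that] by (simp only: powr_minus divide_inverse)
    then show ?thesis by (simp add: pos_le_divide_eq mult.commute)
  qed
  then show ?thesis
    using assms(1,2) by (auto simp: holder_class_def holder_norm_def intro!: SUP_least ennreal_leI)
qed

lemma holder_class_mono:
  assumes "r \<le> s" "B \<ge> 0"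
  shows "holder_class W B s \<subseteq> holder_class W B r"
proof
  fix f assume f: "f \<in> holder_class W B s"
  show "f \<in> holder_class W B r"
  proof (rule holder_classI)
    show "f \<in> cont_densities" using f by (simp add: holder_class_def)
    show "\<bar>scal_coeff W k f\<bar> \<le> B" if "k \<in> {1..num_scal W}" for k
      using holder_class_scal_coeff[OF f that assms(2)] .
    show "\<bar>wav_coeff W l k f\<bar> \<le> B * 2 powr (- (real l * (r + 1/2)))"
      if "l \<ge> base_level W" "k \<in> {1..2 ^ l}" for l k
    proof -
      have "B * 2 powr (- (real l * (s + 1/2))) \<le> B * 2 powr (- (real l * (r + 1/2)))"
        using assms by (intro mult_left_mono powr_mono) (auto intro!: mult_left_mono)
      with holder_class_wav_coeff[OF f that assms(2)] show ?thesis by linarith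
    qed
  qed
qed

text \<open>The decay of the coefficients times the sum of the wavelets of a level gives
  \<open>B * C * q ^ l\<close> with q = 2 powr (- r). The series therefore converges uniformly with
  a geometric remainder, and its continuous limit \<open>g\<close> is \<open>f\<close> because the
  partial sums also converge to \<open>f\<close> in L2.\<close>

lemma wavelet_approximation:
  assumes f: "f \<in> holder_class W B r" and r: "r > 0" and B: "B \<ge> 0" and J: "J \<ge> base_level W"
    and x: "x \<in> {0..1}"
  shows "\<bar>f x - wavelet_partial_sum W J f x\<bar> \<le> B * C / (1 - 2 powr (- r)) * 2 powr (- (r * J))"
proof -
  define q where "q = 2 powr (- r)"
  have q: "0 < q" "q < 1" using r by (auto simp: q_def powr_less_one)
  have qpow: "2 powr (- (r * real j)) = q ^ j" for j
    by (simp add: q_def powr_powr powr_realpow[symmetric] mult.commute)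
  \<comment> \<open>Extended by 0 below the base level, so that the series starts at index
    0.\<close>
  define a where "a l x = (if l \<ge> base_level W then \<Sum>k\<in>{1..2 ^ l}. wav_coeff W l k f * wav W l k x else 0)" for l x
  have a_le: "\<bar>a l x\<bar> \<le> B * C * q ^ l" if "x \<in> {0..1}" for l x
  proof (cases "l \<ge> base_level W")
    case True
    have "\<bar>a l x\<bar> \<le> (\<Sum>k\<in>{1..2 ^ l}. (B * 2 powr (- (real l * (r + 1/2)))) * \<bar>wav W l k x\<bar>)"
      unfolding a_def using True holder_class_wav_coeff[OF f True _ B]
      by (auto intro!: order_trans[OF sum_abs] sum_mono mult_right_mono simp: abs_mult)
    also have "\<dots> \<le> (B * 2 powr (- (real l * (r + 1/2)))) * (C * 2 powr (l / 2))"
      unfolding sum_distrib_left[symmetric] using sum_wav_le[OF that True] B by (intro mult_left_mono) auto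
    also have "\<dots> = B * C * (2 powr (- (real l * (r + 1/2))) * 2 powr (l / 2))" by simp
    also have "2 powr (- (real l * (r + 1/2))) * 2 powr (l / 2) = q ^ l"
      unfolding qpow[symmetric] powr_add[symmetric] by (simp add: algebra_simps)
    finally show ?thesis .
  qed (use B C_ge_1 q in \<open>auto simp: a_def\<close>)
  have sum_q: "summable (\<lambda>l. B * C * q ^ l)" using q by (intro summable_mult) simp
  have unif: "uniform_limit {0..1} (\<lambda>n x. \<Sum>i<n. a i x) (\<lambda>x. \<Sum>i. a i x) sequentially"
    by (rule Weierstrass_m_test[OF _ sum_q]) (use a_le in simp)
  define h where "h x = (\<Sum>k\<in>{1..num_scal W}. scal_coeff W k f * scal W k x)" for x
  define g where "g x = h x + (\<Sum>i. a i x)" for x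
  have cont_a: "continuous_on {0..1} (a l)" for l
    unfolding a_def[abs_def]
    by (cases "base_level W \<le> l") (auto intro!: continuous_intros continuous_wav)
  have cont_h: "continuous_on {0..1} h"
    unfolding h_def[abs_def] by (auto intro!: continuous_intros continuous_scal)
  have cont_g: "continuous_on {0..1} g"
    unfolding g_def[abs_def] using unif cont_a
    by (intro continuous_intros cont_h uniform_limit_theorem[OF _ unif]) (auto intro!: always_eventually continuous_intros)
  have ps: "wavelet_partial_sum W j f x = h x + (\<Sum>i<j. a i x)" if "j \<ge> base_level W" for j x
  proof -
    have "(\<Sum>i<j. a i x) = (\<Sum>i\<in>{base_level W..<j}. a i x)"
      by (intro sum.mono_neutral_right) (auto simp: a_def)
    then show ?thesis by (simp add: wavelet_partial_sum_def h_def a_def)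
  qed
  have tail: "\<bar>g x - wavelet_partial_sum W j f x\<bar> \<le> B * C / (1 - q) * q ^ j"
    if "j \<ge> base_level W" "x \<in> {0..1}" for j x
  proof -
    have sa: "summable (\<lambda>i. a i x)"
      by (rule summable_comparison_test'[OF sum_q, of 0]) (use a_le that in auto)
    have "g x - wavelet_partial_sum W j f x = (\<Sum>i. a (i + j) x)"
      using suminf_minus_initial_segment[OF sa, of j] by (simp add: g_def ps[OF that(1)])
    also have "\<bar>\<dots>\<bar> \<le> (\<Sum>i. B * C * q ^ j * q ^ i)"
    proof -
      have s': "summable (\<lambda>i. B * C * q ^ j * q ^ i)" using q by (intro summable_mult) simp
      have le: "norm (a (i + j) x) \<le> B * C * q ^ j * q ^ i" for i
        using a_le[OF that(2), of "i + j"] by (simp add: power_add mult_ac)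
      show ?thesis using norm_suminf_le[OF le s'] by simp
    qed
    also have "\<dots> = B * C / (1 - q) * q ^ j"
      using q by (subst suminf_mult) (auto simp: suminf_geometric)
    finally show ?thesis .
  qed
  have cont_f: "continuous_on {0..1} f" by (rule holder_class_cont[OF f])
  have cont_p: "continuous_on {0..1} (wavelet_partial_sum W j f)" for j
    unfolding wavelet_partial_sum_def[abs_def]
    by (auto intro!: continuous_intros continuous_wav continuous_scal)
  have L2: "(\<lambda>j. LINT x|leb01. (f x - wavelet_partial_sum W j f x)\<^sup>2) \<longlonglongrightarrow> 0"
  proof -
    have "integrable leb01 (\<lambda>x. (f x)\<^sup>2)" by (intro integrable_leb01 continuous_intros cont_f)
    then show ?thesis
      using basis borel_measurable_leb01[OF cont_f] unfolding orthonormal_basis_L2_def by blast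
  qed
  \<comment> \<open>The squared distance is at most twice the sum of the squared distances of
    \<open>f\<close> and \<open>g\<close> from a common partial sum; the first tends to 0 by
    completeness, the second by \<open>tail\<close>.\<close>
  have "(LINT x|leb01. (f x - g x)\<^sup>2) \<le> 0"
  proof (rule LIMSEQ_le_const)
    show "(\<lambda>j. 2 * (LINT x|leb01. (f x - wavelet_partial_sum W j f x)\<^sup>2) + 2 * (B * C / (1 - q) * q ^ j)\<^sup>2) \<longlonglongrightarrow> 0"
    proof -
      have "(\<lambda>j. q ^ j) \<longlonglongrightarrow> 0" using q by (intro LIMSEQ_power_zero) auto
      from tendsto_power[OF tendsto_mult[OF tendsto_const this], of "B * C / (1 - q)" 2]
      have "(\<lambda>j. (B * C / (1 - q) * q ^ j)\<^sup>2) \<longlonglongrightarrow> 0" by simp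
      from tendsto_add[OF tendsto_mult[OF tendsto_const L2] tendsto_mult[OF tendsto_const this], of 2 2]
      show ?thesis by simp
    qed
    show "\<exists>N. \<forall>j\<ge>N. (LINT x|leb01. (f x - g x)\<^sup>2)
        \<le> 2 * (LINT x|leb01. (f x - wavelet_partial_sum W j f x)\<^sup>2) + 2 * (B * C / (1 - q) * q ^ j)\<^sup>2"
    proof (intro exI[of _ "base_level W"] allI impI)
      fix j assume j: "base_level W \<le> j"
      let ?p = "wavelet_partial_sum W j f"
      have "(LINT x|leb01. (f x - g x)\<^sup>2)
          \<le> (LINT x|leb01. 2 * (f x - ?p x)\<^sup>2 + 2 * (B * C / (1 - q) * q ^ j)\<^sup>2)"
      proof (rule LINT_leb01_mono)
        fix x :: real assume x: "x \<in> {0..1}"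
        have "(g x - ?p x)\<^sup>2 \<le> (B * C / (1 - q) * q ^ j)\<^sup>2"
          using tail[OF j x] by (metis abs_ge_zero power2_abs power_mono)
        moreover have "(f x - g x)\<^sup>2 \<le> 2 * (f x - ?p x)\<^sup>2 + 2 * (g x - ?p x)\<^sup>2"
          using zero_le_power2[of "f x - ?p x + (g x - ?p x)"] by (simp add: power2_eq_square algebra_simps)
        ultimately show "(f x - g x)\<^sup>2 \<le> 2 * (f x - ?p x)\<^sup>2 + 2 * (B * C / (1 - q) * q ^ j)\<^sup>2" by linarith
      qed (intro continuous_intros cont_f cont_g cont_p)+
      also have "\<dots> = 2 * (LINT x|leb01. (f x - ?p x)\<^sup>2) + 2 * (B * C / (1 - q) * q ^ j)\<^sup>2"
        by (subst Bochner_Integration.integral_add)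
          (auto intro!: integrable_leb01 continuous_intros cont_f cont_p)
      finally show "(LINT x|leb01. (f x - g x)\<^sup>2)
          \<le> 2 * (LINT x|leb01. (f x - ?p x)\<^sup>2) + 2 * (B * C / (1 - q) * q ^ j)\<^sup>2" .
    qed
  qed
  moreover have "(LINT x|leb01. (f x - g x)\<^sup>2) \<ge> 0" by simp
  ultimately have "(LINT x|leb01. (f x - g x)\<^sup>2) = 0" by linarith
  then have "f x - g x = 0"
    by (rule LINT_leb01_square_eq_0[of "\<lambda>x. f x - g x", rotated]) (intro x continuous_intros cont_f cont_g)+
  then have "f x = g x" by simp
  then show ?thesis using tail[OF J x] unfolding qpow by (simp only: q_def)
qed

text \<open>The supremum norm of the scaling part plus the remainder of
  \<open>wavelet_approximation\<close> at the base level, with its decaying factor bounded by 1. It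
  later acts as the variance bound in Bernstein's inequality.\<close>

definition density_bound :: "real \<Rightarrow> real \<Rightarrow> real" where
  "density_bound B r = B * C + B * C / (1 - 2 powr (- r))"

lemma density_bound_nonneg: "r > 0 \<Longrightarrow> B \<ge> 0 \<Longrightarrow> density_bound B r \<ge> 0"
  using C_ge_1 powr_less_one[of 2 "- r"] by (auto simp: density_bound_def intro!: add_nonneg_nonneg divide_nonneg_nonneg)

lemma holder_class_bounded:
  assumes f: "f \<in> holder_class W B r" and r: "r > 0" and B: "B \<ge> 0" and x: "x \<in> {0..1}"
  shows "f x \<le> density_bound B r"
proof -
  have "\<bar>wavelet_partial_sum W (base_level W) f x\<bar> \<le> (\<Sum>k\<in>{1..num_scal W}. B * \<bar>scal W k x\<bar>)"
    unfolding wavelet_partial_sum_def using holder_class_scal_coeff[OF f _ B]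
    by (auto intro!: order_trans[OF sum_abs] sum_mono mult_right_mono simp: abs_mult)
  also have "\<dots> \<le> B * C"
    unfolding sum_distrib_left[symmetric] using sum_scal_le[OF x] B by (intro mult_left_mono) auto
  finally have 1: "\<bar>wavelet_partial_sum W (base_level W) f x\<bar> \<le> B * C" .
  have q: "2 powr (- r) < 1" using r by (intro powr_less_one) auto
  have "\<bar>f x - wavelet_partial_sum W (base_level W) f x\<bar>
      \<le> B * C / (1 - 2 powr (- r)) * 2 powr (- (r * base_level W))"
    by (rule wavelet_approximation[OF f r B order_refl x])
  also have "\<dots> \<le> B * C / (1 - 2 powr (- r)) * 1"
    using q B C_ge_1 r powr_mono[of "- (r * base_level W)" 0 2]
    by (intro mult_left_mono) (auto intro!: divide_nonneg_nonneg)
  finally show ?thesis using 1 unfolding density_bound_def by linarith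
qed

text \<open>Height \<open>C * 2 powr (l / 2)\<close> times support length
  \<open>2 * M / 2 ^ l\<close>; for an interior index the supporting interval stays inside
  \<open>{0..1}\<close>.\<close>

lemma LINT_abs_wav_le:
  assumes l: "l \<ge> base_level W" and k: "M < k" "k + M \<le> 2 ^ l"
  shows "(LINT x|leb01. \<bar>wav W l k x\<bar>) \<le> 2 * M * C * 2 powr (- (l / 2))"
proof -
  let ?I = "{(real k - real M) / 2 ^ l..(real k + real M) / 2 ^ l}"
  have kr: "real M \<le> real k" "real k + real M \<le> 2 ^ l"
    using k of_nat_mono[OF k(2), where 'a=real] by auto
  have sub: "?I \<subseteq> {0..1}" using kr by (auto simp: divide_simps)
  have "(LINT x|leb01. \<bar>wav W l k x\<bar>) \<le> (LINT x|leb01. C * 2 powr (l / 2) * indicator ?I x)"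
  proof (rule integral_mono)
    show "integrable leb01 (\<lambda>x. \<bar>wav W l k x\<bar>)"
      using l k by (intro integrable_leb01 continuous_intros continuous_wav) auto
    have "?I \<in> sets leb01" using sub by (simp add: sets_restrict_space_iff)
    then show "integrable leb01 (\<lambda>x. C * 2 powr (l / 2) * indicator ?I x)"
      using sub by (intro integrable_mult_right integrable_real_indicator)
        (auto simp: emeasure_restrict_space emeasure_lborel_Icc_eq)
    show "\<bar>wav W l k x\<bar> \<le> C * 2 powr (l / 2) * indicator ?I x" if "x \<in> space leb01" for x
    proof (cases "wav W l k x = 0")
      case True then show ?thesis using C_ge_1 by simp
    next
      case False
      have x: "x \<in> {0..1}" using that by simp
      have "\<bar>2 ^ l * x - real k\<bar> \<le> real M" by (rule wav_support[OF l k x False])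
      then have "x \<in> ?I" by (auto simp: field_simps abs_le_iff)
      then show ?thesis using abs_wav_le[OF x l, of k] k by simp
    qed
  qed
  also have "\<dots> = C * 2 powr (l / 2) * measure leb01 ?I"
    by (simp only: integral_mult_right_zero Bochner_Integration.integral_indicator space_leb01 Int_absorb2[OF sub])
  also have "measure leb01 ?I = 2 * M / 2 ^ l"
    using sub by (subst measure_restrict_space) (auto simp: divide_right_mono diff_divide_distrib[symmetric])
  also have "C * 2 powr (l / 2) * (2 * M / 2 ^ l) = 2 * M * C * (2 powr (l / 2) * 2 powr (- real l))"
  proof -
    have "2 powr (- real l) = 1 / 2 ^ l" by (simp only: powr_minus powr_realpow inverse_eq_divide zero_less_numeral)
    then show ?thesis by (simp only:) simp
  qed
  also have "2 powr (l / 2) * 2 powr (- real l) = 2 powr (- (l / 2))"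
    by (simp add: powr_add[symmetric])
  finally show ?thesis .
qed

text \<open>Hoelder's inequality, pairing the supremum norm of the difference with the L1 norm of
  the wavelet.\<close>

lemma wav_coeff_diff_le:
  assumes l: "l \<ge> base_level W" and k: "M < k" "k + M \<le> 2 ^ l"
    and cont: "continuous_on {0..1} f" "continuous_on {0..1} g"
    and D: "\<And>x. x \<in> {0..1} \<Longrightarrow> \<bar>f x - g x\<bar> \<le> D"
  shows "\<bar>wav_coeff W l k f - wav_coeff W l k g\<bar> \<le> D * (2 * M * C * 2 powr (- (l / 2)))"
proof -
  have cw: "continuous_on {0..1} (wav W l k)" using l k by (intro continuous_wav) auto
  have "wav_coeff W l k f - wav_coeff W l k g = (LINT x|leb01. (f x - g x) * wav W l k x)"
    unfolding wav_coeff_def left_diff_distrib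
    by (rule Bochner_Integration.integral_diff[symmetric]) (intro integrable_leb01 continuous_intros cont cw)+
  also have "\<bar>\<dots>\<bar> \<le> (LINT x|leb01. \<bar>(f x - g x) * wav W l k x\<bar>)"
    by (rule integral_abs_bound)
  also have "\<dots> \<le> (LINT x|leb01. D * \<bar>wav W l k x\<bar>)"
    using D by (intro LINT_leb01_mono continuous_intros cont cw) (auto simp: abs_mult mult_right_mono)
  also have "\<dots> \<le> D * (2 * M * C * 2 powr (- (l / 2)))"
    using LINT_abs_wav_le[OF l k] D[of 0] by (simp add: mult_left_mono)
  finally show ?thesis .
qed

text \<open>By \<open>large\<close>, the coefficient of \<open>g\<close> is at most half that of
  \<open>f\<close>. If \<open>g\<close> were closer than claimed, the two would differ by at most a
  quarter of it. The 8 combines this quarter with the factor 2 in the L1 norm.\<close>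

lemma wav_coeff_separation:
  assumes l: "l \<ge> base_level W" and k: "M < k" "k + M \<le> 2 ^ l"
    and cont: "continuous_on {0..1} f" and B: "B > 0"
    and large: "wav_coeff W l k f \<ge> 2 * (B * 2 powr (- (real l * (s + 1/2))))"
    and g: "g \<in> holder_class W B s"
  shows "sup_dist g f \<ge> ennreal (wav_coeff W l k f * 2 powr (l / 2) / (8 * M * C))"
proof (rule ccontr)
  define D where "D = wav_coeff W l k f * 2 powr (l / 2) / (8 * M * C)"
  have pos: "wav_coeff W l k f > 0"
    using large B by (intro less_le_trans[OF _ large]) simp
  assume "\<not> ?thesis"
  then have lt: "sup_dist g f < ennreal D" by (simp add: D_def)
  have "\<bar>f x - g x\<bar> \<le> D" if "x \<in> {0..1}" for x
  proof -
    have "ennreal \<bar>g x - f x\<bar> \<le> sup_dist g f" unfolding sup_dist_def by (rule SUP_upper[OF that])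
    also note lt
    finally show ?thesis by (simp add: ennreal_less_iff abs_minus_commute)
  qed
  then have "\<bar>wav_coeff W l k f - wav_coeff W l k g\<bar> \<le> D * (2 * M * C * 2 powr (- (l / 2)))"
    by (intro wav_coeff_diff_le[OF l k cont holder_class_cont[OF g]])
  also have "\<dots> = wav_coeff W l k f / 4"
    using M_pos C_ge_1 by (simp add: D_def powr_minus)
  finally have "\<bar>wav_coeff W l k f - wav_coeff W l k g\<bar> \<le> wav_coeff W l k f / 4" .
  moreover have "\<bar>wav_coeff W l k g\<bar> \<le> wav_coeff W l k f / 2"
    using holder_class_wav_coeff[OF g l, of k] k B large by auto
  ultimately show False using pos by linarith
qed

end

section \<open>Deviations of the empirical coefficients\<close>

text \<open>For negative \<open>z\<close>, (1 + z + z^2) * (1 - z) = 1 - z^3 is at least 1, whereas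
  exp z * (1 - z) is at most 1.\<close>

lemma exp_le_quadratic:
  fixes z :: real
  assumes "\<bar>z\<bar> \<le> 1"
  shows "exp z \<le> 1 + z + z\<^sup>2"
proof (cases "z \<ge> 0")
  case True then show ?thesis using exp_bound[of z] assms by simp
next
  case False
  then have z: "z < 0" by simp
  have "exp z * (1 - z) \<le> exp z * exp (- z)"
    using exp_ge_add_one_self[of "- z"] by (intro mult_left_mono) auto
  also have "\<dots> = 1" by (simp add: exp_minus)
  also have "1 \<le> (1 + z + z\<^sup>2) * (1 - z)"
  proof -
    have "z * z * z \<le> 0" using z by (simp add: mult_nonneg_nonpos)
    then show ?thesis by (simp add: algebra_simps power2_eq_square)
  qed
  finally show ?thesis using z by (simp add: mult_le_cancel_right_pos)
qed

text \<open>The centred variable is at most 2 b in absolute value, so the condition on \<delta>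
  keeps the exponent in the range of \<open>exp_le_quadratic\<close>. The linear term then
  integrates to 0 and the quadratic one to at most \<open>\<delta>\<^sup>2 * v\<close>.\<close>

lemma (in prob_space) mgf_le:
  fixes g :: "'a \<Rightarrow> real" and b v \<delta> :: real
  assumes g[measurable]: "g \<in> borel_measurable M" and bnd: "\<And>x. x \<in> space M \<Longrightarrow> \<bar>g x\<bar> \<le> b"
    and v: "expectation (\<lambda>x. (g x)\<^sup>2) \<le> v" and \<delta>: "0 < \<delta>" "2 * b * \<delta> \<le> 1"
  shows "(\<integral>\<^sup>+x. ennreal (exp (\<delta> * (g x - expectation g))) \<partial>M) \<le> ennreal (exp (\<delta>\<^sup>2 * v))"
proof -
  define \<mu> where "\<mu> = expectation g"
  have int_g: "integrable M g" by (rule integrable_const_bound[of _ b]) (use bnd in auto)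
  have int_g2: "integrable M (\<lambda>x. (g x)\<^sup>2)"
    by (rule integrable_const_bound[of _ "b\<^sup>2"]) (use bnd in \<open>auto intro!: AE_I2 simp: abs_le_square_iff[symmetric] dest: order_trans[OF _ abs_ge_self]\<close>)
  have \<mu>: "\<bar>\<mu>\<bar> \<le> b"
  proof -
    have "\<bar>\<mu>\<bar> \<le> expectation (\<lambda>x. \<bar>g x\<bar>)" unfolding \<mu>_def by (rule integral_abs_bound)
    also have "\<dots> \<le> expectation (\<lambda>x. b)"
      by (rule integral_mono) (use int_g bnd in auto)
    finally show ?thesis by (simp add: prob_space)
  qed
  have quad: "exp (\<delta> * (g x - \<mu>)) \<le> 1 + \<delta> * (g x - \<mu>) + \<delta>\<^sup>2 * (g x - \<mu>)\<^sup>2" if "x \<in> space M" for x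
  proof -
    have "\<bar>g x - \<mu>\<bar> \<le> 2 * b" using bnd[OF that] \<mu> by linarith
    then have "\<bar>\<delta> * (g x - \<mu>)\<bar> \<le> \<delta> * (2 * b)" using \<delta> by (simp add: abs_mult)
    then show ?thesis using exp_le_quadratic[of "\<delta> * (g x - \<mu>)"] \<delta> by (simp add: power_mult_distrib mult_ac)
  qed
  have int_q: "integrable M (\<lambda>x. 1 + \<delta> * (g x - \<mu>) + \<delta>\<^sup>2 * (g x - \<mu>)\<^sup>2)"
    using int_g int_g2 by (auto simp: power2_diff intro!: Bochner_Integration.integrable_add Bochner_Integration.integrable_diff integrable_mult_right)
  have "(\<integral>\<^sup>+x. ennreal (exp (\<delta> * (g x - \<mu>))) \<partial>M)
      \<le> (\<integral>\<^sup>+x. ennreal (1 + \<delta> * (g x - \<mu>) + \<delta>\<^sup>2 * (g x - \<mu>)\<^sup>2) \<partial>M)"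
    by (intro nn_integral_mono ennreal_leI quad)
  also have "\<dots> = ennreal (expectation (\<lambda>x. 1 + \<delta> * (g x - \<mu>) + \<delta>\<^sup>2 * (g x - \<mu>)\<^sup>2))"
    using quad by (intro nn_integral_eq_integral[OF int_q] AE_I2) (metis exp_ge_zero order_trans)
  finally have 1: "(\<integral>\<^sup>+x. ennreal (exp (\<delta> * (g x - \<mu>))) \<partial>M)
      \<le> ennreal (expectation (\<lambda>x. 1 + \<delta> * (g x - \<mu>) + \<delta>\<^sup>2 * (g x - \<mu>)\<^sup>2))" .
  have "expectation (\<lambda>x. 1 + \<delta> * (g x - \<mu>) + \<delta>\<^sup>2 * (g x - \<mu>)\<^sup>2) = 1 + \<delta>\<^sup>2 * (expectation (\<lambda>x. (g x)\<^sup>2) - \<mu>\<^sup>2)"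
    using int_g int_g2 by (simp add: power2_diff prob_space \<mu>_def[symmetric] algebra_simps) (simp add: power2_eq_square)
  also have "\<dots> \<le> 1 + \<delta>\<^sup>2 * v"
    using v by (intro add_mono mult_left_mono) (auto intro: order_trans[OF _ v])
  also have "\<dots> \<le> exp (\<delta>\<^sup>2 * v)" by (rule exp_ge_add_one_self)
  finally show ?thesis using 1 by (simp add: \<mu>_def) (meson ennreal_leI order_trans)
qed

text \<open>Chernoff's method: Markov's inequality for the exponential of \<delta> times the centred
  sum, whose integral factors by independence. The threshold is tied to the same \<delta>, so
  nothing has to be optimised afterwards.\<close>

lemma bernstein_upper:
  fixes g :: "'a \<Rightarrow> real" and b v \<delta> \<kappa> :: real
  assumes Q: "prob_space Q" and g[measurable]: "g \<in> borel_measurable Q"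
    and bnd: "\<And>x. x \<in> space Q \<Longrightarrow> \<bar>g x\<bar> \<le> b" and v: "(\<integral>x. (g x)\<^sup>2 \<partial>Q) \<le> v"
    and \<delta>: "0 < \<delta>" "2 * b * \<delta> \<le> 1" and I: "finite I"
  shows "emeasure (\<Pi>\<^sub>M i\<in>I. Q) {X \<in> space (\<Pi>\<^sub>M i\<in>I. Q). (\<Sum>i\<in>I. g (X i) - (\<integral>x. g x \<partial>Q)) \<ge> card I * (\<kappa> * \<delta>)}
    \<le> ennreal (exp (card I * \<delta>\<^sup>2 * (v - \<kappa>)))"
proof -
  interpret Q: prob_space Q by fact
  interpret product_sigma_finite "\<lambda>_. Q" by standard
  define Y where "Y x = g x - (\<integral>x. g x \<partial>Q)" for x
  have [measurable]: "Y \<in> borel_measurable Q" by (simp add: Y_def[abs_def])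
  let ?P = "\<Pi>\<^sub>M i\<in>I. Q"
  have "emeasure ?P {X \<in> space ?P. (\<Sum>i\<in>I. Y (X i)) \<ge> card I * (\<kappa> * \<delta>)}
      \<le> emeasure ?P ({X \<in> space ?P. 1 \<le> ennreal (exp (- (card I * \<delta>\<^sup>2 * \<kappa>))) * (\<Prod>i\<in>I. ennreal (exp (\<delta> * Y (X i))))} \<inter> space ?P)"
  proof (intro emeasure_mono subsetI)
    fix X assume X: "X \<in> {X \<in> space ?P. (\<Sum>i\<in>I. Y (X i)) \<ge> card I * (\<kappa> * \<delta>)}"
    have "\<delta> * (card I * (\<kappa> * \<delta>)) \<le> \<delta> * (\<Sum>i\<in>I. Y (X i))"
      using X \<delta> by (intro mult_left_mono) auto
    then have "1 \<le> exp (- (card I * \<delta>\<^sup>2 * \<kappa>) + \<delta> * (\<Sum>i\<in>I. Y (X i)))"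
      by (simp add: power2_eq_square mult_ac)
    also have "\<dots> = exp (- (card I * \<delta>\<^sup>2 * \<kappa>)) * (\<Prod>i\<in>I. exp (\<delta> * Y (X i)))"
      by (simp only: exp_add exp_sum[OF I] sum_distrib_left)
    finally have "ennreal 1 \<le> ennreal (exp (- (card I * \<delta>\<^sup>2 * \<kappa>)) * (\<Prod>i\<in>I. exp (\<delta> * Y (X i))))"
      by (rule ennreal_leI)
    also have "\<dots> = ennreal (exp (- (card I * \<delta>\<^sup>2 * \<kappa>))) * (\<Prod>i\<in>I. ennreal (exp (\<delta> * Y (X i))))"
      by (simp add: ennreal_mult prod_nonneg prod_ennreal)
    finally show "X \<in> {X \<in> space ?P. 1 \<le> ennreal (exp (- (card I * \<delta>\<^sup>2 * \<kappa>))) * (\<Prod>i\<in>I. ennreal (exp (\<delta> * Y (X i))))} \<inter> space ?P"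
      using X by simp
  qed measurable
  also have "\<dots> \<le> ennreal (exp (- (card I * \<delta>\<^sup>2 * \<kappa>))) * (\<integral>\<^sup>+X. (\<Prod>i\<in>I. ennreal (exp (\<delta> * Y (X i)))) \<partial>?P)"
  proof -
    have [measurable]: "(\<lambda>X. \<Prod>i\<in>I. ennreal (exp (\<delta> * Y (X i)))) \<in> borel_measurable ?P" by measurable
    have "emeasure ?P ({X \<in> space ?P. 1 \<le> ennreal (exp (- (card I * \<delta>\<^sup>2 * \<kappa>))) * (\<Prod>i\<in>I. ennreal (exp (\<delta> * Y (X i))))} \<inter> space ?P)
      = emeasure ?P ({X \<in> space ?P. 1 \<le> ennreal (exp (- (card I * \<delta>\<^sup>2 * \<kappa>))) * (\<Prod>i\<in>I. ennreal (exp (\<delta> * Y (X i))))})"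
      by (rule arg_cong[where f="emeasure ?P"]) auto
    also have "\<dots> \<le> ennreal (exp (- (card I * \<delta>\<^sup>2 * \<kappa>))) * (\<integral>\<^sup>+X. (\<Prod>i\<in>I. ennreal (exp (\<delta> * Y (X i)))) * indicator (space ?P) X \<partial>?P)"
      by (rule nn_integral_Markov_inequality) measurable
    also have "(\<integral>\<^sup>+X. (\<Prod>i\<in>I. ennreal (exp (\<delta> * Y (X i)))) * indicator (space ?P) X \<partial>?P)
        = (\<integral>\<^sup>+X. (\<Prod>i\<in>I. ennreal (exp (\<delta> * Y (X i)))) \<partial>?P)"
      by (intro nn_integral_cong) simp
    finally show ?thesis .
  qed
  also have "(\<integral>\<^sup>+X. (\<Prod>i\<in>I. ennreal (exp (\<delta> * Y (X i)))) \<partial>?P) = (\<Prod>i\<in>I. \<integral>\<^sup>+x. ennreal (exp (\<delta> * Y x)) \<partial>Q)"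
    by (rule product_nn_integral_prod[OF I]) measurable
  also have "ennreal (exp (- (card I * \<delta>\<^sup>2 * \<kappa>))) * \<dots>
      \<le> ennreal (exp (- (card I * \<delta>\<^sup>2 * \<kappa>))) * (\<Prod>i\<in>I. ennreal (exp (\<delta>\<^sup>2 * v)))"
    using Q.mgf_le[OF g bnd v \<delta>] by (intro mult_left_mono prod_mono) (auto simp: Y_def intro!: power_mono)
  also have "\<dots> = ennreal (exp (- (card I * \<delta>\<^sup>2 * \<kappa>)) * exp (\<delta>\<^sup>2 * v) ^ card I)"
    by (simp add: ennreal_mult ennreal_power)
  also have "exp (- (card I * \<delta>\<^sup>2 * \<kappa>)) * exp (\<delta>\<^sup>2 * v) ^ card I = exp (card I * \<delta>\<^sup>2 * (v - \<kappa>))"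
    by (simp add: exp_of_nat_mult[symmetric] exp_add[symmetric] algebra_simps)
  finally show ?thesis by (simp add: Y_def)
qed

lemma bernstein:
  fixes g :: "'a \<Rightarrow> real" and b v \<delta> \<kappa> :: real
  assumes Q: "prob_space Q" and g[measurable]: "g \<in> borel_measurable Q"
    and bnd: "\<And>x. x \<in> space Q \<Longrightarrow> \<bar>g x\<bar> \<le> b" and v: "(\<integral>x. (g x)\<^sup>2 \<partial>Q) \<le> v"
    and \<delta>: "0 < \<delta>" "2 * b * \<delta> \<le> 1" and I: "finite I"
  shows "emeasure (\<Pi>\<^sub>M i\<in>I. Q) {X \<in> space (\<Pi>\<^sub>M i\<in>I. Q).
      \<bar>(\<Sum>i\<in>I. g (X i)) - card I * (\<integral>x. g x \<partial>Q)\<bar> \<ge> card I * (\<kappa> * \<delta>)}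
    \<le> ennreal (2 * exp (card I * \<delta>\<^sup>2 * (v - \<kappa>)))"
proof -
  let ?P = "\<Pi>\<^sub>M i\<in>I. Q"
  let ?A = "\<lambda>h. {X \<in> space ?P. (\<Sum>i\<in>I. h (X i) - (\<integral>x. h x \<partial>Q)) \<ge> card I * (\<kappa> * \<delta>)}"
  have [measurable]: "?A g \<in> sets ?P" "?A (\<lambda>x. - g x) \<in> sets ?P" by measurable
  have "emeasure ?P {X \<in> space ?P. \<bar>(\<Sum>i\<in>I. g (X i)) - card I * (\<integral>x. g x \<partial>Q)\<bar> \<ge> card I * (\<kappa> * \<delta>)}
      \<le> emeasure ?P (?A g \<union> ?A (\<lambda>x. - g x))"
    by (rule emeasure_mono) (auto simp: sum_subtractf sum_negf)
  also have "\<dots> \<le> emeasure ?P (?A g) + emeasure ?P (?A (\<lambda>x. - g x))"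
    by (rule emeasure_subadditive) measurable
  also have "\<dots> \<le> ennreal (exp (card I * \<delta>\<^sup>2 * (v - \<kappa>))) + ennreal (exp (card I * \<delta>\<^sup>2 * (v - \<kappa>)))"
    by (intro add_mono bernstein_upper[OF Q _ _ _ \<delta> I]) (use bnd v in auto)
  finally show ?thesis by (simp flip: ennreal_plus)
qed

section \<open>Countably valued statistics\<close>

text \<open>Replaces measurability into a function space, where no sigma-algebra is chosen: with
  countably many values and measurable level sets, the preimage of an arbitrary set is
  measurable.\<close>

definition countably_valued :: "'a measure \<Rightarrow> ('a \<Rightarrow> 'b) \<Rightarrow> bool" where
  "countably_valued M h \<longleftrightarrow> countable (h ` space M) \<and> (\<forall>v. {x \<in> space M. h x = v} \<in> sets M)"

lemma countably_valued_Collect: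
  assumes "countably_valued M h"
  shows "{x \<in> space M. P (h x)} \<in> sets M"
proof -
  have "{x \<in> space M. P (h x)} = (\<Union>v\<in>{v \<in> h ` space M. P v}. {x \<in> space M. h x = v})" by auto
  also have "\<dots> \<in> sets M"
    using assms by (intro sets.countable_UN'') (auto simp: countably_valued_def)
  finally show ?thesis .
qed

lemma countably_valued_compose: "countably_valued M h \<Longrightarrow> countably_valued M (\<lambda>x. F (h x))"
  using countably_valued_Collect[of M h "\<lambda>y. F y = v" for v]
  by (auto simp: countably_valued_def image_image[symmetric])

lemma countably_valued_pair:
  assumes "countably_valued M h" "countably_valued M k"
  shows "countably_valued M (\<lambda>x. (h x, k x))"
  unfolding countably_valued_def
proof
  have "countable (h ` space M \<times> k ` space M)"
    using assms by (auto simp: countably_valued_def)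
  then show "countable ((\<lambda>x. (h x, k x)) ` space M)" by (rule countable_subset[rotated]) auto
  have "{x \<in> space M. (h x, k x) = v} = {x \<in> space M. h x = fst v} \<inter> {x \<in> space M. k x = snd v}" for v
    by auto
  then show "\<forall>v. {x \<in> space M. (h x, k x) = v} \<in> sets M"
    using assms by (auto simp: countably_valued_def)
qed

text \<open>Restricting to a finite \<open>I\<close> confines the values to a finite product of
  countable sets; functions outside \<open>extensional I\<close> are never attained.\<close>

lemma countably_valued_restrict:
  assumes I: "finite I" and h: "\<And>i. i \<in> I \<Longrightarrow> countably_valued M (h i)"
  shows "countably_valued M (\<lambda>x. \<lambda>i\<in>I. h i x)"
  unfolding countably_valued_def
proof
  have "countable (Pi\<^sub>E I (\<lambda>i. h i ` space M))"
    using h by (intro countable_PiE I) (auto simp: countably_valued_def)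
  then show "countable ((\<lambda>x. \<lambda>i\<in>I. h i x) ` space M)" by (rule countable_subset[rotated]) auto
  show "\<forall>v. {x \<in> space M. (\<lambda>i\<in>I. h i x) = v} \<in> sets M"
  proof
    fix v
    show "{x \<in> space M. (\<lambda>i\<in>I. h i x) = v} \<in> sets M"
    proof (cases "v \<in> extensional I")
      case True
      then have "{x \<in> space M. (\<lambda>i\<in>I. h i x) = v} = {x \<in> space M. \<forall>i\<in>I. h i x = v i}"
        by (auto simp: fun_eq_iff restrict_def extensional_def)
      also have "\<dots> \<in> sets M"
        using h I by (intro sets.sets_Collect_finite_All) (auto simp: countably_valued_def)
      finally show ?thesis .
    next
      case False
      then have "{x \<in> space M. (\<lambda>i\<in>I. h i x) = v} = {}" by auto
      then show ?thesis by (simp only: sets.empty_sets)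
    qed
  qed
qed

lemma countably_valued_measurable:
  assumes "countably_valued M h" "\<And>x. x \<in> space M \<Longrightarrow> h x \<in> space N"
  shows "h \<in> measurable M N"
proof (rule measurableI)
  show "h -` A \<inter> space M \<in> sets M" for A
    using countably_valued_Collect[OF assms(1), of "\<lambda>y. y \<in> A"] by (simp add: vimage_def Int_def conj_commute)
qed (use assms in auto)

lemma countably_valued_floor:
  fixes f :: "'a \<Rightarrow> real"
  assumes [measurable]: "f \<in> borel_measurable M"
  shows "countably_valued M (\<lambda>x. \<lfloor>f x\<rfloor>)"
  unfolding countably_valued_def by (auto intro: countable_subset[OF subset_UNIV])

section \<open>The linear wavelet estimator\<close>

lemma density_prob_space:
  assumes "f \<in> cont_densities"
  shows "prob_space (density leb01 (\<lambda>x. ennreal (f x)))"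
proof (rule prob_spaceI)
  have f: "continuous_on {0..1} f" "\<And>x. x \<in> {0..1} \<Longrightarrow> 0 \<le> f x" "(LINT x|leb01. f x) = 1"
    using assms by (auto simp: cont_densities_def)
  have [measurable]: "f \<in> borel_measurable leb01" by (rule borel_measurable_leb01) fact
  have "emeasure (density leb01 (\<lambda>x. ennreal (f x))) (space leb01) = (\<integral>\<^sup>+x. ennreal (f x) \<partial>leb01)"
    using sets.top[of leb01] by (subst emeasure_density) (auto intro!: nn_integral_cong)
  also have "\<dots> = ennreal 1"
    using f integrable_leb01[OF f(1)] by (subst nn_integral_eq_integral) (auto intro!: AE_I2)
  finally show "emeasure (density leb01 (\<lambda>x. ennreal (f x))) (space (density leb01 (\<lambda>x. ennreal (f x)))) = 1"
    by simp
qed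

lemma LINT_density_leb01:
  fixes g :: "real \<Rightarrow> real"
  assumes "f \<in> cont_densities" "continuous_on {0..1} g"
  shows "(LINT x|density leb01 (\<lambda>x. ennreal (f x)). g x) = (LINT x|leb01. f x * g x)"
  using assms by (intro integral_real_density) (auto simp: cont_densities_def intro!: borel_measurable_leb01 AE_I2)

lemma sets_sample_law [simp, measurable_cong]: "sets (sample_law n f) = sets (sample_space n)"
  unfolding sample_law_def sample_space_def by (rule sets_PiM_cong) auto

lemma space_sample_law [simp]: "space (sample_law n f) = space (sample_space n)"
  by (rule sets_eq_imp_space_eq) simp

lemma prob_space_sample_law: "f \<in> cont_densities \<Longrightarrow> prob_space (sample_law n f)"
  unfolding sample_law_def by (intro prob_space_PiM density_prob_space)

definition estimator :: "wavelet_system \<Rightarrow> nat \<Rightarrow> nat \<Rightarrow> (nat \<Rightarrow> real) \<Rightarrow> real \<Rightarrow> real" where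
  "estimator W J n X x =
     (\<Sum>i\<in>idx W J. of_int \<lfloor>\<Sum>j\<in>{1..n}. elem W i (X j)\<rfloor> / real n * elem W i x)"

context localized_wavelets
begin

lemma borel_measurable_elem: "i \<in> idx W J \<Longrightarrow> elem W i \<in> borel_measurable leb01"
  by (intro borel_measurable_leb01 continuous_elem)

text \<open>Rounding the empirical coefficients costs \<open>1 / n\<close> and makes every function of the
  estimator measurable.\<close>

lemma countably_valued_estimator: "countably_valued (sample_space n) (estimator W J n)"
proof -
  let ?q = "\<lambda>X. \<lambda>i\<in>idx W J. \<lfloor>\<Sum>j\<in>{1..n}. elem W i (X j)\<rfloor>"
  have "countably_valued (sample_space n) ?q"
  proof (intro countably_valued_restrict countably_valued_floor finite_idx)
    fix i assume "i \<in> idx W J"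
    then have [measurable]: "elem W i \<in> borel_measurable leb01" by (rule borel_measurable_elem)
    show "(\<lambda>X. \<Sum>j\<in>{1..n}. elem W i (X j)) \<in> borel_measurable (sample_space n)"
      unfolding sample_space_def by measurable
  qed
  from countably_valued_compose[OF this, of "\<lambda>q x. \<Sum>i\<in>idx W J. of_int (q i) / real n * elem W i x"]
  show ?thesis unfolding estimator_def[abs_def] by (simp cong: sum.cong)
qed

text \<open>Basis functions have unit L2 norm, so their second moment under a bounded density does
  not grow with the level, although their supremum norm does.\<close>

lemma LINT_elem_square_le:
  assumes f: "f \<in> holder_class W B r" "r > 0" "B \<ge> 0" and i: "i \<in> idx W J"
  shows "(LINT x|density leb01 (\<lambda>x. ennreal (f x)). (elem W i x)\<^sup>2) \<le> density_bound B r"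
proof -
  have fc: "f \<in> cont_densities" using f by (simp add: holder_class_def)
  have ce: "continuous_on {0..1} (elem W i)" by (rule continuous_elem[OF i])
  have "(LINT x|density leb01 (\<lambda>x. ennreal (f x)). (elem W i x)\<^sup>2) = (LINT x|leb01. f x * (elem W i x)\<^sup>2)"
    by (intro LINT_density_leb01 fc continuous_intros ce)
  also have "\<dots> \<le> (LINT x|leb01. density_bound B r * (elem W i x)\<^sup>2)"
    by (intro LINT_leb01_mono continuous_intros holder_class_cont[OF f(1)] ce mult_right_mono
        holder_class_bounded[OF f] zero_le_power2)
  also have "\<dots> = density_bound B r" by (simp add: LINT_elem_square[OF i])
  finally show ?thesis .
qed

text \<open>A union bound over the coefficients. Off the exceptional events each rounded coefficient
  errs by at most \<open>\<kappa> * \<delta> + 1 / n\<close>, which \<open>sum_elem_le\<close> turns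
  into an error in supremum norm; the last term is the truncation bias.\<close>

lemma estimator_error:
  assumes f: "f \<in> holder_class W B r" "r > 0" "B \<ge> 0" and J: "J \<ge> base_level W" and n: "n > 0"
    and \<delta>: "\<delta> > 0" "\<kappa> \<ge> 0" "2 * (4 * C * 2 powr (J / 2)) * \<delta> \<le> 1"
  shows "emeasure (sample_law n f) {X \<in> space (sample_space n). \<not> (\<forall>x\<in>{0..1}.
      \<bar>estimator W J n X x - f x\<bar> \<le> (\<kappa> * \<delta> + 1 / n) * (4 * C * 2 powr (J / 2))
         + B * C / (1 - 2 powr (- r)) * 2 powr (- (r * J)))}
    \<le> ennreal (2 * card (idx W J) * exp (n * \<delta>\<^sup>2 * (density_bound B r - \<kappa>)))"
proof -
  let ?Q = "density leb01 (\<lambda>x. ennreal (f x))"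
  have fc: "f \<in> cont_densities" using f by (simp add: holder_class_def)
  interpret Q: prob_space ?Q by (rule density_prob_space[OF fc])
  define S where "S i X = (\<Sum>j\<in>{1..n}. elem W i (X j))" for i and X :: "nat \<Rightarrow> real"
  define E where "E i = {X \<in> space (sample_law n f). \<bar>S i X - n * coeff W i f\<bar> \<ge> n * (\<kappa> * \<delta>)}" for i
  have E: "emeasure (sample_law n f) (E i) \<le> ennreal (2 * exp (n * \<delta>\<^sup>2 * (density_bound B r - \<kappa>)))"
    and E_sets: "E i \<in> sets (sample_law n f)" if i: "i \<in> idx W J" for i
  proof -
    have m[measurable]: "elem W i \<in> borel_measurable ?Q"
      using borel_measurable_elem[OF i] by simp
    have "coeff W i f = (LINT x|?Q. elem W i x)"
      by (simp add: coeff_def LINT_density_leb01[OF fc continuous_elem[OF i]])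
    then show "emeasure (sample_law n f) (E i) \<le> ennreal (2 * exp (n * \<delta>\<^sup>2 * (density_bound B r - \<kappa>)))"
      using bernstein[OF Q.prob_space_axioms m _ LINT_elem_square_le[OF f i] \<delta>(1,3) finite_atLeastAtMost[of 1 n], of \<kappa>]
        abs_elem_le[OF _ i]
      unfolding E_def S_def sample_law_def by simp
    show "E i \<in> sets (sample_law n f)" unfolding E_def S_def sample_law_def by measurable
  qed
  have "emeasure (sample_law n f) {X \<in> space (sample_space n). \<not> (\<forall>x\<in>{0..1}.
      \<bar>estimator W J n X x - f x\<bar> \<le> (\<kappa> * \<delta> + 1 / n) * (4 * C * 2 powr (J / 2))
         + B * C / (1 - 2 powr (- r)) * 2 powr (- (r * J)))}
    \<le> emeasure (sample_law n f) (\<Union>i\<in>idx W J. E i)"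
  proof (intro emeasure_mono subsetI)
    show "(\<Union>i\<in>idx W J. E i) \<in> sets (sample_law n f)" using E_sets by auto
    fix X assume X: "X \<in> {X \<in> space (sample_space n). \<not> (\<forall>x\<in>{0..1}.
      \<bar>estimator W J n X x - f x\<bar> \<le> (\<kappa> * \<delta> + 1 / n) * (4 * C * 2 powr (J / 2))
         + B * C / (1 - 2 powr (- r)) * 2 powr (- (r * J)))}"
    show "X \<in> (\<Union>i\<in>idx W J. E i)"
    proof (rule ccontr)
      assume "X \<notin> (\<Union>i\<in>idx W J. E i)"
      then have good: "\<bar>S i X - n * coeff W i f\<bar> < n * (\<kappa> * \<delta>)" if "i \<in> idx W J" for i
        using that X by (force simp: E_def)
      have dev: "\<bar>of_int \<lfloor>S i X\<rfloor> / n - coeff W i f\<bar> \<le> \<kappa> * \<delta> + 1 / n" if "i \<in> idx W J" for i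
      proof -
        have "\<bar>of_int \<lfloor>S i X\<rfloor> - n * coeff W i f\<bar> \<le> n * (\<kappa> * \<delta>) + 1"
          using good[OF that] of_int_floor_le[of "S i X"] real_of_int_floor_add_one_gt[of "S i X"] by linarith
        also have "\<dots> = n * (\<kappa> * \<delta> + 1 / n)" using n by (simp add: field_simps)
        finally have "\<bar>n * (of_int \<lfloor>S i X\<rfloor> / n - coeff W i f)\<bar> \<le> n * (\<kappa> * \<delta> + 1 / n)"
          using n by (simp add: right_diff_distrib)
        then show ?thesis using n by (simp add: abs_mult)
      qed
      have "\<bar>estimator W J n X x - f x\<bar> \<le> (\<kappa> * \<delta> + 1 / n) * (4 * C * 2 powr (J / 2))
         + B * C / (1 - 2 powr (- r)) * 2 powr (- (r * J))" if x: "x \<in> {0..1}" for x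
      proof -
        have "\<bar>estimator W J n X x - wavelet_partial_sum W J f x\<bar>
            = \<bar>\<Sum>i\<in>idx W J. (of_int \<lfloor>S i X\<rfloor> / n - coeff W i f) * elem W i x\<bar>"
          by (simp add: estimator_def wavelet_partial_sum_eq S_def sum_subtractf[symmetric] left_diff_distrib)
        also have "\<dots> \<le> (\<Sum>i\<in>idx W J. (\<kappa> * \<delta> + 1 / n) * \<bar>elem W i x\<bar>)"
          using dev by (intro order_trans[OF sum_abs] sum_mono) (auto simp: abs_mult intro: mult_right_mono)
        also have "\<dots> \<le> (\<kappa> * \<delta> + 1 / n) * (4 * C * 2 powr (J / 2))"
          unfolding sum_distrib_left[symmetric] using \<delta> by (intro mult_left_mono sum_elem_le[OF x]) auto
        finally show ?thesis using wavelet_approximation[OF f J x] by linarith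
      qed
      then show False using X by auto
    qed
  qed
  also have "\<dots> \<le> (\<Sum>i\<in>idx W J. emeasure (sample_law n f) (E i))"
    using E_sets by (intro emeasure_subadditive_finite) auto
  also have "\<dots> \<le> (\<Sum>i\<in>idx W J. ennreal (2 * exp (n * \<delta>\<^sup>2 * (density_bound B r - \<kappa>))))"
    by (intro sum_mono E)
  also have "\<dots> = ennreal (2 * card (idx W J) * exp (n * \<delta>\<^sup>2 * (density_bound B r - \<kappa>)))"
    by (simp add: ennreal_of_nat_eq_real_of_nat ennreal_mult'[symmetric] mult_ac)
  finally show ?thesis .
qed

end

section \<open>Resolution levels, rates and the supremum-norm risk of the estimator\<close>

definition level :: "real \<Rightarrow> nat \<Rightarrow> nat" where
  "level r n = nat \<lfloor>log 2 ((ln (real n) / real n) powr (- 1 / (2 * r + 1)))\<rfloor>"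

text \<open>The threshold 3 is the first integer above exp 1, so that ln n is at least 1.\<close>

lemma ln_over_n_bounds:
  assumes "n \<ge> 3"
  shows "1 / real n \<le> ln (real n) / real n" "ln (real n) / real n \<le> 1" "0 < ln (real n) / real n" "1 \<le> ln (real n)"
proof -
  have "exp 1 \<le> (3::real)" using e_less_272 by linarith
  then have "exp 1 \<le> real n" using assms by linarith
  then show l: "1 \<le> ln (real n)" using assms by (subst ln_ge_iff) auto
  have "ln (real n) \<le> real n" using ln_le_minus_one[of "real n"] assms by linarith
  with l show "1 / real n \<le> ln (real n) / real n" "ln (real n) / real n \<le> 1" "0 < ln (real n) / real n"
    using assms by (auto simp: divide_right_mono)
qed

lemma
  fixes r :: real
  assumes r: "r > 0" and n: "n \<ge> 3"
  shows level_upper: "2 powr level r n \<le> (ln n / n) powr (- 1 / (2 * r + 1))"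
    and level_lower: "(ln n / n) powr (- 1 / (2 * r + 1)) \<le> 2 * 2 powr level r n"
proof -
  define t where "t = ln (real n) / real n"
  have t: "0 < t" "t \<le> 1" using ln_over_n_bounds[OF n] by (auto simp: t_def)
  have u: "t powr (- 1 / (2 * r + 1)) \<ge> 1"
    using powr_mono'[of "- 1 / (2 * r + 1)" 0 t] t r by (simp add: divide_nonpos_pos)
  have u0: "t powr (- 1 / (2 * r + 1)) > 0" using t by simp
  \<comment> \<open>Nonnegativity makes the conversion by \<open>nat\<close> in \<open>level\<close>
    lossless.\<close>
  from u have "\<lfloor>log 2 (t powr (- 1 / (2 * r + 1)))\<rfloor> \<ge> 0" using t by (simp add: zero_le_log_cancel_iff)
  then have lev: "real (level r n) = of_int \<lfloor>log 2 (t powr (- 1 / (2 * r + 1)))\<rfloor>"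
    by (simp add: level_def t_def)
  have "real (level r n) \<le> log 2 (t powr (- 1 / (2 * r + 1)))" unfolding lev by simp
  then show "2 powr level r n \<le> (ln n / n) powr (- 1 / (2 * r + 1))"
    unfolding t_def[symmetric] using le_log_iff[OF _ u0] by (metis one_less_numeral_iff semiring_norm(76))
  have "log 2 (t powr (- 1 / (2 * r + 1))) < real (level r n) + 1" unfolding lev by linarith
  then have "t powr (- 1 / (2 * r + 1)) < 2 powr (real (level r n) + 1)"
    using log_less_iff[OF _ u0] by (metis one_less_numeral_iff semiring_norm(76))
  then show "(ln n / n) powr (- 1 / (2 * r + 1)) \<le> 2 * 2 powr level r n"
    by (simp add: powr_add t_def)
qed

text \<open>With t = ln n / n, the stochastic error sqrt (u * t) and the bias u powr (- r) of
  resolution u coincide at u = t powr (- 1 / (2 r + 1)), where both equal the rate. Rounding the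
  level down costs the factor 2 powr r in the bias.\<close>

lemma
  fixes r :: real
  assumes r: "r > 0" and n: "n \<ge> 3"
  shows level_variance: "2 powr (level r n / 2) * sqrt (ln n / n) \<le> rate r n"
    and level_bias_upper: "2 powr (- (r * level r n)) \<le> 2 powr r * rate r n"
    and level_bias_lower: "rate r n \<le> 2 powr (- (r * level r n))"
    and level_le: "2 powr level r n \<le> real n"
proof -
  define t where "t = ln (real n) / real n"
  define u where "u = t powr (- 1 / (2 * r + 1))"
  have t: "0 < t" "t \<le> 1" using ln_over_n_bounds[OF n] by (auto simp: t_def)
  have u0: "u > 0" using t by (simp add: u_def)
  have ub: "2 powr level r n \<le> u" and lb: "u \<le> 2 * 2 powr level r n"
    using level_upper[OF r n] level_lower[OF r n] by (auto simp: u_def t_def)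
  have ur: "u powr (- r) = rate r n"
    by (simp add: u_def rate_def t_def powr_powr)
  have "2 powr (level r n / 2) * sqrt t = (2 powr level r n) powr (1/2) * t powr (1/2)"
    using t by (simp add: powr_powr powr_half_sqrt)
  also have "\<dots> \<le> u powr (1/2) * t powr (1/2)"
    using ub by (intro mult_right_mono powr_mono2) auto
  also have "\<dots> = t powr (- 1 / (2 * r + 1) * (1/2) + 1/2)"
    by (simp only: u_def powr_powr powr_add)
  also have "- 1 / (2 * r + 1) * (1/2) + 1/2 = r / (2 * r + 1)"
    using r by (simp add: field_simps)
  finally show "2 powr (level r n / 2) * sqrt (ln n / n) \<le> rate r n"
    by (simp add: rate_def t_def)
  have "2 powr (- (r * level r n)) = (2 powr level r n) powr (- r)" by (simp add: powr_powr mult.commute)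
  also have "\<dots> \<le> (u / 2) powr (- r)"
    using lb u0 r by (intro powr_mono2') auto
  also have "\<dots> = u powr (- r) / 2 powr (- r)" by (rule powr_divide)
  also have "\<dots> = 2 powr r * rate r n" unfolding ur by (simp add: powr_minus divide_inverse)
  finally show "2 powr (- (r * level r n)) \<le> 2 powr r * rate r n" .
  have "rate r n \<le> (2 powr level r n) powr (- r)"
    unfolding ur[symmetric] using ub r by (intro powr_mono2') auto
  then show "rate r n \<le> 2 powr (- (r * level r n))" by (simp add: powr_powr mult.commute)
  have "u \<le> t powr (- 1)"
    unfolding u_def using t r by (intro powr_mono') (auto simp: field_simps)
  also have "\<dots> = real n / ln n" using n by (simp add: t_def powr_minus)
  also have "\<dots> \<le> real n" using ln_over_n_bounds(4)[OF n] mult_left_mono[of 1 "ln n" "real n"]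
    by (simp add: pos_divide_le_eq)
  finally show "2 powr level r n \<le> real n" using ub by linarith
qed

lemma filterlim_level:
  assumes r: "r > 0"
  shows "filterlim (level r) at_top sequentially"
  unfolding filterlim_at_top
proof
  fix J :: nat
  define a where "a = 1 / (2 * r + 1)"
  have a: "a > 0" using r by (simp add: a_def)
  have "filterlim (\<lambda>n::nat. (ln (real n) / real n) powr (- a)) at_top sequentially"
    using a by real_asymp
  then have "\<forall>\<^sub>F n in sequentially. (ln (real n) / real n) powr (- a) \<ge> 2 * 2 powr J"
    by (simp add: filterlim_at_top)
  then show "\<forall>\<^sub>F n in sequentially. J \<le> level r n"
    using eventually_ge_at_top[of 3]
  proof eventually_elim
    case (elim n)
    have e: "- 1 / (2 * r + 1) = - a" by (simp add: a_def)
    have "2 * 2 powr J \<le> 2 * 2 powr level r n"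
      using elim(1) level_lower[OF r elim(2)] unfolding e by (rule order_trans)
    then show ?case by simp
  qed
qed

lemma rate_tendsto_0: "r > 0 \<Longrightarrow> (rate r) \<longlonglongrightarrow> 0"
proof -
  assume "r > 0"
  then have "r / (2 * r + 1) > 0" by simp
  then show "(rate r) \<longlonglongrightarrow> 0" unfolding rate_def[abs_def] by real_asymp
qed

lemma rate_nonneg: "rate r n \<ge> 0"
  by (simp add: rate_def)

lemma rate_pos: "n \<ge> 3 \<Longrightarrow> rate r n > 0"
  using ln_over_n_bounds(3)[of n] by (simp add: rate_def)

definition bad_event :: "wavelet_system \<Rightarrow> real \<Rightarrow> real \<Rightarrow> nat \<Rightarrow> (real \<Rightarrow> real) \<Rightarrow> (nat \<Rightarrow> real) set" where
  "bad_event W r D n f = {X \<in> space (sample_space n).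
      \<not> (\<forall>x\<in>{0..1}. \<bar>estimator W (level r n) n X x - f x\<bar> \<le> D * rate r n)}"

lemma (in localized_wavelets) estimator_rate:
  assumes r: "r > 0" and B: "B \<ge> 0"
  shows "\<exists>D>0. \<forall>\<^sub>F n in sequentially. \<forall>f\<in>holder_class W B r.
    emeasure (sample_law n f) (bad_event W r D n f) \<le> ennreal (D / n)"
proof -
  \<comment> \<open>With \<open>\<delta>\<^sup>2 = ln n / n\<close>, the excess 2 over the variance
    bound makes a coefficient fail with probability at most 2 / n^2. There are at most of order n
    coefficients, which leaves order 1/n.\<close>
  define \<kappa> where "\<kappa> = density_bound B r + 2"
  have \<kappa>: "\<kappa> \<ge> 0" using density_bound_nonneg[OF r B] by (simp add: \<kappa>_def)
  define q where "q = B * C / (1 - 2 powr (- r))"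
  have q: "q \<ge> 0" using B C_ge_1 r powr_less_one[of 2 "- r"] by (auto simp: q_def intro!: divide_nonneg_nonneg)
  \<comment> \<open>The first summand covers noise and rounding, the second the bias, the third the
    failure probability, so that one constant bounds both radius and probability.\<close>
  define D where "D = 4 * C * (\<kappa> + 1) + q * 2 powr r + 2 * (num_scal W + 1)"
  have D: "D \<ge> 4 * C * (\<kappa> + 1) + q * 2 powr r" "D \<ge> 2 * (num_scal W + 1)" "D > 0"
    using C_ge_1 \<kappa> q by (auto simp: D_def add_nonneg_pos)
  have "(\<lambda>n. 8 * C * rate r n) \<longlonglongrightarrow> 8 * C * 0"
    by (intro tendsto_intros rate_tendsto_0 r)
  then have "\<forall>\<^sub>F n in sequentially. 8 * C * rate r n < 1"
    by (intro order_tendstoD(2)) auto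
  moreover have "\<forall>\<^sub>F n in sequentially. base_level W \<le> level r n"
    using filterlim_level[OF r] by (auto simp: filterlim_at_top)
  moreover have "\<forall>\<^sub>F n::nat in sequentially. n \<ge> 3" by (rule eventually_ge_at_top)
  ultimately have "\<forall>\<^sub>F n in sequentially. \<forall>f\<in>holder_class W B r.
    emeasure (sample_law n f) {X \<in> space (sample_space n).
      \<not> (\<forall>x\<in>{0..1}. \<bar>estimator W (level r n) n X x - f x\<bar> \<le> D * rate r n)} \<le> ennreal (D / n)"
  proof eventually_elim
    case (elim n)
    define t where "t = ln (real n) / real n"
    define \<delta> where "\<delta> = sqrt t"
    note n = \<open>n \<ge> 3\<close>
    have t: "0 < t" "t \<le> 1" "1 / n \<le> t" using ln_over_n_bounds[OF n] by (auto simp: t_def)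
    have \<delta>: "\<delta> > 0" "\<delta>\<^sup>2 = t" "1 / n \<le> \<delta>"
    proof -
      show "\<delta> > 0" "\<delta>\<^sup>2 = t" using t by (auto simp: \<delta>_def)
      have "sqrt t * sqrt t \<le> sqrt t * 1" using t by (intro mult_left_mono) auto
      then show "1 / n \<le> \<delta>" using t by (simp add: \<delta>_def)
    qed
    let ?J = "level r n"
    have var: "2 powr (?J / 2) * \<delta> \<le> rate r n"
      using level_variance[OF r n] by (simp add: \<delta>_def t_def)
    \<comment> \<open>The range condition of Bernstein's inequality; it reduces to
      \<open>8 * C * rate r n \<le> 1\<close>, which holds eventually.\<close>
    have small: "2 * (4 * C * 2 powr (?J / 2)) * \<delta> \<le> 1"
    proof -
      have "8 * C * (2 powr (?J / 2) * \<delta>) \<le> 8 * C * rate r n"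
        using var C_ge_1 by (intro mult_left_mono) auto
      then show ?thesis using elim by (simp add: mult_ac)
    qed
    show ?case
    proof
      fix f assume f: "f \<in> holder_class W B r"
      have bound: "(\<kappa> * \<delta> + 1 / n) * (4 * C * 2 powr (?J / 2)) + q * 2 powr (- (r * ?J)) \<le> D * rate r n"
      proof -
        have "(\<kappa> * \<delta> + 1 / n) * (4 * C * 2 powr (?J / 2)) \<le> ((\<kappa> + 1) * \<delta>) * (4 * C * 2 powr (?J / 2))"
          using \<delta> C_ge_1 by (intro mult_right_mono) (auto simp: algebra_simps)
        also have "\<dots> = 4 * C * (\<kappa> + 1) * (2 powr (?J / 2) * \<delta>)" by simp
        also have "\<dots> \<le> 4 * C * (\<kappa> + 1) * rate r n"
          using var C_ge_1 \<kappa> by (intro mult_left_mono) auto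
        finally have 1: "(\<kappa> * \<delta> + 1 / n) * (4 * C * 2 powr (?J / 2)) \<le> 4 * C * (\<kappa> + 1) * rate r n" .
        have "q * 2 powr (- (r * ?J)) \<le> q * (2 powr r * rate r n)"
          using level_bias_upper[OF r n] q by (intro mult_left_mono) auto
        with 1 have "(\<kappa> * \<delta> + 1 / n) * (4 * C * 2 powr (?J / 2)) + q * 2 powr (- (r * ?J))
            \<le> (4 * C * (\<kappa> + 1) + q * 2 powr r) * rate r n"
          by (simp add: algebra_simps)
        also have "\<dots> \<le> D * rate r n" by (intro mult_right_mono D rate_nonneg)
        finally show ?thesis .
      qed
      let ?bad = "\<lambda>b. {X \<in> space (sample_space n). \<not> (\<forall>x\<in>{0..1}. \<bar>estimator W ?J n X x - f x\<bar> \<le> b)}"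
      have "emeasure (sample_law n f) (?bad (D * rate r n))
        \<le> emeasure (sample_law n f) (?bad ((\<kappa> * \<delta> + 1 / n) * (4 * C * 2 powr (?J / 2)) + q * 2 powr (- (r * ?J))))"
        using bound countably_valued_Collect[OF countably_valued_estimator]
        by (intro emeasure_mono) (auto intro: order_trans)
      also have "\<dots> \<le> ennreal (2 * card (idx W ?J) * exp (n * \<delta>\<^sup>2 * (density_bound B r - \<kappa>)))"
        unfolding q_def using n by (intro estimator_error[OF f r B elim(2) _ \<delta>(1) \<kappa> small]) auto
      also have "\<dots> \<le> ennreal (D / n)"
      proof (rule ennreal_leI)
        have "exp (n * \<delta>\<^sup>2 * (density_bound B r - \<kappa>)) = exp (ln n * (- 2))"
          using n by (simp add: \<delta> t_def \<kappa>_def)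
        also have "\<dots> = (1 / n)\<^sup>2"
          using n exp_double[of "ln n"] by (simp add: exp_minus power_divide inverse_eq_divide mult.commute)
        finally have e: "exp (n * \<delta>\<^sup>2 * (density_bound B r - \<kappa>)) = (1 / n)\<^sup>2" .
        have "real (card (idx W ?J)) \<le> num_scal W + 2 powr ?J"
          using of_nat_mono[OF card_idx_le[of W ?J], where 'a=real] by (simp add: powr_realpow)
        also have "\<dots> \<le> num_scal W + real n" using level_le[OF r n] by simp
        also have "\<dots> \<le> (num_scal W + 1) * n" using n by (simp add: algebra_simps mult_le_cancel_right1)
        finally have "2 * card (idx W ?J) * (1 / n)\<^sup>2 \<le> 2 * ((num_scal W + 1) * n) * (1 / n)\<^sup>2"
          by (intro mult_right_mono) auto
        also have "\<dots> = 2 * (num_scal W + 1) / n" using n by (simp add: power2_eq_square field_simps)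
        also have "\<dots> \<le> D / n" using D by (intro divide_right_mono) auto
        finally show "2 * card (idx W ?J) * exp (n * \<delta>\<^sup>2 * (density_bound B r - \<kappa>)) \<le> D / n"
          unfolding e .
      qed
      finally show "emeasure (sample_law n f) (?bad (D * rate r n)) \<le> ennreal (D / n)" .
    qed
  qed
  with D(3) show ?thesis unfolding bad_event_def by blast
qed

section \<open>The test and the adaptive band\<close>

text \<open>Being a predicate on functions, it yields a measurable event whenever it is applied to
  the countably valued estimator; no infimum over the class has to be measurable.\<close>

definition near_class :: "wavelet_system \<Rightarrow> real \<Rightarrow> real \<Rightarrow> real \<Rightarrow> (real \<Rightarrow> real) \<Rightarrow> bool" where
  "near_class W B s b h \<longleftrightarrow> (\<exists>g\<in>holder_class W B s. \<forall>x\<in>{0..1}. \<bar>h x - g x\<bar> \<le> b)"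

definition accepts :: "wavelet_system \<Rightarrow> real \<Rightarrow> real \<Rightarrow> real \<Rightarrow> real \<Rightarrow> nat \<Rightarrow> (nat \<Rightarrow> real) \<Rightarrow> bool" where
  "accepts W B r s D n X \<longleftrightarrow> near_class W B s (D * rate r n) (estimator W (level r n) n X)"

definition band_radius :: "wavelet_system \<Rightarrow> real \<Rightarrow> real \<Rightarrow> real \<Rightarrow> real \<Rightarrow> nat \<Rightarrow> (nat \<Rightarrow> real) \<Rightarrow> real" where
  "band_radius W B r s D n X = (if accepts W B r s D n X then D * rate s n else D * rate r n)"

definition band_center :: "wavelet_system \<Rightarrow> real \<Rightarrow> real \<Rightarrow> real \<Rightarrow> real \<Rightarrow> nat \<Rightarrow> (nat \<Rightarrow> real) \<Rightarrow> real \<Rightarrow> real" where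
  "band_center W B r s D n X =
     (if accepts W B r s D n X then estimator W (level s n) n X else estimator W (level r n) n X)"

lemma rate_antimono:
  assumes "0 < r" "r \<le> s" "n \<ge> 3"
  shows "rate s n \<le> rate r n"
proof -
  have "r / (2 * r + 1) \<le> s / (2 * s + 1)"
    using assms by (simp add: divide_simps algebra_simps)
  then show ?thesis
    unfolding rate_def using ln_over_n_bounds[OF assms(3)] by (intro powr_mono') auto
qed

lemma rate_le_1:
  assumes "0 < r" "n \<ge> 3"
  shows "rate r n \<le> 1"
  unfolding rate_def using ln_over_n_bounds[OF assms(2)] assms(1) by (intro powr_le1) auto

lemma inverse_le_rate:
  assumes "0 < r" "n \<ge> 3"
  shows "1 / n \<le> rate r n"
proof -
  have "1 / n \<le> (ln n / n) powr 1" using ln_over_n_bounds[OF assms(2)] by simp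
  also have "\<dots> \<le> rate r n"
    unfolding rate_def using ln_over_n_bounds[OF assms(2)] assms(1) by (intro powr_mono') auto
  finally show ?thesis .
qed

lemma bad_event_mono: "D \<le> D' \<Longrightarrow> bad_event W r D' n f \<subseteq> bad_event W r D n f"
  unfolding bad_event_def using rate_nonneg[of r n] by (fastforce dest: mult_right_mono[of D D'])

text \<open>\<open>ennreal\<close> sends negative reals to 0; positivity of \<rho> lets the
  comparison be read back over the reals.\<close>

lemma separated_class_sup_dist:
  assumes "f \<in> separated_class W B r s \<rho>" "g \<in> holder_class W B s" "0 < \<rho>"
    and "\<And>x. x \<in> {0..1} \<Longrightarrow> \<bar>g x - f x\<bar> \<le> d"
  shows "\<rho> \<le> d"
proof -
  have "ennreal \<rho> \<le> sup_dist g f"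
    using assms(1,2) by (auto simp: separated_class_def intro: order_trans[OF _ INF_lower])
  also have "\<dots> \<le> ennreal d"
    unfolding sup_dist_def using assms(4) by (intro SUP_least ennreal_leI) auto
  finally show ?thesis using assms(3) by (metis ennreal_le_iff2 not_less)
qed

lemma eventually_le_of_le_over_n:
  fixes h :: "nat \<Rightarrow> ennreal" and D \<eta> :: real
  assumes "\<forall>\<^sub>F n in sequentially. h n \<le> ennreal (D / n)" "\<eta> > 0"
  shows "\<forall>\<^sub>F n in sequentially. h n \<le> ennreal \<eta>"
proof -
  have "(\<lambda>n::nat. D / n) \<longlonglongrightarrow> 0" by real_asymp
  then have "\<forall>\<^sub>F n::nat in sequentially. D / n < \<eta>" using assms(2) by (rule order_tendstoD(2))
  with assms(1) show ?thesis
    by eventually_elim (meson ennreal_leI less_imp_le order_trans)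
qed

context localized_wavelets
begin

lemma bad_event_sets: "bad_event W r D n f \<in> sets (sample_space n)"
  unfolding bad_event_def by (rule countably_valued_Collect[OF countably_valued_estimator])

lemma countably_valued_estimators:
  "countably_valued (sample_space n) (\<lambda>X. (estimator W J n X, estimator W J' n X))"
  by (intro countably_valued_pair countably_valued_estimator)

lemma sets_accepts: "{X \<in> space (sample_space n). \<not> accepts W B r s D n X} \<in> sets (sample_space n)"
  unfolding accepts_def by (rule countably_valued_Collect[OF countably_valued_estimator])

text \<open>When the estimator is close to \<open>f\<close>, then \<open>f\<close> itself witnesses
  closeness to the class.\<close>

lemma null_not_accepts:
  assumes "f \<in> holder_class W B s"
  shows "{X \<in> space (sample_space n). \<not> accepts W B r s D n X} \<subseteq> bad_event W r D n f"
  using assms by (auto simp: bad_event_def accepts_def near_class_def)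

text \<open>The triangle inequality: on acceptance and off the bad event, the witness from the
  smoother class would be within \<open>2 * D * rate r n\<close> of \<open>f\<close>, closer than
  the separation permits.\<close>

lemma separated_accepts:
  assumes "f \<in> separated_class W B r s \<rho>" "2 * D * rate r n < \<rho>" "D > 0"
  shows "{X \<in> space (sample_space n). accepts W B r s D n X} \<subseteq> bad_event W r D n f"
proof
  fix X assume X: "X \<in> {X \<in> space (sample_space n). accepts W B r s D n X}"
  let ?h = "estimator W (level r n) n X"
  obtain g where g: "g \<in> holder_class W B s" "\<And>x. x \<in> {0..1} \<Longrightarrow> \<bar>?h x - g x\<bar> \<le> D * rate r n"
    using X by (auto simp: accepts_def near_class_def)
  show "X \<in> bad_event W r D n f"
  proof (rule ccontr)
    assume "X \<notin> bad_event W r D n f"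
    then have "\<bar>?h x - f x\<bar> \<le> D * rate r n" if "x \<in> {0..1}" for x
      using X that by (auto simp: bad_event_def)
    then have "\<bar>g x - f x\<bar> \<le> 2 * D * rate r n" if "x \<in> {0..1}" for x
      using that g(2)[OF that] by fastforce
    moreover have "0 < \<rho>" using assms(2,3) rate_nonneg[of r n]
      by (meson le_less_trans less_imp_le mult_nonneg_nonneg zero_le_numeral)
    ultimately have "\<rho> \<le> 2 * D * rate r n"
      by (intro separated_class_sup_dist[OF assms(1) g(1)]) auto
    then show False using assms(2) by simp
  qed
qed

text \<open>A larger \<open>D\<close> shrinks the bad event and weakens the probability bound, so
  the sum of the two constants works for both smoothness indices.\<close>

lemma two_estimators:
  assumes "0 < r" "0 < s" "B \<ge> 0"
  shows "\<exists>D>0. \<forall>\<^sub>F n in sequentially.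
    (\<forall>f\<in>holder_class W B r. emeasure (sample_law n f) (bad_event W r D n f) \<le> ennreal (D / n)) \<and>
    (\<forall>f\<in>holder_class W B s. emeasure (sample_law n f) (bad_event W s D n f) \<le> ennreal (D / n))"
proof -
  obtain D1 where D1: "D1 > 0" "\<forall>\<^sub>F n in sequentially. \<forall>f\<in>holder_class W B r.
      emeasure (sample_law n f) (bad_event W r D1 n f) \<le> ennreal (D1 / n)"
    using estimator_rate[OF assms(1,3)] by auto
  obtain D2 where D2: "D2 > 0" "\<forall>\<^sub>F n in sequentially. \<forall>f\<in>holder_class W B s.
      emeasure (sample_law n f) (bad_event W s D2 n f) \<le> ennreal (D2 / n)"
    using estimator_rate[OF assms(2,3)] by auto
  have mono: "emeasure (sample_law n f) (bad_event W q (D1 + D2) n f) \<le> ennreal ((D1 + D2) / n)"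
    if "emeasure (sample_law n f) (bad_event W q D n f) \<le> ennreal (D / n)" "D \<le> D1 + D2" for q D n f
  proof -
    have "emeasure (sample_law n f) (bad_event W q (D1 + D2) n f) \<le> emeasure (sample_law n f) (bad_event W q D n f)"
      by (intro emeasure_mono bad_event_mono that) (simp add: bad_event_sets)
    also have "\<dots> \<le> ennreal (D / n)" by fact
    also have "\<dots> \<le> ennreal ((D1 + D2) / n)" using that(2) by (intro ennreal_leI divide_right_mono) auto
    finally show ?thesis .
  qed
  have "\<forall>\<^sub>F n in sequentially.
    (\<forall>f\<in>holder_class W B r. emeasure (sample_law n f) (bad_event W r (D1 + D2) n f) \<le> ennreal ((D1 + D2) / n)) \<and>
    (\<forall>f\<in>holder_class W B s. emeasure (sample_law n f) (bad_event W s (D1 + D2) n f) \<le> ennreal ((D1 + D2) / n))"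
    using D1(2) D2(2)
  proof eventually_elim
    case (elim n)
    then show ?case using mono[of n _ r D1] mono[of n _ s D2] D1(1) D2(1) by auto
  qed
  then show ?thesis using D1(1) D2(1) by (intro exI[of _ "D1 + D2"]) auto
qed

text \<open>The separation constant \<open>3 * D\<close> exceeds the \<open>2 * D\<close> required
  by \<open>separated_accepts\<close>. One constant works for every \<eta> because the error is even
  of order 1/n.\<close>

lemma test_achieves_rate:
  assumes r: "0 < r" "r < s" and B: "B \<ge> 0" and \<eta>: "\<eta> > 0"
  shows "\<exists>L>0. \<exists>\<Psi>. (\<forall>n. \<Psi> n \<in> tests n) \<and>
     limsup (\<lambda>n. test_error n (holder_class W B s) (separated_class W B r s (L * rate r n)) (\<Psi> n)) \<le> ennreal \<eta>"
proof -
  obtain D where D: "D > 0" and est: "\<forall>\<^sub>F n in sequentially.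
    (\<forall>f\<in>holder_class W B r. emeasure (sample_law n f) (bad_event W r D n f) \<le> ennreal (D / n)) \<and>
    (\<forall>f\<in>holder_class W B s. emeasure (sample_law n f) (bad_event W s D n f) \<le> ennreal (D / n))"
    using two_estimators[of r s B] r B by auto
  define \<Psi> where "\<Psi> n X = (if accepts W B r s D n X then 0 else 1 :: real)" for n X
  have tests: "\<Psi> n \<in> tests n" for n
    using countably_valued_measurable[OF countably_valued_compose[OF countably_valued_estimator[of n "level r n"],
          of "\<lambda>h. if near_class W B s (D * rate r n) h then 0 else 1 :: real"], of borel]
    by (auto simp: tests_def \<Psi>_def[abs_def] accepts_def)
  have "\<forall>\<^sub>F n in sequentially. test_error n (holder_class W B s) (separated_class W B r s (3 * D * rate r n)) (\<Psi> n)
      \<le> ennreal ((2 * D) / n)"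
    using est eventually_ge_at_top[of 3]
  proof eventually_elim
    case (elim n)
    have "(\<integral>\<^sup>+X. ennreal (\<Psi> n X) \<partial>sample_law n f) \<le> ennreal (D / n)" if f: "f \<in> holder_class W B s" for f
    proof -
      have "(\<integral>\<^sup>+X. ennreal (\<Psi> n X) \<partial>sample_law n f) = (\<integral>\<^sup>+X. indicator {X \<in> space (sample_space n). \<not> accepts W B r s D n X} X \<partial>sample_law n f)"
        by (intro nn_integral_cong) (auto simp: \<Psi>_def)
      also have "\<dots> = emeasure (sample_law n f) {X \<in> space (sample_space n). \<not> accepts W B r s D n X}"
        by (rule nn_integral_indicator) (simp add: sets_accepts)
      also have "\<dots> \<le> emeasure (sample_law n f) (bad_event W r D n f)"
        by (intro emeasure_mono null_not_accepts f) (simp add: bad_event_sets)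
      also have "\<dots> \<le> ennreal (D / n)"
        using elim f holder_class_mono[of r s B] r B by auto
      finally show ?thesis .
    qed
    moreover have "(\<integral>\<^sup>+X. ennreal (1 - \<Psi> n X) \<partial>sample_law n f) \<le> ennreal (D / n)"
      if f: "f \<in> separated_class W B r s (3 * D * rate r n)" for f
    proof -
      have a: "{X \<in> space (sample_space n). accepts W B r s D n X} = space (sample_space n) - {X \<in> space (sample_space n). \<not> accepts W B r s D n X}"
        by auto
      have "(\<integral>\<^sup>+X. ennreal (1 - \<Psi> n X) \<partial>sample_law n f) = (\<integral>\<^sup>+X. indicator {X \<in> space (sample_space n). accepts W B r s D n X} X \<partial>sample_law n f)"
        by (intro nn_integral_cong) (auto simp: \<Psi>_def)
      also have "\<dots> = emeasure (sample_law n f) {X \<in> space (sample_space n). accepts W B r s D n X}"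
        unfolding a by (rule nn_integral_indicator) (auto intro!: sets.compl_sets sets_accepts)
      also have "\<dots> \<le> emeasure (sample_law n f) (bad_event W r D n f)"
        using D rate_pos[OF elim(2), of r] by (intro emeasure_mono separated_accepts[OF f]) (auto simp: bad_event_sets)
      also have "\<dots> \<le> ennreal (D / n)"
        using elim f by (auto simp: separated_class_def)
      finally show ?thesis .
    qed
    ultimately have "test_error n (holder_class W B s) (separated_class W B r s (3 * D * rate r n)) (\<Psi> n)
        \<le> ennreal (D / n) + ennreal (D / n)"
      unfolding test_error_def by (intro add_mono SUP_least)
    also have "\<dots> = ennreal ((2 * D) / n)" using D by (simp flip: ennreal_plus)
    finally show ?case .
  qed
  from eventually_le_of_le_over_n[OF this \<eta>]
  have "limsup (\<lambda>n. test_error n (holder_class W B s) (separated_class W B r s (3 * D * rate r n)) (\<Psi> n)) \<le> ennreal \<eta>"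
    by (rule Limsup_bounded)
  with tests D show ?thesis
    by (intro exI[of _ "3 * D"] conjI exI[of _ \<Psi>]) auto
qed

lemma adaptive_band_exists:
  assumes r: "0 < r" "r < s" and B: "B \<ge> 0" and \<alpha>: "0 < \<alpha>" "\<alpha> < 1"
  shows "\<exists>\<rho> lo up. (\<forall>n. 0 \<le> \<rho> n) \<and> limsup (\<lambda>n. ereal (\<rho> n / rate r n)) < \<infinity> \<and> confidence_band lo up \<and>
     asymp_honest \<alpha> (\<lambda>n. holder_class W B s \<union> separated_class W B r s (\<rho> n)) lo up \<and>
     adaptive s r (\<lambda>n. holder_class W B s) (\<lambda>n. separated_class W B r s (\<rho> n)) lo up"
proof -
  obtain D where D: "D > 0" and est: "\<forall>\<^sub>F n in sequentially.
    (\<forall>f\<in>holder_class W B r. emeasure (sample_law n f) (bad_event W r D n f) \<le> ennreal (D / n)) \<and>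
    (\<forall>f\<in>holder_class W B s. emeasure (sample_law n f) (bad_event W s D n f) \<le> ennreal (D / n))"
    using two_estimators[of r s B] r B by auto
  have sub: "holder_class W B s \<subseteq> holder_class W B r" using r B by (intro holder_class_mono) auto
  define \<rho> where "\<rho> n = 3 * D * rate r n" for n
  define lo where "lo n X y = band_center W B r s D n X y - band_radius W B r s D n X" for n X y
  define up where "up n X y = band_center W B r s D n X y + band_radius W B r s D n X" for n X y
  \<comment> \<open>Both end points factor through the pair of estimators, which is countably
    valued; every measurability requirement on the band follows from this.\<close>
  define lo' where "lo' n = (\<lambda>(hr, hs) y. if near_class W B s (D * rate r n) hr
    then hs y - D * rate s n else hr y - D * rate r n)" for n and y :: real
  define up' where "up' n = (\<lambda>(hr, hs) y. if near_class W B s (D * rate r n) hr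
    then hs y + D * rate s n else hr y + D * rate r n)" for n and y :: real
  let ?h = "\<lambda>n X. (estimator W (level r n) n X, estimator W (level s n) n X)"
  have lo_eq: "lo n X = lo' n (?h n X)" and up_eq: "up n X = up' n (?h n X)" for n X
    by (auto simp: lo_def lo'_def up_def up'_def band_center_def band_radius_def accepts_def)
  have cv: "countably_valued (sample_space n) (\<lambda>X. F (?h n X))" for n F
    by (rule countably_valued_compose[OF countably_valued_estimators])
  have band: "confidence_band lo up"
    unfolding confidence_band_def
  proof (intro allI conjI ballI)
    fix n
    show "(\<lambda>X. lo n X y) \<in> borel_measurable (sample_space n)" for y
      unfolding lo_eq by (rule countably_valued_measurable[OF cv]) simp
    show "(\<lambda>X. up n X y) \<in> borel_measurable (sample_space n)" for y
      unfolding up_eq by (rule countably_valued_measurable[OF cv]) simp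
    show "lo n X y \<le> up n X y" for X y
      using D rate_nonneg[of s n] rate_nonneg[of r n] by (auto simp: lo_def up_def band_radius_def)
    show "in_band n lo up f \<in> sets (sample_space n)" for f
      unfolding in_band_def lo_eq up_eq by (rule countably_valued_Collect[OF countably_valued_estimators])
    show "diameter n lo up \<in> borel_measurable (sample_space n)"
      unfolding diameter_def[abs_def] lo_eq up_eq by (rule countably_valued_measurable[OF cv]) simp
  qed
  then have in_band_sets: "in_band n lo up f \<in> sets (sample_space n)" if "f \<in> cont_densities" for n f
    using that by (simp add: confidence_band_def)
  have coverage: "\<forall>\<^sub>F n in sequentially. \<forall>f\<in>holder_class W B s \<union> separated_class W B r s (\<rho> n).
     emeasure (sample_law n f) (space (sample_space n) - in_band n lo up f) \<le> ennreal ((2 * D) / n)"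
    using est eventually_ge_at_top[of 3]
  proof eventually_elim
    case (elim n)
    show ?case
    proof
      fix f assume f: "f \<in> holder_class W B s \<union> separated_class W B r s (\<rho> n)"
      have fr: "f \<in> holder_class W B r" using f sub by (auto simp: separated_class_def)
      have cover_s: "X \<in> bad_event W s D n f" if "X \<in> space (sample_space n)" "X \<notin> in_band n lo up f" "accepts W B r s D n X" for X
        using that by (auto simp: in_band_def lo_def up_def band_center_def band_radius_def bad_event_def abs_le_iff algebra_simps)
      have cover_r: "X \<in> bad_event W r D n f" if "X \<in> space (sample_space n)" "X \<notin> in_band n lo up f" "\<not> accepts W B r s D n X" for X
        using that by (auto simp: in_band_def lo_def up_def band_center_def band_radius_def bad_event_def abs_le_iff algebra_simps)
      have r: "emeasure (sample_law n f) (bad_event W r D n f) \<le> ennreal (D / n)" using elim fr by auto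
      show "emeasure (sample_law n f) (space (sample_space n) - in_band n lo up f) \<le> ennreal ((2 * D) / n)"
      proof (cases "f \<in> holder_class W B s")
        case True
        have "emeasure (sample_law n f) (space (sample_space n) - in_band n lo up f)
            \<le> emeasure (sample_law n f) (bad_event W r D n f \<union> bad_event W s D n f)"
          using cover_s cover_r by (intro emeasure_mono) (auto simp: bad_event_sets)
        also have "\<dots> \<le> emeasure (sample_law n f) (bad_event W r D n f) + emeasure (sample_law n f) (bad_event W s D n f)"
          by (rule emeasure_subadditive) (auto simp: bad_event_sets)
        also have "\<dots> \<le> ennreal (D / n) + ennreal (D / n)" using elim True r by (intro add_mono) auto
        also have "\<dots> = ennreal ((2 * D) / n)" using D by (simp flip: ennreal_plus)
        finally show ?thesis .
      next
        case False
        then have f: "f \<in> separated_class W B r s (\<rho> n)" using f by simp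
        \<comment> \<open>For such \<open>f\<close> the estimator at level \<open>level s n\<close>
          is not controlled, but it is used only upon acceptance, and separation makes acceptance
          part of the bad event.\<close>
        have "{X \<in> space (sample_space n). accepts W B r s D n X} \<subseteq> bad_event W r D n f"
          using D rate_pos[OF elim(2), of r] by (intro separated_accepts[OF f]) (auto simp: \<rho>_def)
        then have "emeasure (sample_law n f) (space (sample_space n) - in_band n lo up f)
            \<le> emeasure (sample_law n f) (bad_event W r D n f)"
          using cover_r by (intro emeasure_mono) (auto simp: bad_event_sets)
        also note r
        also have "ennreal (D / n) \<le> ennreal ((2 * D) / n)"
          using D by (intro ennreal_leI divide_right_mono) auto
        finally show ?thesis .
      qed
    qed
  qed
  have honest: "asymp_honest \<alpha> (\<lambda>n. holder_class W B s \<union> separated_class W B r s (\<rho> n)) lo up"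
    unfolding asymp_honest_def
  proof (rule Liminf_bounded)
    have "(\<lambda>n::nat. (2 * D) / n) \<longlonglongrightarrow> 0" by real_asymp
    then have "\<forall>\<^sub>F n::nat in sequentially. (2 * D) / n < \<alpha>" using \<alpha>(1) by (rule order_tendstoD(2))
    with coverage
    show "\<forall>\<^sub>F n in sequentially. ennreal (1 - \<alpha>) \<le>
      (INF f\<in>holder_class W B s \<union> separated_class W B r s (\<rho> n). emeasure (sample_law n f) (in_band n lo up f))"
    proof eventually_elim
      case (elim n)
      show ?case
      proof (rule INF_greatest)
        fix f assume f: "f \<in> holder_class W B s \<union> separated_class W B r s (\<rho> n)"
        then have fc: "f \<in> cont_densities" by (auto simp: holder_class_def separated_class_def)
        interpret prob_space "sample_law n f" by (rule prob_space_sample_law[OF fc])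
        have s: "in_band n lo up f \<in> sets (sample_law n f)" using in_band_sets[OF fc] by simp
        have "ennreal (prob (space (sample_space n) - in_band n lo up f)) \<le> ennreal ((2 * D) / n)"
          using bspec[OF elim(1) f] unfolding emeasure_eq_measure .
        then have "prob (space (sample_law n f) - in_band n lo up f) \<le> (2 * D) / n"
          using D by (subst (asm) ennreal_le_iff) auto
        then have "1 - \<alpha> \<le> prob (in_band n lo up f)"
          using prob_compl[OF s] elim(2) by linarith
        then show "ennreal (1 - \<alpha>) \<le> emeasure (sample_law n f) (in_band n lo up f)"
          by (simp add: emeasure_eq_measure ennreal_leI)
      qed
    qed
  qed
  have diam: "diameter n lo up X \<le> ennreal (2 * band_radius W B r s D n X)" for n X
    unfolding diameter_def using D rate_nonneg[of s n] rate_nonneg[of r n]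
    by (intro SUP_least ennreal_leI) (auto simp: lo_def up_def band_radius_def)
  have "\<forall>\<^sub>F n in sequentially.
        (SUP f\<in>holder_class W B s. expected_diameter n lo up f) \<le> ennreal ((2 * D + 2 * D * D) * rate s n) \<and>
        (SUP f\<in>separated_class W B r s (\<rho> n). expected_diameter n lo up f) \<le> ennreal ((2 * D + 2 * D * D) * rate r n)"
    using est eventually_ge_at_top[of 3]
  proof eventually_elim
    case (elim n)
    note n = elim(2)
    have rs: "rate s n \<le> rate r n" using r n by (intro rate_antimono) auto
    show ?case
    proof (intro conjI SUP_least)
      fix f assume f: "f \<in> holder_class W B s"
      let ?A = "{X \<in> space (sample_space n). \<not> accepts W B r s D n X}"
      interpret prob_space "sample_law n f"
        using f by (intro prob_space_sample_law) (simp add: holder_class_def)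
      have "expected_diameter n lo up f \<le> (\<integral>\<^sup>+X. ennreal (2 * D * rate s n) + ennreal (2 * D * rate r n) * indicator ?A X \<partial>sample_law n f)"
        unfolding expected_diameter_def
      proof (rule nn_integral_mono)
        fix X assume "X \<in> space (sample_law n f)"
        then have "ennreal (2 * band_radius W B r s D n X) \<le> ennreal (2 * D * rate s n) + ennreal (2 * D * rate r n) * indicator ?A X"
          by (auto simp: band_radius_def indicator_def mult.assoc add_increasing)
        with diam[of n X] show "diameter n lo up X \<le> ennreal (2 * D * rate s n) + ennreal (2 * D * rate r n) * indicator ?A X"
          by (rule order_trans)
      qed
      also have "\<dots> = ennreal (2 * D * rate s n) + ennreal (2 * D * rate r n) * emeasure (sample_law n f) ?A"
        using sets_accepts[of n B r s D] by (subst nn_integral_add) (auto simp: nn_integral_cmult_indicator emeasure_space_1[simplified])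
      also have "\<dots> \<le> ennreal (2 * D * rate s n) + ennreal (2 * D * rate r n) * ennreal (D / n)"
      proof (intro add_mono mult_left_mono order_refl)
        have "emeasure (sample_law n f) ?A \<le> emeasure (sample_law n f) (bad_event W r D n f)"
          by (intro emeasure_mono null_not_accepts f) (simp add: bad_event_sets)
        also have "\<dots> \<le> ennreal (D / n)" using elim f sub by auto
        finally show "emeasure (sample_law n f) ?A \<le> ennreal (D / n)" .
      qed simp
      also have "\<dots> = ennreal (2 * D * rate s n + 2 * D * rate r n * (D / n))"
        using D rate_nonneg[of s n] rate_nonneg[of r n] by (simp flip: ennreal_plus ennreal_mult)
      also have "\<dots> \<le> ennreal ((2 * D + 2 * D * D) * rate s n)"
      proof (rule ennreal_leI)
        \<comment> \<open>The wide band is at most a constant wide and occurs under \<open>f\<close>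
          with probability at most \<open>D / n\<close>; since 1/n is below \<open>rate s n\<close>,
          its contribution is absorbed.\<close>
        have "2 * D * rate r n * (D / n) = (2 * D * D) * (rate r n * (1 / n))" by simp
        also have "\<dots> \<le> (2 * D * D) * (1 * rate s n)"
          using D r n rate_nonneg[of r n] rate_le_1[of r n] inverse_le_rate[of s n]
          by (intro mult_left_mono mult_mono) auto
        finally show "2 * D * rate s n + 2 * D * rate r n * (D / n) \<le> (2 * D + 2 * D * D) * rate s n"
          by (simp add: algebra_simps)
      qed
      finally show "expected_diameter n lo up f \<le> ennreal ((2 * D + 2 * D * D) * rate s n)" .
    next
      fix f assume f: "f \<in> separated_class W B r s (\<rho> n)"
      interpret prob_space "sample_law n f"
        using f by (intro prob_space_sample_law) (simp add: holder_class_def separated_class_def)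
      have "expected_diameter n lo up f \<le> (\<integral>\<^sup>+X. ennreal ((2 * D + 2 * D * D) * rate r n) \<partial>sample_law n f)"
        unfolding expected_diameter_def
      proof (rule nn_integral_mono)
        fix X
        have "2 * band_radius W B r s D n X \<le> 2 * D * rate r n"
          using rs D by (auto simp: band_radius_def)
        also have "\<dots> \<le> (2 * D + 2 * D * D) * rate r n"
          using D rate_nonneg[of r n] by (intro mult_right_mono) auto
        finally show "diameter n lo up X \<le> ennreal ((2 * D + 2 * D * D) * rate r n)"
          using diam[of n X] by (meson ennreal_leI order_trans)
      qed
      then show "expected_diameter n lo up f \<le> ennreal ((2 * D + 2 * D * D) * rate r n)"
        using emeasure_space_1 by simp
    qed
  qed
  then have adapt: "adaptive s r (\<lambda>n. holder_class W B s) (\<lambda>n. separated_class W B r s (\<rho> n)) lo up"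
    unfolding adaptive_def by blast
  have "limsup (\<lambda>n. ereal (\<rho> n / rate r n)) \<le> ereal (3 * D)"
    using D by (intro Limsup_bounded always_eventually) (auto simp: \<rho>_def)
  then have "limsup (\<lambda>n. ereal (\<rho> n / rate r n)) < \<infinity>" by (rule le_less_trans) simp
  moreover have "0 \<le> \<rho> n" for n using D rate_nonneg[of r n] by (simp add: \<rho>_def)
  ultimately show ?thesis using band honest adapt by blast
qed

end

section \<open>Indistinguishable alternatives\<close>

text \<open>Second moment method. The averaged likelihood ratio \<open>Y\<close> has mean 1, and
  since the cross moments equal 1 its variance is at most \<open>K / card I\<close>. So the two
  errors against the mixture sum to at least 1 - \<eta>, and some member of the mixture does no
  worse than the average.\<close>

lemma (in prob_space) mixture_lower_bound:
  fixes Z :: "'i \<Rightarrow> 'a \<Rightarrow> real" and \<Psi> :: "'a \<Rightarrow> real"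
  assumes I: "finite I" "I \<noteq> {}"
    and Z[measurable]: "\<And>i. i \<in> I \<Longrightarrow> Z i \<in> borel_measurable M"
    and Z_bnd: "\<And>i x. i \<in> I \<Longrightarrow> x \<in> space M \<Longrightarrow> \<bar>Z i x\<bar> \<le> b"
    and Z_1: "\<And>i. i \<in> I \<Longrightarrow> expectation (Z i) = 1"
    and Z_orth: "\<And>i j. i \<in> I \<Longrightarrow> j \<in> I \<Longrightarrow> i \<noteq> j \<Longrightarrow> expectation (\<lambda>x. Z i x * Z j x) = 1"
    and Z_2: "\<And>i. i \<in> I \<Longrightarrow> expectation (\<lambda>x. Z i x * Z i x) \<le> K"
    and K: "K / card I \<le> \<eta>\<^sup>2" and \<eta>: "\<eta> > 0"
    and \<Psi>[measurable]: "\<Psi> \<in> borel_measurable M" and \<Psi>01: "\<And>x. x \<in> space M \<Longrightarrow> 0 \<le> \<Psi> x \<and> \<Psi> x \<le> 1"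
  shows "\<exists>i\<in>I. 1 - \<eta> \<le> expectation \<Psi> + expectation (\<lambda>x. (1 - \<Psi> x) * Z i x)"
proof -
  let ?P = "real (card I)"
  have P: "?P > 0" using I by (simp add: card_gt_0_iff)
  define Y where "Y x = (\<Sum>i\<in>I. Z i x) / ?P" for x
  have Y[measurable]: "Y \<in> borel_measurable M" unfolding Y_def[abs_def] by measurable
  have bint: "integrable M h" if "h \<in> borel_measurable M" "\<And>x. x \<in> space M \<Longrightarrow> \<bar>h x\<bar> \<le> c" for h :: "'a \<Rightarrow> real" and c
    using that by (intro integrable_const_bound[of _ c]) (auto intro!: AE_I2)
  have b: "b \<ge> 0" using I Z_bnd not_empty by (meson abs_ge_zero all_not_in_conv order_trans)
  have int_Z: "integrable M (Z i)" if "i \<in> I" for i using that Z_bnd by (intro bint[of _ b]) auto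
  have int_ZZ: "integrable M (\<lambda>x. Z i x * Z j x)" if "i \<in> I" "j \<in> I" for i j
    using that Z_bnd b by (intro bint[of _ "b * b"]) (auto simp: abs_mult intro!: mult_mono)
  have int_\<Psi>: "integrable M \<Psi>" using \<Psi>01 by (intro bint[of _ 1]) auto
  have int_\<Psi>Z: "integrable M (\<lambda>x. (1 - \<Psi> x) * Z i x)" if "i \<in> I" for i
  proof (rule bint[of _ "1 * b"])
    show "\<bar>(1 - \<Psi> x) * Z i x\<bar> \<le> 1 * b" if "x \<in> space M" for x
      unfolding abs_mult using \<Psi>01[OF that] Z_bnd[OF \<open>i \<in> I\<close> that] by (intro mult_mono) auto
  qed (use that in measurable)
  have int_Y: "integrable M Y" unfolding Y_def[abs_def] using int_Z by auto
  have Y2: "(Y x)\<^sup>2 = (\<Sum>i\<in>I. \<Sum>j\<in>I. Z i x * Z j x) / ?P\<^sup>2" for x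
    by (simp add: Y_def power_divide power2_eq_square sum_product)
  have int_Y2: "integrable M (\<lambda>x. (Y x)\<^sup>2)" unfolding Y2 using int_ZZ by auto
  have EY: "expectation Y = 1"
    unfolding Y_def[abs_def] using int_Z Z_1 P by simp
  have "expectation (\<lambda>x. (Y x)\<^sup>2) = (\<Sum>i\<in>I. \<Sum>j\<in>I. expectation (\<lambda>x. Z i x * Z j x)) / ?P\<^sup>2"
    unfolding Y2 using int_ZZ by simp
  also have "\<dots> \<le> (\<Sum>i\<in>I. K + ?P) / ?P\<^sup>2"
  proof (intro divide_right_mono sum_mono)
    fix i assume i: "i \<in> I"
    have "(\<Sum>j\<in>I. expectation (\<lambda>x. Z i x * Z j x))
        = expectation (\<lambda>x. Z i x * Z i x) + (\<Sum>j\<in>I - {i}. expectation (\<lambda>x. Z i x * Z j x))"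
      by (rule sum.remove[OF I(1) i])
    also have "(\<Sum>j\<in>I - {i}. expectation (\<lambda>x. Z i x * Z j x)) = (\<Sum>j\<in>I - {i}. 1)"
      using Z_orth i by (intro sum.cong) auto
    also have "\<dots> \<le> ?P" by (simp add: card_Diff1_le)
    finally show "(\<Sum>j\<in>I. expectation (\<lambda>x. Z i x * Z j x)) \<le> K + ?P" using Z_2[OF i] by linarith
  qed simp
  also have "\<dots> = K / ?P + 1" using P by (simp add: power2_eq_square field_simps)
  finally have EY2: "expectation (\<lambda>x. (Y x)\<^sup>2) \<le> \<eta>\<^sup>2 + 1" using K by linarith
  \<comment> \<open>The inequality |u| <= (\<eta> + u^2 / \<eta>) / 2 takes the place of
    Cauchy-Schwarz; at variance \<open>\<eta>\<^sup>2\<close> it loses nothing.\<close>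
  have "expectation (\<lambda>x. (1 - \<Psi> x) * (1 - Y x)) \<le> expectation (\<lambda>x. (\<eta> + (1 - Y x)\<^sup>2 / \<eta>) / 2)"
  proof (rule integral_mono)
    have "integrable M (\<lambda>x. (1 - \<Psi> x) * Y x)"
      unfolding Y_def sum_distrib_left times_divide_eq_right using int_\<Psi>Z by auto
    then show "integrable M (\<lambda>x. (1 - \<Psi> x) * (1 - Y x))"
      using int_\<Psi> by (simp add: right_diff_distrib)
    show "integrable M (\<lambda>x. (\<eta> + (1 - Y x)\<^sup>2 / \<eta>) / 2)"
      using int_Y int_Y2 by (auto simp: power2_diff)
    fix x assume "x \<in> space M"
    have "(1 - \<Psi> x) * (1 - Y x) \<le> \<bar>1 - \<Psi> x\<bar> * \<bar>1 - Y x\<bar>" by (metis abs_ge_self abs_mult)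
    also have "\<dots> \<le> 1 * \<bar>1 - Y x\<bar>"
      using \<Psi>01[OF \<open>x \<in> space M\<close>] by (intro mult_right_mono) auto
    also have "\<dots> \<le> (\<eta> + (1 - Y x)\<^sup>2 / \<eta>) / 2"
    proof -
      have "0 \<le> (\<eta> - \<bar>1 - Y x\<bar>)\<^sup>2" by simp
      then have "2 * \<bar>1 - Y x\<bar> * \<eta> \<le> \<eta>\<^sup>2 + (1 - Y x)\<^sup>2" by (simp add: power2_diff mult_ac)
      then show ?thesis using \<eta> by (simp add: field_simps power2_eq_square)
    qed
    finally show "(1 - \<Psi> x) * (1 - Y x) \<le> (\<eta> + (1 - Y x)\<^sup>2 / \<eta>) / 2" .
  qed
  also have "expectation (\<lambda>x. (\<eta> + (1 - Y x)\<^sup>2 / \<eta>) / 2) = (\<eta> + (1 - 2 * expectation Y + expectation (\<lambda>x. (Y x)\<^sup>2)) / \<eta>) / 2"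
    using int_Y int_Y2 by (simp add: power2_diff prob_space)
  also have "\<dots> \<le> (\<eta> + \<eta>\<^sup>2 / \<eta>) / 2"
    using EY EY2 \<eta> by (intro divide_right_mono add_left_mono) auto
  also have "\<dots> = \<eta>" using \<eta> by (simp add: power2_eq_square)
  finally have main: "expectation (\<lambda>x. (1 - \<Psi> x) * (1 - Y x)) \<le> \<eta>" .
  have int_\<Psi>Y: "integrable M (\<lambda>x. (1 - \<Psi> x) * Y x)"
    unfolding Y_def sum_distrib_left times_divide_eq_right using int_\<Psi>Z by auto
  have "expectation (\<lambda>x. (1 - \<Psi> x) * (1 - Y x)) = 1 - expectation \<Psi> - expectation (\<lambda>x. (1 - \<Psi> x) * Y x)"
    using int_\<Psi> int_\<Psi>Y by (simp add: right_diff_distrib[of "1 - _" 1] prob_space)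
  also have "expectation (\<lambda>x. (1 - \<Psi> x) * Y x) = (\<Sum>i\<in>I. expectation (\<lambda>x. (1 - \<Psi> x) * Z i x)) / ?P"
    unfolding Y_def sum_distrib_left times_divide_eq_right using int_\<Psi>Z by simp
  finally have avg: "1 - \<eta> - expectation \<Psi> \<le> (\<Sum>i\<in>I. expectation (\<lambda>x. (1 - \<Psi> x) * Z i x)) / ?P"
    using main by linarith
  show ?thesis
  proof (rule ccontr)
    assume "\<not> ?thesis"
    then have "(\<Sum>i\<in>I. expectation (\<lambda>x. (1 - \<Psi> x) * Z i x)) < (\<Sum>i\<in>I. 1 - \<eta> - expectation \<Psi>)"
      using I by (intro sum_strict_mono) (auto simp: not_le algebra_simps)
    then show False using avg P by (simp add: field_simps)
  qed
qed

text \<open>Agreement on boxes determines the product measure, and on a box the integral of the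
  product density factors.\<close>

lemma PiM_density:
  fixes u :: "'a \<Rightarrow> ennreal"
  assumes I: "finite I" and N: "prob_space N" and u[measurable]: "u \<in> borel_measurable N"
    and D: "prob_space (density N u)"
  shows "(\<Pi>\<^sub>M i\<in>I. density N u) = density (\<Pi>\<^sub>M i\<in>I. N) (\<lambda>X. \<Prod>i\<in>I. u (X i))"
proof -
  interpret N: prob_space N by fact
  interpret D: prob_space "density N u" by fact
  interpret PN: product_sigma_finite "\<lambda>_. N" by standard
  interpret PD: product_sigma_finite "\<lambda>_. density N u" by standard
  show ?thesis
  proof (rule PD.PiM_eqI[OF I, symmetric])
    show "sets (density (\<Pi>\<^sub>M i\<in>I. N) (\<lambda>X. \<Prod>i\<in>I. u (X i))) = sets (\<Pi>\<^sub>M i\<in>I. density N u)"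
      by (simp cong: sets_PiM_cong)
    fix A assume A: "\<And>i. i \<in> I \<Longrightarrow> A i \<in> sets (density N u)"
    then have [measurable]: "\<And>i. i \<in> I \<Longrightarrow> A i \<in> sets N" by simp
    have box: "Pi\<^sub>E I A \<in> sets (\<Pi>\<^sub>M i\<in>I. N)" using A I by (intro sets_PiM_I_finite) auto
    have "emeasure (density (\<Pi>\<^sub>M i\<in>I. N) (\<lambda>X. \<Prod>i\<in>I. u (X i))) (Pi\<^sub>E I A)
        = (\<integral>\<^sup>+X. (\<Prod>i\<in>I. u (X i)) * indicator (Pi\<^sub>E I A) X \<partial>(\<Pi>\<^sub>M i\<in>I. N))"
      by (rule emeasure_density[OF _ box]) measurable
    also have "\<dots> = (\<integral>\<^sup>+X. (\<Prod>i\<in>I. u (X i) * indicator (A i) (X i)) \<partial>(\<Pi>\<^sub>M i\<in>I. N))"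
    proof (rule nn_integral_cong)
      fix X assume X: "X \<in> space (\<Pi>\<^sub>M i\<in>I. N)"
      have "indicator (Pi\<^sub>E I A) X = (\<Prod>i\<in>I. indicator (A i) (X i) :: ennreal)"
      proof (cases "\<forall>i\<in>I. X i \<in> A i")
        case True
        then show ?thesis using X by (auto simp: space_PiM PiE_def)
      next
        case False
        then obtain i where "i \<in> I" "X i \<notin> A i" by auto
        then have "(\<Prod>i\<in>I. indicator (A i) (X i) :: ennreal) = 0"
          using I by (intro prod_zero bexI[of _ i]) auto
        moreover have "X \<notin> Pi\<^sub>E I A" using False by auto
        ultimately show ?thesis by simp
      qed
      then show "(\<Prod>i\<in>I. u (X i)) * indicator (Pi\<^sub>E I A) X = (\<Prod>i\<in>I. u (X i) * indicator (A i) (X i))"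
        by (simp add: prod.distrib)
    qed
    also have "\<dots> = (\<Prod>i\<in>I. \<integral>\<^sup>+x. u x * indicator (A i) x \<partial>N)"
      by (rule PN.product_nn_integral_prod[OF I]) measurable
    also have "\<dots> = (\<Prod>i\<in>I. emeasure (density N u) (A i))"
      using A by (intro prod.cong refl) (simp add: emeasure_density)
    finally show "emeasure (density (\<Pi>\<^sub>M i\<in>I. N) (\<lambda>X. \<Prod>i\<in>I. u (X i))) (Pi\<^sub>E I A)
        = (\<Prod>i\<in>I. emeasure (density N u) (A i))" .
  qed
qed

definition likelihood_ratio :: "nat \<Rightarrow> (real \<Rightarrow> real) \<Rightarrow> (real \<Rightarrow> real) \<Rightarrow> (nat \<Rightarrow> real) \<Rightarrow> real" where
  "likelihood_ratio n f0 f X = (\<Prod>i\<in>{1..n}. f (X i) / f0 (X i))"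

context
  fixes f0 f :: "real \<Rightarrow> real"
  assumes f0: "f0 \<in> cont_densities" "\<And>x. x \<in> {0..1} \<Longrightarrow> f0 x > 0" and f: "f \<in> cont_densities"
begin

lemma continuous_ratio: "continuous_on {0..1} (\<lambda>x. f x / f0 x)"
  using f0 f by (intro continuous_intros) (force simp: cont_densities_def)+

lemma sample_law_density:
  "sample_law n f = density (sample_law n f0) (\<lambda>X. ennreal (likelihood_ratio n f0 f X))"
proof -
  let ?u = "\<lambda>x. ennreal (f x / f0 x)"
  have [measurable]: "f0 \<in> borel_measurable leb01" "f \<in> borel_measurable leb01"
    using f0 f by (auto simp: cont_densities_def intro!: borel_measurable_leb01)
  have eq: "density leb01 (\<lambda>x. ennreal (f x)) = density (density leb01 (\<lambda>x. ennreal (f0 x))) ?u"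
  proof (subst density_density_eq)
    show "density leb01 (\<lambda>x. ennreal (f x)) = density leb01 (\<lambda>x. ennreal (f0 x) * ?u x)"
    proof (rule density_cong)
      show "AE x in leb01. ennreal (f x) = ennreal (f0 x) * ?u x"
      proof (rule AE_I2)
        fix x assume "x \<in> space leb01"
        then have "f0 x > 0" "f x \<ge> 0" using f0 f by (auto simp: cont_densities_def)
        then show "ennreal (f x) = ennreal (f0 x) * ?u x" by (simp flip: ennreal_mult)
      qed
    qed measurable
  qed measurable
  have "sample_law n f = density (sample_law n f0) (\<lambda>X. \<Prod>i\<in>{1..n}. ?u (X i))"
    unfolding sample_law_def eq
    by (rule PiM_density) (use density_prob_space[OF f0(1)] density_prob_space[OF f] eq in \<open>auto\<close>)
  also have "\<dots> = density (sample_law n f0) (\<lambda>X. ennreal (likelihood_ratio n f0 f X))"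
  proof (rule density_cong)
    show "AE X in sample_law n f0. (\<Prod>i\<in>{1..n}. ?u (X i)) = ennreal (likelihood_ratio n f0 f X)"
    proof (rule AE_I2)
      fix X assume "X \<in> space (sample_law n f0)"
      then have "X i \<in> {0..1}" if "i \<in> {1..n}" for i
        using that by (auto simp: sample_space_def space_PiM PiE_iff)
      then have "f (X i) / f0 (X i) \<ge> 0" if "i \<in> {1..n}" for i
        using that f0 f by (force simp: cont_densities_def intro!: divide_nonneg_nonneg)
      then show "(\<Prod>i\<in>{1..n}. ?u (X i)) = ennreal (likelihood_ratio n f0 f X)"
        unfolding likelihood_ratio_def by (rule prod_ennreal)
    qed
  qed (simp_all add: likelihood_ratio_def[abs_def] sample_law_def, measurable)
  finally show ?thesis .
qed

lemma likelihood_ratio_measurable: "likelihood_ratio n f0 f \<in> borel_measurable (sample_space n)"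
proof -
  have [measurable]: "(\<lambda>x. f x / f0 x) \<in> borel_measurable leb01"
    by (intro borel_measurable_leb01 continuous_ratio)
  show ?thesis unfolding likelihood_ratio_def[abs_def] sample_space_def by measurable
qed

lemma likelihood_ratio_nonneg: "X \<in> space (sample_space n) \<Longrightarrow> likelihood_ratio n f0 f X \<ge> 0"
  unfolding likelihood_ratio_def using f0 f
  by (intro prod_nonneg ballI divide_nonneg_nonneg)
    (force simp: cont_densities_def sample_space_def space_PiM PiE_iff)+

lemma likelihood_ratio_bounded:
  assumes "\<And>x. x \<in> {0..1} \<Longrightarrow> f x / f0 x \<le> c" "X \<in> space (sample_space n)"
  shows "\<bar>likelihood_ratio n f0 f X\<bar> \<le> c ^ n"
proof -
  have X: "X i \<in> {0..1}" if "i \<in> {1..n}" for i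
    using that assms(2) by (auto simp: sample_space_def space_PiM PiE_iff)
  have "likelihood_ratio n f0 f X \<le> (\<Prod>i\<in>{1..n}. c)"
    unfolding likelihood_ratio_def
    using X assms(1) f0 f by (intro prod_mono conjI divide_nonneg_nonneg) (force simp: cont_densities_def)+
  then show ?thesis using likelihood_ratio_nonneg[OF assms(2)] by simp
qed

end

lemma LINT_product_sample_law:
  assumes f0: "f0 \<in> cont_densities" and h: "continuous_on {0..1} h"
  shows "(LINT X|sample_law n f0. (\<Prod>i\<in>{1..n}. h (X i))) = (LINT x|leb01. f0 x * h x) ^ n"
proof -
  let ?Q = "density leb01 (\<lambda>x. ennreal (f0 x))"
  interpret Q: prob_space ?Q by (rule density_prob_space[OF f0])
  interpret product_sigma_finite "\<lambda>_. ?Q" by standard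
  have cf: "continuous_on {0..1} f0" "\<And>x. x \<in> {0..1} \<Longrightarrow> f0 x \<ge> 0" using f0 by (auto simp: cont_densities_def)
  have "integrable ?Q h"
  proof (subst integrable_real_density)
    show "integrable leb01 (\<lambda>x. f0 x * h x)" by (intro integrable_leb01 continuous_intros cf h)
  qed (use cf h in \<open>auto intro!: borel_measurable_leb01 AE_I2\<close>)
  then have "(LINT X|sample_law n f0. (\<Prod>i\<in>{1..n}. h (X i))) = (\<Prod>i\<in>{1..n}. LINT x|?Q. h x)"
    unfolding sample_law_def by (intro product_integral_prod) auto
  then show ?thesis by (simp add: LINT_density_leb01[OF f0 h])
qed

section \<open>Perturbed densities and their chi-square divergence\<close>

context localized_wavelets
begin

text \<open>The wavelet at \<open>j\<close>, \<open>k\<close> belongs to the base density, while the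
  one at \<open>J\<close>, \<open>m\<close> is the perturbation to be detected. Amplitude
  \<open>a = 0\<close> recovers the base density, so one set of facts covers both.\<close>

definition bump :: "real \<Rightarrow> nat \<Rightarrow> nat \<Rightarrow> real \<Rightarrow> nat \<Rightarrow> nat \<Rightarrow> real \<Rightarrow> real" where
  "bump b j k a J m x = 1 + b * wav W j k x + a * wav W J m x"

context
  fixes b a :: real and j k J m :: nat
  assumes j: "base_level W \<le> j" "k \<in> {1..2 ^ j}" and J: "base_level W \<le> J" "m \<in> {1..2 ^ J}" "j \<noteq> J"
begin

lemma continuous_bump: "continuous_on {0..1} (bump b j k a J m)"
  unfolding bump_def[abs_def] by (intro continuous_intros continuous_wav j J)

lemma wav_coeff_bump:
  assumes l: "base_level W \<le> l" "i \<in> {1..2 ^ l}"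
  shows "wav_coeff W l i (bump b j k a J m) = (if l = j \<and> i = k then b else 0) + (if l = J \<and> i = m then a else 0)"
proof -
  have "wav_coeff W l i (bump b j k a J m)
      = (LINT x|leb01. wav W l i x) + b * (LINT x|leb01. wav W j k x * wav W l i x) + a * (LINT x|leb01. wav W J m x * wav W l i x)"
    unfolding wav_coeff_def bump_def distrib_right mult_1_left mult.assoc
    by (subst Bochner_Integration.integral_add Bochner_Integration.integral_add integral_mult_right_zero,
        (intro integrable_leb01 continuous_intros continuous_wav j J l)+)+ simp
  then show ?thesis using j J l by (auto simp: LINT_wav LINT_wav_wav)
qed

text \<open>By orthogonality only the constant 1 contributes. Its coefficient is bounded through |x|
  <= (1 + x^2) / 2 and the unit L2 norm of the scaling function.\<close>

lemma scal_coeff_bump: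
  assumes i: "i \<in> {1..num_scal W}"
  shows "\<bar>scal_coeff W i (bump b j k a J m)\<bar> \<le> 1"
proof -
  have s: "(LINT x|leb01. wav W l p x * scal W i x) = 0" if "base_level W \<le> l" "p \<in> {1..2 ^ l}" for l p
    using LINT_scal_wav[OF that(1) i that(2)] by (simp add: mult.commute)
  have "scal_coeff W i (bump b j k a J m)
      = (LINT x|leb01. scal W i x) + b * (LINT x|leb01. wav W j k x * scal W i x) + a * (LINT x|leb01. wav W J m x * scal W i x)"
    unfolding scal_coeff_def bump_def distrib_right mult_1_left mult.assoc
    by (subst Bochner_Integration.integral_add Bochner_Integration.integral_add integral_mult_right_zero,
        (intro integrable_leb01 continuous_intros continuous_wav continuous_scal i j J)+)+ simp
  also have "\<dots> = (LINT x|leb01. scal W i x)" using s j J by simp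
  also have "\<bar>\<dots>\<bar> \<le> (LINT x|leb01. \<bar>scal W i x\<bar>)" by (rule integral_abs_bound)
  also have "\<dots> \<le> (LINT x|leb01. (1 + (scal W i x)\<^sup>2) / 2)"
  proof (rule LINT_leb01_mono)
    fix x
    have "0 \<le> (\<bar>scal W i x\<bar> - 1)\<^sup>2" by simp
    then show "\<bar>scal W i x\<bar> \<le> (1 + (scal W i x)\<^sup>2) / 2" by (simp add: power2_diff)
  qed (intro continuous_intros continuous_scal i; simp)+
  also have "\<dots> = (1 + (LINT x|leb01. (scal W i x)\<^sup>2)) / 2"
  proof -
    have "integrable leb01 (\<lambda>x. (scal W i x)\<^sup>2)" by (intro integrable_leb01 continuous_intros continuous_scal i)
    moreover have "integrable leb01 (\<lambda>x. 1::real)" by (intro integrable_leb01 continuous_intros)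
    ultimately show ?thesis by simp
  qed
  also have "(LINT x|leb01. (scal W i x)\<^sup>2) = 1"
    using LINT_elem_square[of "(None, i)" 0] i by (simp add: idx_def elem_def)
  finally show ?thesis by simp
qed

lemma bump_ge:
  assumes small: "\<bar>b\<bar> * (C * 2 powr (j / 2)) \<le> 1/2" and x: "x \<in> {0..1}"
  shows "1/2 + a * wav W J m x \<le> bump b j k a J m x" "bump b j k a J m x \<le> 3/2 + a * wav W J m x"
proof -
  have "\<bar>b * wav W j k x\<bar> \<le> \<bar>b\<bar> * (C * 2 powr (j / 2))"
    unfolding abs_mult using abs_wav_le[OF x j] by (intro mult_left_mono) auto
  then have "\<bar>b * wav W j k x\<bar> \<le> 1/2" using small by linarith
  then show "1/2 + a * wav W J m x \<le> bump b j k a J m x" "bump b j k a J m x \<le> 3/2 + a * wav W J m x"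
    unfolding bump_def by linarith+
qed

text \<open>Each perturbation moves the constant 1 by at most 1/2, so the sum stays nonnegative, and
  wavelets integrate to 0, so the mass stays 1. Here \<open>B \<ge> 1\<close> accommodates the
  scaling coefficients.\<close>

lemma bump_in_holder_class:
  assumes small: "\<bar>b\<bar> * (C * 2 powr (j / 2)) \<le> 1/2" "\<bar>a\<bar> * (C * 2 powr (J / 2)) \<le> 1/2"
    and B: "B \<ge> 1" "\<bar>b\<bar> \<le> B * 2 powr (- (real j * (q + 1/2)))" "\<bar>a\<bar> \<le> B * 2 powr (- (real J * (q + 1/2)))"
  shows "bump b j k a J m \<in> holder_class W B q"
proof (rule holder_classI)
  show "bump b j k a J m \<in> cont_densities"
    unfolding cont_densities_def
  proof (intro CollectI conjI ballI continuous_bump)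
    fix x :: real assume x: "x \<in> {0..1}"
    have "\<bar>a * wav W J m x\<bar> \<le> \<bar>a\<bar> * (C * 2 powr (J / 2))"
      unfolding abs_mult using abs_wav_le[OF x J(1,2)] by (intro mult_left_mono) auto
    then show "0 \<le> bump b j k a J m x"
      using bump_ge[OF small(1) x] small(2) by linarith
  next
    have "(LINT x|leb01. bump b j k a J m x) = 1 + b * (LINT x|leb01. wav W j k x) + a * (LINT x|leb01. wav W J m x)"
    proof -
      have "integrable leb01 (wav W j k)" "integrable leb01 (wav W J m)" "integrable leb01 (\<lambda>x. 1::real)"
        by (intro integrable_leb01 continuous_wav j J continuous_intros)+
      then show ?thesis unfolding bump_def[abs_def] by simp
    qed
    then show "(LINT x|leb01. bump b j k a J m x) = 1" using j J by (simp add: LINT_wav)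
  qed
  show "\<bar>scal_coeff W i (bump b j k a J m)\<bar> \<le> B" if "i \<in> {1..num_scal W}" for i
    using scal_coeff_bump[OF that] B by linarith
  show "\<bar>wav_coeff W l i (bump b j k a J m)\<bar> \<le> B * 2 powr (- (real l * (q + 1/2)))"
    if "base_level W \<le> l" "i \<in> {1..2 ^ l}" for l i
    using wav_coeff_bump[OF that] B J by auto
qed

end

text \<open>The base density carries one bump at a fixed level, so that its distance from \<open>\<Sigma>(t)\<close>
  stays bounded below while the separation required in part (c) tends to 0.\<close>

definition base_bump :: "real \<Rightarrow> nat \<Rightarrow> nat \<Rightarrow> real \<Rightarrow> real" where
  "base_bump b j k x = 1 + b * wav W j k x"

lemma base_bump_eq: "base_bump b j k = bump b j k 0 J m"
  by (simp add: base_bump_def[abs_def] bump_def[abs_def])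

text \<open>Positions are spaced by \<open>2 * M + 1\<close>, whereas two interior wavelets that are
  nonzero at the same point have positions at most \<open>2 * M\<close> apart.\<close>

lemma interior_disjoint:
  assumes "base_level W \<le> J" "x \<in> {0..1}" "i \<noteq> i'"
    and "M + 1 + (2 * M + 1) * i + M \<le> 2 ^ J" "M + 1 + (2 * M + 1) * i' + M \<le> 2 ^ J"
  shows "wav W J (M + 1 + (2 * M + 1) * i) x * wav W J (M + 1 + (2 * M + 1) * i') x = 0"
proof (rule ccontr)
  let ?m = "\<lambda>i. M + 1 + (2 * M + 1) * i"
  assume "wav W J (?m i) x * wav W J (?m i') x \<noteq> 0"
  then have nz: "wav W J (?m i) x \<noteq> 0" "wav W J (?m i') x \<noteq> 0" by (metis mult_zero_left, metis mult_zero_right)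
  have "\<bar>2 ^ J * x - real (?m i)\<bar> \<le> real M" "\<bar>2 ^ J * x - real (?m i')\<bar> \<le> real M"
    by (rule wav_support[OF assms(1) _ assms(4,2) nz(1)], simp)
      (rule wav_support[OF assms(1) _ assms(5,2) nz(2)], simp)
  then have "real (?m i) \<le> real (?m i' + 2 * M)" "real (?m i') \<le> real (?m i + 2 * M)" by auto
  then have le: "?m i \<le> ?m i' + 2 * M" "?m i' \<le> ?m i + 2 * M" by (simp_all only: of_nat_le_iff)
  have step: "?m p \<ge> ?m q + (2 * M + 1)" if "q < p" for p q
  proof -
    have "(2 * M + 1) * p \<ge> (2 * M + 1) * (q + 1)" using that by (intro mult_le_mono) auto
    then show ?thesis by simp
  qed
  from assms(3) consider "i < i'" | "i' < i" by linarith
  then show False by cases (use le step[of i i'] step[of i' i] in linarith)+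
qed

text \<open>The integrand expands to f0 + a w + a w' + a^2 w w' / f0. The linear terms integrate to
  0, the quadratic one vanishes for disjoint supports, and on the diagonal f0 >= 1/2 bounds it by 2
  a^2 w^2.\<close>

lemma LINT_bump_product:
  assumes j: "base_level W \<le> j" "k \<in> {1..2 ^ j}" and J: "base_level W \<le> J" "j \<noteq> J"
    and m: "m \<in> {1..2 ^ J}" "m' \<in> {1..2 ^ J}"
    and small: "\<bar>b\<bar> * (C * 2 powr (j / 2)) \<le> 1/2"
  defines "f0 \<equiv> base_bump b j k"
  shows "(\<And>x. x \<in> {0..1} \<Longrightarrow> wav W J m x * wav W J m' x = 0) \<Longrightarrow>
      (LINT x|leb01. f0 x * (bump b j k a J m x / f0 x * (bump b j k a J m' x / f0 x))) = 1"
    and "m = m' \<Longrightarrow> (LINT x|leb01. f0 x * (bump b j k a J m x / f0 x * (bump b j k a J m' x / f0 x))) \<le> 1 + 2 * a\<^sup>2"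
proof -
  let ?w = "wav W J m" and ?w' = "wav W J m'"
  have f0_ge: "f0 x \<ge> 1/2" if "x \<in> {0..1}" for x
    using bump_ge(1)[OF j J(1) m(1) J(2) small that, of 0] by (simp add: f0_def base_bump_def bump_def)
  have c0: "continuous_on {0..1} f0" unfolding f0_def base_bump_def[abs_def]
    by (intro continuous_intros continuous_wav j)
  have cb: "continuous_on {0..1} (bump b j k a J m)" "continuous_on {0..1} (bump b j k a J m')"
    by (intro continuous_bump j J m)+
  have cw: "continuous_on {0..1} ?w" "continuous_on {0..1} ?w'" by (intro continuous_wav J m)+
  have nz: "\<forall>x\<in>{0..1}. f0 x \<noteq> 0" using f0_ge by force
  have bump: "bump b j k a J p x = f0 x + a * wav W J p x" for p x by (simp add: bump_def f0_def base_bump_def)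
  have expand: "f0 x * (bump b j k a J m x / f0 x * (bump b j k a J m' x / f0 x))
      = f0 x + a * ?w x + a * ?w' x + a\<^sup>2 * (?w x * ?w' x) / f0 x" if "x \<in> {0..1}" for x
    using nz that by (simp add: bump field_simps power2_eq_square)
  have i0: "integrable leb01 f0" "integrable leb01 ?w" "integrable leb01 ?w'" "integrable leb01 (\<lambda>x. (?w x)\<^sup>2)"
    by (intro integrable_leb01 continuous_intros c0 cw)+
  have "integrable leb01 (\<lambda>x. 1::real)" "integrable leb01 (wav W j k)"
    by (intro integrable_leb01 continuous_intros continuous_wav j)+
  then have L0: "(LINT x|leb01. f0 x) = 1"
    unfolding f0_def base_bump_def[abs_def] using LINT_wav[OF j] by simp
  have Lw: "(LINT x|leb01. ?w x) = 0" "(LINT x|leb01. ?w' x) = 0" using LINT_wav[OF J(1)] m by auto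
  {
    assume disj: "\<And>x. x \<in> {0..1} \<Longrightarrow> ?w x * ?w' x = 0"
    have "(LINT x|leb01. f0 x * (bump b j k a J m x / f0 x * (bump b j k a J m' x / f0 x)))
        = (LINT x|leb01. f0 x + a * ?w x + a * ?w' x)"
      by (rule Bochner_Integration.integral_cong[OF refl], subst expand) (use disj in auto)
    also have "\<dots> = 1" using i0 L0 Lw by simp
    finally show "(LINT x|leb01. f0 x * (bump b j k a J m x / f0 x * (bump b j k a J m' x / f0 x))) = 1" .
  next
    assume mm: "m = m'"
    have "(LINT x|leb01. f0 x * (bump b j k a J m x / f0 x * (bump b j k a J m' x / f0 x)))
        \<le> (LINT x|leb01. f0 x + a * ?w x + a * ?w' x + 2 * a\<^sup>2 * (?w x)\<^sup>2)"
    proof (rule LINT_leb01_mono)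
      fix x :: real assume x: "x \<in> {0..1}"
      have "a\<^sup>2 * (?w x * ?w x) / f0 x \<le> a\<^sup>2 * (?w x * ?w x) / (1/2)"
        using f0_ge[OF x] by (intro divide_left_mono) auto
      then show "f0 x * (bump b j k a J m x / f0 x * (bump b j k a J m' x / f0 x))
          \<le> f0 x + a * ?w x + a * ?w' x + 2 * a\<^sup>2 * (?w x)\<^sup>2"
        unfolding expand[OF x] by (simp add: mm power2_eq_square mult_ac)
    qed (intro continuous_intros c0 cb cw nz)+
    also have "\<dots> = 1 + 2 * a\<^sup>2"
    proof -
      have "(LINT x|leb01. (?w x)\<^sup>2) = 1"
        using LINT_wav_wav[OF J(1) J(1) m(1) m(1)] by (simp add: power2_eq_square)
      then show ?thesis using i0 L0 Lw by simp
    qed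
    finally show "(LINT x|leb01. f0 x * (bump b j k a J m x / f0 x * (bump b j k a J m' x / f0 x))) \<le> 1 + 2 * a\<^sup>2" .
  }
qed

text \<open>The chi-square divergence between the uniform mixture of the \<open>P\<close> bumped densities and the
  base density is at most \<open>(1 + 2 * a\<^sup>2) ^ n / P\<close>.\<close>

lemma bump_mixture:
  assumes j: "base_level W \<le> j" "k \<in> {1..2 ^ j}" and J: "base_level W \<le> J" "j \<noteq> J"
    and small: "\<bar>b\<bar> * (C * 2 powr (j / 2)) \<le> 1/2" "\<bar>a\<bar> * (C * 2 powr (J / 2)) \<le> 1/2"
    and P: "P > 0" "(2 * M + 1) * P \<le> 2 ^ J" and \<eta>: "\<eta> > 0" "(1 + 2 * a\<^sup>2) ^ n / P \<le> \<eta>\<^sup>2"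
    and \<Psi>: "\<Psi> \<in> borel_measurable (sample_space n)" "\<And>X. X \<in> space (sample_space n) \<Longrightarrow> 0 \<le> \<Psi> X \<and> \<Psi> X \<le> 1"
  shows "\<exists>i<P. ennreal (1 - \<eta>) \<le> (\<integral>\<^sup>+X. ennreal (\<Psi> X) \<partial>sample_law n (base_bump b j k))
      + (\<integral>\<^sup>+X. ennreal (1 - \<Psi> X) \<partial>sample_law n (bump b j k a J (M + 1 + (2 * M + 1) * i)))"
proof -
  define f0 where "f0 = base_bump b j k"
  define m where "m i = M + 1 + (2 * M + 1) * i" for i
  define f where "f i = bump b j k a J (m i)" for i
  have m_le: "m i + M \<le> 2 ^ J" if "i < P" for i
  proof -
    have "(2 * M + 1) * (i + 1) \<le> (2 * M + 1) * P" using that by (intro mult_le_mono) auto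
    then show ?thesis using P(2) by (simp add: m_def)
  qed
  then have m: "m i \<in> {1..2 ^ J}" if "i < P" for i using that by (force simp: m_def)
  have dens: "bump b j k a' J (m i) \<in> cont_densities" if "i < P" "\<bar>a'\<bar> * (C * 2 powr (J / 2)) \<le> 1/2" for i a'
  proof -
    \<comment> \<open>Only continuity, nonnegativity and unit mass are wanted here, so smoothness 0
      is used with a radius chosen large enough for both amplitudes.\<close>
    define B where "B = max 1 (max (\<bar>b\<bar> / 2 powr (- (real j * (0 + 1/2)))) (\<bar>a'\<bar> / 2 powr (- (real J * (0 + 1/2)))))"
    have "\<bar>b\<bar> / 2 powr (- (real j * (0 + 1/2))) \<le> B" "\<bar>a'\<bar> / 2 powr (- (real J * (0 + 1/2))) \<le> B"
      by (auto simp: B_def)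
    then have "\<bar>b\<bar> \<le> B * 2 powr (- (real j * (0 + 1/2)))" "\<bar>a'\<bar> \<le> B * 2 powr (- (real J * (0 + 1/2)))"
      by (simp_all add: pos_divide_le_eq)
    moreover have "B \<ge> 1" by (simp add: B_def)
    ultimately have "bump b j k a' J (m i) \<in> holder_class W B 0"
      by (intro bump_in_holder_class j J m that small)
    then show ?thesis by (simp add: holder_class_def)
  qed
  have f_dens: "f i \<in> cont_densities" if "i < P" for i unfolding f_def by (intro dens that small)
  have f0_dens: "f0 \<in> cont_densities"
    unfolding f0_def base_bump_eq[of b j k J "m 0"] by (rule dens) (use P in auto)
  have f0_ge: "f0 x \<ge> 1/2" if "x \<in> {0..1}" for x
    using bump_ge(1)[OF j J(1) m[OF P(1)] J(2) small(1) that, of 0] by (simp add: f0_def base_bump_def bump_def)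
  then have f0_pos: "\<And>x. x \<in> {0..1} \<Longrightarrow> f0 x > 0" by force
  have f_le: "f i x \<le> 2" if "i < P" "x \<in> {0..1}" for i x
  proof -
    have "\<bar>a * wav W J (m i) x\<bar> \<le> \<bar>a\<bar> * (C * 2 powr (J / 2))"
      unfolding abs_mult using abs_wav_le[OF that(2) J(1) m[OF that(1)]] by (intro mult_left_mono) auto
    then show ?thesis
      using bump_ge(2)[OF j J(1) m[OF that(1)] J(2) small(1) that(2), of a] small(2) unfolding f_def by linarith
  qed
  \<comment> \<open>Bounds the likelihood ratio by \<open>4 ^ n\<close>, which provides
    integrability.\<close>
  have ratio_le: "f i x / f0 x \<le> 4" if "i < P" "x \<in> {0..1}" for i x
    using f_le[OF that] f0_ge[OF that(2)] f0_pos[OF that(2)] by (simp add: pos_divide_le_eq)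
  interpret prob_space "sample_law n f0" by (rule prob_space_sample_law[OF f0_dens])
  define Z where "Z i = likelihood_ratio n f0 (f i)" for i
  note lr = f0_dens f0_pos f_dens
  have Z_meas: "Z i \<in> borel_measurable (sample_law n f0)" if "i < P" for i
    using likelihood_ratio_measurable[OF f0_dens f0_pos f_dens[OF that]] unfolding Z_def by simp
  \<comment> \<open>Independence makes the sample moment the n-th power of the one-observation
    moment: 1 off the diagonal, at most \<open>(1 + 2 * a\<^sup>2) ^ n\<close> on it.\<close>
  have ZZ: "expectation (\<lambda>X. Z i X * Z i' X) = (LINT x|leb01. f0 x * (f i x / f0 x * (f i' x / f0 x))) ^ n"
    if "i < P" "i' < P" for i i'
  proof -
    have "continuous_on {0..1} (\<lambda>x. f i x / f0 x * (f i' x / f0 x))"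
      using that by (intro continuous_on_mult continuous_ratio lr)
    from LINT_product_sample_law[OF f0_dens this, of n] show ?thesis
      unfolding Z_def likelihood_ratio_def prod.distrib .
  qed
  have nn: "ennreal (expectation (\<lambda>X. (1 - \<Psi> X) * Z i X)) = (\<integral>\<^sup>+X. ennreal (1 - \<Psi> X) \<partial>sample_law n (f i))"
    if "i < P" for i
  proof -
    have [measurable]: "Z i \<in> borel_measurable (sample_space n)" "\<Psi> \<in> borel_measurable (sample_space n)"
      using Z_meas[OF that] \<Psi>(1) by auto
    have bnd: "\<bar>Z i X\<bar> \<le> 4 ^ n" "0 \<le> Z i X" if "X \<in> space (sample_space n)" for X
      unfolding Z_def using \<open>i < P\<close> that
      by (auto intro!: likelihood_ratio_bounded likelihood_ratio_nonneg lr ratio_le)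
    have "(\<integral>\<^sup>+X. ennreal (1 - \<Psi> X) \<partial>sample_law n (f i))
        = (\<integral>\<^sup>+X. ennreal (Z i X) * ennreal (1 - \<Psi> X) \<partial>sample_law n f0)"
    proof -
      have "sample_law n (f i) = density (sample_law n f0) (\<lambda>X. ennreal (Z i X))"
        unfolding Z_def by (rule sample_law_density[OF f0_dens f0_pos f_dens[OF that]])
      then show ?thesis by (simp only:) (rule nn_integral_density; measurable)
    qed
    also have "\<dots> = (\<integral>\<^sup>+X. ennreal ((1 - \<Psi> X) * Z i X) \<partial>sample_law n f0)"
      using bnd \<Psi>(2) by (intro nn_integral_cong) (auto simp: ennreal_mult mult.commute)
    also have "\<dots> = ennreal (expectation (\<lambda>X. (1 - \<Psi> X) * Z i X))"
    proof (rule nn_integral_eq_integral)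
      show "integrable (sample_law n f0) (\<lambda>X. (1 - \<Psi> X) * Z i X)"
      proof (rule integrable_const_bound[of _ "1 * 4 ^ n"])
        show "AE X in sample_law n f0. norm ((1 - \<Psi> X) * Z i X) \<le> 1 * 4 ^ n"
        proof (rule AE_I2)
          fix X assume "X \<in> space (sample_law n f0)"
          then show "norm ((1 - \<Psi> X) * Z i X) \<le> 1 * 4 ^ n"
            unfolding real_norm_def abs_mult using bnd[of X] \<Psi>(2)[of X] by (intro mult_mono) auto
        qed
      qed measurable
      show "AE X in sample_law n f0. 0 \<le> (1 - \<Psi> X) * Z i X"
        using bnd \<Psi>(2) by (intro AE_I2) auto
    qed
    finally show ?thesis by simp
  qed
  have "\<exists>i\<in>{..<P}. 1 - \<eta> \<le> expectation \<Psi> + expectation (\<lambda>X. (1 - \<Psi> X) * Z i X)"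
  proof (rule mixture_lower_bound[where b="4 ^ n" and K="(1 + 2 * a\<^sup>2) ^ n"])
    show "\<bar>Z i X\<bar> \<le> 4 ^ n" if "i \<in> {..<P}" "X \<in> space (sample_law n f0)" for i X
      unfolding Z_def using that by (intro likelihood_ratio_bounded lr ratio_le) auto
    show "expectation (Z i) = 1" if "i \<in> {..<P}" for i
    proof -
      have i: "i < P" using that by simp
      have "expectation (Z i) = (LINT x|leb01. f0 x * (f i x / f0 x)) ^ n"
        unfolding Z_def likelihood_ratio_def
        using LINT_product_sample_law[OF f0_dens continuous_ratio[OF f0_dens f0_pos f_dens[OF i]], of n] by simp
      also have "(LINT x|leb01. f0 x * (f i x / f0 x)) = (LINT x|leb01. f i x)"
      proof (rule Bochner_Integration.integral_cong[OF refl])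
        fix x assume "x \<in> space leb01"
        then show "f0 x * (f i x / f0 x) = f i x" using f0_pos[of x] by simp
      qed
      finally show ?thesis using f_dens[OF i] by (simp add: cont_densities_def)
    qed
    show "expectation (\<lambda>X. Z i X * Z i' X) = 1" if "i \<in> {..<P}" "i' \<in> {..<P}" "i \<noteq> i'" for i i'
    proof -
      have "(LINT x|leb01. f0 x * (f i x / f0 x * (f i' x / f0 x))) = 1"
        unfolding f_def f0_def
      proof (rule LINT_bump_product(1)[OF j J _ _ small(1)])
        show "m i \<in> {1..2 ^ J}" "m i' \<in> {1..2 ^ J}" using that m by auto
        show "wav W J (m i) x * wav W J (m i') x = 0" if "x \<in> {0..1}" for x
          unfolding m_def using that \<open>i \<noteq> i'\<close> \<open>i \<in> {..<P}\<close> \<open>i' \<in> {..<P}\<close> m_le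
          by (intro interior_disjoint J) (auto simp: m_def)
      qed
      then show ?thesis using ZZ[of i i'] that by simp
    qed
    show "expectation (\<lambda>X. Z i X * Z i X) \<le> (1 + 2 * a\<^sup>2) ^ n" if "i \<in> {..<P}" for i
    proof -
      have "(LINT x|leb01. f0 x * (f i x / f0 x * (f i x / f0 x))) \<le> 1 + 2 * a\<^sup>2"
        unfolding f_def f0_def using that m by (intro LINT_bump_product(2)[OF j J _ _ small(1)]) auto
      moreover have "(LINT x|leb01. f0 x * (f i x / f0 x * (f i x / f0 x))) \<ge> 0"
        using f0_pos by (intro integral_nonneg_AE AE_I2) (auto intro!: mult_nonneg_nonneg simp: less_imp_le)
      ultimately show ?thesis using ZZ[of i i] that by (auto intro: power_mono)
    qed
  qed (use P \<eta> \<Psi> Z_meas in auto)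
  then obtain i where i: "i < P" and "1 - \<eta> \<le> expectation \<Psi> + expectation (\<lambda>X. (1 - \<Psi> X) * Z i X)" by auto
  then have "ennreal (1 - \<eta>) \<le> ennreal (expectation \<Psi> + expectation (\<lambda>X. (1 - \<Psi> X) * Z i X))"
    by (intro ennreal_leI)
  also have "\<dots> = ennreal (expectation \<Psi>) + ennreal (expectation (\<lambda>X. (1 - \<Psi> X) * Z i X))"
    using \<Psi>(2) likelihood_ratio_nonneg[OF f0_dens f0_pos f_dens[OF i]]
    by (intro ennreal_plus integral_nonneg_AE AE_I2) (auto simp: Z_def)
  also have "ennreal (expectation \<Psi>) = (\<integral>\<^sup>+X. ennreal (\<Psi> X) \<partial>sample_law n f0)"
    using \<Psi> by (intro nn_integral_eq_integral[symmetric] integrable_const_bound[of _ 1] AE_I2) auto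
  finally show ?thesis unfolding nn[OF i] using i by (auto simp: f0_def f_def m_def)
qed


text \<open>The amplitude is the largest that smoothness s permits at level \<open>j\<close>. It
  exceeds what smoothness t permits by the factor 2 powr (j (t - s)); \<open>j\<close> is taken
  large enough that this is at least 2, that the density stays positive, and that position
  \<open>M + 1\<close> is interior.\<close>

lemma base_bump_properties:
  assumes "0 < s" "s < t" "B \<ge> 1"
  obtains b j where "b > 0" "base_level W \<le> j" "2 * M + 1 \<le> 2 ^ j" "b = B * 2 powr (- (real j * (s + 1/2)))"
    "\<bar>b\<bar> * (C * 2 powr (j / 2)) \<le> 1/2" "base_bump b j (M + 1) \<in> holder_class W B s"
    "\<exists>c>0. (INF g\<in>holder_class W B t. sup_dist g (base_bump b j (M + 1))) \<ge> ennreal c"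
proof -
  have ts: "t - s > 0" using assms by simp
  have "(\<lambda>j::nat. B * C * 2 powr (- (s * real j))) \<longlonglongrightarrow> 0" using assms(1) by real_asymp
  then have "\<forall>\<^sub>F j in sequentially. B * C * 2 powr (- (s * real j)) < 1/2"
    by (rule order_tendstoD(2)) simp
  moreover have "filterlim (\<lambda>j::nat. 2 powr (real j * (t - s))) at_top sequentially" using ts by real_asymp
  then have "\<forall>\<^sub>F j::nat in sequentially. 2 \<le> 2 powr (real j * (t - s))"
    by (simp only: filterlim_at_top)
  moreover have "filterlim (\<lambda>j::nat. (2::real) ^ j) at_top sequentially" by real_asymp
  then have "\<forall>\<^sub>F j::nat in sequentially. real (2 * M + 1) \<le> 2 ^ j"
    by (simp only: filterlim_at_top)
  moreover have "\<forall>\<^sub>F j in sequentially. base_level W \<le> j" by (rule eventually_ge_at_top)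
  ultimately have "\<forall>\<^sub>F j in sequentially. B * C * 2 powr (- (s * real j)) < 1/2 \<and>
      2 \<le> 2 powr (real j * (t - s)) \<and> real (2 * M + 1) \<le> 2 ^ j \<and> base_level W \<le> j"
    by eventually_elim simp
  then obtain j where j: "B * C * 2 powr (- (s * real j)) < 1/2" "2 \<le> 2 powr (real j * (t - s))"
      "real (2 * M + 1) \<le> 2 ^ j" "base_level W \<le> j"
    using eventually_happens'[OF sequentially_bot] by blast
  define b where "b = B * 2 powr (- (real j * (s + 1/2)))"
  have b: "b > 0" using assms by (simp add: b_def)
  have M2: "2 * M + 1 \<le> 2 ^ j" using j(3) by (simp flip: of_nat_le_iff[where 'a=real])
  then have k: "M + 1 \<in> {1..2 ^ j}" "M < M + 1" "M + 1 + M \<le> 2 ^ j" by auto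
  have "\<bar>b\<bar> * (C * 2 powr (j / 2)) = B * C * (2 powr (- (real j * (s + 1/2))) * 2 powr (j / 2))"
    using b assms by (simp add: b_def)
  also have "2 powr (- (real j * (s + 1/2))) * 2 powr (j / 2) = 2 powr (- (s * real j))"
    by (simp add: powr_add[symmetric] algebra_simps)
  finally have small: "\<bar>b\<bar> * (C * 2 powr (j / 2)) \<le> 1/2" using j(1) by linarith
  \<comment> \<open>The second bump has amplitude 0; any level above \<open>j\<close> would
    serve.\<close>
  note base = base_bump_eq[of b j "M + 1" "Suc j" 1]
  have in_s: "base_bump b j (M + 1) \<in> holder_class W B s"
    unfolding base using b j k small assms by (intro bump_in_holder_class) (auto simp: b_def)
  have wc: "wav_coeff W j (M + 1) (base_bump b j (M + 1)) = b"
    unfolding base using j k by (subst wav_coeff_bump) auto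
  have "2 * (B * 2 powr (- (real j * (t + 1/2)))) \<le> 2 powr (real j * (t - s)) * (B * 2 powr (- (real j * (t + 1/2))))"
    using j(2) assms by (intro mult_right_mono) auto
  also have "\<dots> = B * (2 powr (real j * (t - s)) * 2 powr (- (real j * (t + 1/2))))" by simp
  also have "2 powr (real j * (t - s)) * 2 powr (- (real j * (t + 1/2))) = 2 powr (- (real j * (s + 1/2)))"
    by (simp add: powr_add[symmetric] algebra_simps)
  finally have large: "2 * (B * 2 powr (- (real j * (t + 1/2)))) \<le> b" by (simp add: b_def)
  have "(INF g\<in>holder_class W B t. sup_dist g (base_bump b j (M + 1))) \<ge> ennreal (b * 2 powr (j / 2) / (8 * M * C))"
  proof (rule INF_greatest)
    fix g assume "g \<in> holder_class W B t"
    then show "ennreal (b * 2 powr (j / 2) / (8 * M * C)) \<le> sup_dist g (base_bump b j (M + 1))"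
      using wav_coeff_separation[OF j(4) k(2,3) holder_class_cont[OF in_s], of B t g] large assms
      unfolding wc by auto
  qed
  moreover have "b * 2 powr (j / 2) / (8 * M * C) > 0" using b M_pos C_ge_1 by simp
  ultimately show ?thesis using that[of b j] b j(4) M2 b_def small in_s by blast
qed

text \<open>With \<open>a = \<epsilon> * 2 powr (- (J * (r + 1/2)))\<close> and \<open>J = level r n\<close>, the chi-square bound of
  \<open>bump_mixture\<close> is at most a constant times \<open>n powr \<gamma> * (ln n / n) powr (2 * \<gamma>)\<close>.\<close>

lemma chi_square_bound:
  fixes r \<epsilon> :: real and n :: nat
  defines "\<gamma> \<equiv> 1 / (2 * (2 * r + 1))"
  assumes r: "r > 0" and n: "n \<ge> 3" and \<epsilon>: "2 * \<epsilon>\<^sup>2 * 2 powr (2 * r + 1) \<le> \<gamma>"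
    and J: "2 * (2 * M + 1) \<le> 2 ^ level r n"
  shows "(1 + 2 * (\<epsilon> * 2 powr (- (real (level r n) * (r + 1/2))))\<^sup>2) ^ n / real (2 ^ level r n div (2 * M + 1))
    \<le> 4 * (2 * real M + 1) * (real n powr \<gamma> * (ln n / n) powr (2 * \<gamma>))"
proof -
  define J where "J = level r n"
  define t where "t = ln (real n) / real n"
  define u where "u = t powr (- 1 / (2 * r + 1))"
  define a where "a = \<epsilon> * 2 powr (- (real J * (r + 1/2)))"
  have t: "0 < t" using ln_over_n_bounds[OF n] by (auto simp: t_def)
  have u: "0 < u" using t by (simp add: u_def)
  have uJ: "u / 2 \<le> 2 powr J" using level_lower[OF r n] by (simp add: u_def t_def J_def)
  have "a\<^sup>2 = \<epsilon>\<^sup>2 * (2 powr J) powr (- (2 * r + 1))"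
  proof -
    have "(2 powr (- (real J * (r + 1/2))))\<^sup>2 = (2 powr J) powr (- (2 * r + 1))"
    proof -
      have "- (real J * (r + 1/2)) + - (real J * (r + 1/2)) = real J * - (2 * r + 1)" by (simp add: algebra_simps)
      then show ?thesis by (simp only: power2_eq_square powr_add[symmetric] powr_powr)
    qed
    then show ?thesis by (simp add: a_def power_mult_distrib)
  qed
  \<comment> \<open>The exponent is the one for which \<open>u powr (- (2 * r + 1))\<close> equals
    \<open>t\<close>. Hence \<open>n * a\<^sup>2\<close> is of order \<open>ln n\<close>, and
    \<epsilon> makes the resulting constant at most \<gamma>.\<close>
  also have "\<dots> \<le> \<epsilon>\<^sup>2 * (u / 2) powr (- (2 * r + 1))"
    using uJ u r by (intro mult_left_mono powr_mono2') auto
  also have "(u / 2) powr (- (2 * r + 1)) = t * 2 powr (2 * r + 1)"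
  proof -
    have "- 1 / (2 * r + 1) * - (2 * r + 1) = 1" using r by (simp add: field_simps)
    then have "u powr (- (2 * r + 1)) = t"
      using t by (simp only: u_def powr_powr) simp
    moreover have "(u / 2) powr (- (2 * r + 1)) = u powr (- (2 * r + 1)) / 2 powr (- (2 * r + 1))"
      by (rule powr_divide)
    ultimately show ?thesis by (simp only: powr_minus divide_inverse inverse_inverse_eq)
  qed
  finally have "n * (2 * a\<^sup>2) \<le> n * (2 * (\<epsilon>\<^sup>2 * (t * 2 powr (2 * r + 1))))"
    by (intro mult_left_mono) auto
  also have "\<dots> = (2 * \<epsilon>\<^sup>2 * 2 powr (2 * r + 1)) * ln n" using n by (simp add: t_def)
  also have "\<dots> \<le> \<gamma> * ln n" using \<epsilon> n by (intro mult_right_mono) auto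
  finally have exponent: "n * (2 * a\<^sup>2) \<le> \<gamma> * ln n" .
  have "(1 + 2 * a\<^sup>2) ^ n \<le> exp (2 * a\<^sup>2) ^ n"
    by (intro power_mono exp_ge_add_one_self) simp
  also have "\<dots> = exp (n * (2 * a\<^sup>2))" by (rule exp_of_nat_mult[symmetric])
  also have "\<dots> \<le> exp (\<gamma> * ln n)" using exponent by simp
  also have "\<dots> = real n powr \<gamma>" using n by (simp add: powr_def)
  finally have num: "(1 + 2 * a\<^sup>2) ^ n \<le> real n powr \<gamma>" .
  define P where "P = 2 ^ J div (2 * M + 1)"
  \<comment> \<open>The remainder of the division is at most \<open>2 * M\<close>, less than half of
    \<open>2 ^ J\<close> by assumption, so rounding costs at most a factor 2.\<close>
  have "(2::nat) ^ J \<le> (2 * M + 1) * P + 2 * M"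
    unfolding P_def using mod_less_divisor[of "2 * M + 1" "2 ^ J"] mult_div_mod_eq[of "2 * M + 1" "2 ^ J"] by linarith
  moreover have "2 * (2 * M + 1) \<le> (2::nat) ^ J" using J by (simp add: J_def)
  moreover have "x \<le> 2 * y" if "x \<le> y + 2 * M" "2 * (2 * M + 1) \<le> x" for x y :: nat
    using that by presburger
  ultimately have "(2::nat) ^ J \<le> 2 * ((2 * M + 1) * P)" by blast
  from of_nat_mono[OF this, where 'a=real] have "2 powr J \<le> 2 * (real (2 * M + 1) * real P)"
    by (simp add: powr_realpow algebra_simps)
  then have P: "u / (4 * (2 * real M + 1)) \<le> real P" using uJ by (simp add: pos_divide_le_eq algebra_simps)
  have "(1 + 2 * a\<^sup>2) ^ n / real P \<le> real n powr \<gamma> / (u / (4 * (2 * real M + 1)))"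
    using num P u by (intro frac_le) auto
  also have "\<dots> = 4 * (2 * real M + 1) * (real n powr \<gamma> * (1 / u))" by simp
  also have "1 / u = t powr (2 * \<gamma>)"
  proof -
    have "- 1 / (2 * r + 1) = - (2 * \<gamma>)" using r by (simp add: \<gamma>_def field_simps)
    then show ?thesis by (simp only: u_def powr_minus_divide) simp
  qed
  finally show ?thesis by (simp only: a_def P_def J_def t_def)
qed

text \<open>One construction for both lower bounds. \<open>f0\<close> does not vary with
  \<open>n\<close>, so its distance from smoothness t eventually exceeds any separation tending to
  0; finiteness of \<open>F n\<close> keeps unions of coverage events measurable.\<close>

lemma least_favourable:
  assumes r: "0 < r" "r < s" "s < t" and B: "B \<ge> 1"
  obtains f0 F c where "c > 0" "f0 \<in> holder_class W B s"
    "\<exists>c0>0. (INF g\<in>holder_class W B t. sup_dist g f0) \<ge> ennreal c0"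
    "\<And>n. finite (F n)" "\<forall>\<^sub>F n in sequentially. F n \<subseteq> separated_class W B r s (c * rate r n)"
    "\<And>\<eta>. \<eta> > 0 \<Longrightarrow> \<forall>\<^sub>F n in sequentially. \<forall>\<Psi>\<in>borel_measurable (sample_space n).
       (\<forall>X\<in>space (sample_space n). 0 \<le> \<Psi> X \<and> \<Psi> X \<le> 1) \<longrightarrow>
       (\<exists>f\<in>F n. ennreal (1 - \<eta>) \<le> (\<integral>\<^sup>+X. ennreal (\<Psi> X) \<partial>sample_law n f0) + (\<integral>\<^sup>+X. ennreal (1 - \<Psi> X) \<partial>sample_law n f))"
proof -
  have s: "0 < s" using r by simp
  obtain b j where b: "b > 0" and j: "base_level W \<le> j" "2 * M + 1 \<le> 2 ^ j"
    and b_def: "b = B * 2 powr (- (real j * (s + 1/2)))" and small: "\<bar>b\<bar> * (C * 2 powr (j / 2)) \<le> 1/2"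
    and in_s: "base_bump b j (M + 1) \<in> holder_class W B s"
    and sep0: "\<exists>c>0. (INF g\<in>holder_class W B t. sup_dist g (base_bump b j (M + 1))) \<ge> ennreal c"
    by (rule base_bump_properties[OF s r(3) B])
  have k: "M + 1 \<in> {1..2 ^ j}" using j(2) by auto
  \<comment> \<open>The number of bumps is of order (n / ln n) powr (2 \<gamma>), so a chi-square
    numerator of at most n powr \<gamma> leaves a quotient that tends to 0.\<close>
  define \<gamma> where "\<gamma> = 1 / (2 * (2 * r + 1))"
  have \<gamma>: "\<gamma> > 0" using r by (simp add: \<gamma>_def)
  \<comment> \<open>The first bound keeps the perturbed functions nonnegative and, as
    \<open>C \<ge> 1\<close>, their coefficients within the radius B; the second is the condition of
    \<open>chi_square_bound\<close>.\<close>
  define \<epsilon> where "\<epsilon> = min (1 / (2 * C)) (sqrt (\<gamma> / (2 * 2 powr (2 * r + 1))))"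
  have \<epsilon>: "\<epsilon> > 0" using \<gamma> C_ge_1 by (simp add: \<epsilon>_def)
  have \<epsilon>C: "\<epsilon> * C \<le> 1/2"
  proof -
    have "\<epsilon> * C \<le> 1 / (2 * C) * C" using C_ge_1 by (intro mult_right_mono) (auto simp: \<epsilon>_def)
    then show ?thesis using C_ge_1 by simp
  qed
  have \<epsilon>2: "2 * \<epsilon>\<^sup>2 * 2 powr (2 * r + 1) \<le> \<gamma>"
  proof -
    have "\<epsilon>\<^sup>2 \<le> (sqrt (\<gamma> / (2 * 2 powr (2 * r + 1))))\<^sup>2" using \<epsilon> by (intro power_mono) (auto simp: \<epsilon>_def)
    also have "\<dots> = \<gamma> / (2 * 2 powr (2 * r + 1))" using \<gamma> by simp
    finally show ?thesis by (simp add: pos_le_divide_eq mult_ac)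
  qed
  have \<epsilon>B: "\<epsilon> \<le> B" using \<epsilon>C \<epsilon> C_ge_1 B mult_left_mono[of 1 C \<epsilon>] by linarith
  define a where "a n = \<epsilon> * 2 powr (- (real (level r n) * (r + 1/2)))" for n
  define P where "P n = 2 ^ level r n div (2 * M + 1)" for n
  define f where "f n i = bump b j (M + 1) (a n) (level r n) (M + 1 + (2 * M + 1) * i)" for n i
  define F where "F n = f n ` {..<P n}" for n
  define c where "c = \<epsilon> / (8 * M * C)"
  have c: "c > 0" using \<epsilon> M_pos C_ge_1 by (simp add: c_def)
  have a_small: "\<bar>a n\<bar> * (C * 2 powr (level r n / 2)) = \<epsilon> * C * 2 powr (- (r * level r n))" for n
  proof -
    have "\<bar>a n\<bar> * (C * 2 powr (level r n / 2)) = \<epsilon> * C * (2 powr (- (real (level r n) * (r + 1/2))) * 2 powr (level r n / 2))"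
      using \<epsilon> by (simp add: a_def)
    also have "2 powr (- (real (level r n) * (r + 1/2))) * 2 powr (level r n / 2) = 2 powr (- (r * level r n))"
      by (simp add: powr_add[symmetric] algebra_simps)
    finally show ?thesis .
  qed
  have a_small': "\<bar>a n\<bar> * (C * 2 powr (level r n / 2)) \<le> 1/2" for n
  proof -
    have "2 powr (- (r * level r n)) \<le> 1" using powr_mono[of "- (r * level r n)" 0 2] r by simp
    then have "\<epsilon> * C * 2 powr (- (r * level r n)) \<le> \<epsilon> * C * 1"
      using \<epsilon> C_ge_1 by (intro mult_left_mono) auto
    then show ?thesis unfolding a_small using \<epsilon>C by linarith
  qed
  have idx_le: "M + 1 + (2 * M + 1) * i + M \<le> 2 ^ level r n" if "i < P n" for i n
  proof -
    have "(2 * M + 1) * (i + 1) \<le> (2 * M + 1) * P n" using that by (intro mult_le_mono) auto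
    also have "\<dots> \<le> 2 ^ level r n" unfolding P_def by (rule times_div_less_eq_dividend)
    finally show ?thesis by simp
  qed
  \<comment> \<open>The first condition separates the two levels, the second provides interior
    positions, and the third makes the new coefficient at least twice what smoothness s
    allows.\<close>
  have "\<forall>\<^sub>F J in sequentially. j < J \<and> real (2 * (2 * M + 1)) \<le> 2 ^ J \<and> 2 * B * 2 powr (- (real J * (s - r))) < \<epsilon>"
  proof (intro eventually_conj eventually_gt_at_top)
    have "filterlim (\<lambda>j::nat. (2::real) ^ j) at_top sequentially" by real_asymp
    then show "\<forall>\<^sub>F J in sequentially. real (2 * (2 * M + 1)) \<le> 2 ^ J" by (simp only: filterlim_at_top)
    define d where "d = s - r"
    have "d > 0" using r by (simp add: d_def)
    then have "(\<lambda>J::nat. 2 powr (- (real J * d))) \<longlonglongrightarrow> 0" by real_asymp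
    then have "(\<lambda>J::nat. 2 powr (- (real J * (s - r)))) \<longlonglongrightarrow> 0" by (simp only: d_def)
    from tendsto_mult_right_zero[OF this, of "2 * B"]
    show "\<forall>\<^sub>F J in sequentially. 2 * B * 2 powr (- (real J * (s - r))) < \<epsilon>"
      using \<epsilon> by (rule order_tendstoD(2))
  qed
  from eventually_compose_filterlim[OF this filterlim_level[OF r(1)]]
  have ev: "\<forall>\<^sub>F n in sequentially. j < level r n \<and> real (2 * (2 * M + 1)) \<le> 2 ^ level r n \<and>
      2 * B * 2 powr (- (real (level r n) * (s - r))) < \<epsilon>" .
  show ?thesis
  proof (rule that[OF c in_s sep0])
    show "finite (F n)" for n by (simp add: F_def)
    show "\<forall>\<^sub>F n in sequentially. F n \<subseteq> separated_class W B r s (c * rate r n)"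
      using ev eventually_ge_at_top[of 3]
    proof eventually_elim
      case (elim n)
      let ?J = "level r n"
      have J: "base_level W \<le> ?J" "j \<noteq> ?J" using elim j by auto
      show ?case
      proof
        fix h assume "h \<in> F n"
        then obtain i where i: "i < P n" "h = f n i" by (auto simp: F_def)
        let ?m = "M + 1 + (2 * M + 1) * i"
        have m: "?m \<in> {1..2 ^ ?J}" "M < ?m" "?m + M \<le> 2 ^ ?J" using idx_le[OF i(1)] by auto
        have b_r: "\<bar>b\<bar> \<le> B * 2 powr (- (real j * (r + 1/2)))"
          using b r B unfolding b_def by (auto intro!: mult_left_mono)
        have a_r: "\<bar>a n\<bar> \<le> B * 2 powr (- (real ?J * (r + 1/2)))"
          using \<epsilon> \<epsilon>B by (auto simp: a_def intro!: mult_right_mono)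
        have h: "h \<in> holder_class W B r"
          unfolding i(2) f_def by (rule bump_in_holder_class[OF j(1) k J(1) m(1) J(2) small a_small' B b_r a_r])
        have wc: "wav_coeff W ?J ?m h = a n"
          unfolding i(2) f_def using J by (subst wav_coeff_bump[OF j(1) k J(1) m(1) J(2) J(1) m(1)]) auto
        have "2 * (B * 2 powr (- (real ?J * (s + 1/2)))) = (2 * B * 2 powr (- (real ?J * (s - r)))) * 2 powr (- (real ?J * (r + 1/2)))"
          by (simp add: powr_add[symmetric] algebra_simps)
        also have "\<dots> \<le> a n" unfolding a_def using elim by (intro mult_right_mono) auto
        finally have large: "2 * (B * 2 powr (- (real ?J * (s + 1/2)))) \<le> wav_coeff W ?J ?m h" unfolding wc .
        have an: "a n * 2 powr (?J / 2) = \<epsilon> * 2 powr (- (r * ?J))"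
          using a_small[of n] \<epsilon> C_ge_1 by (simp add: a_def)
        have "c * rate r n = \<epsilon> * rate r n / (8 * M * C)" by (simp add: c_def)
        also have "\<dots> \<le> a n * 2 powr (?J / 2) / (8 * M * C)"
          unfolding an using level_bias_lower[OF r(1) elim(2)] \<epsilon> C_ge_1
          by (intro divide_right_mono mult_left_mono) auto
        finally have "ennreal (c * rate r n) \<le> ennreal (a n * 2 powr (?J / 2) / (8 * M * C))"
          by (rule ennreal_leI)
        also have "\<dots> \<le> (INF g\<in>holder_class W B s. sup_dist g h)"
          using wav_coeff_separation[OF J(1) m(2,3) holder_class_cont[OF h] _ large] B
          unfolding wc by (intro INF_greatest) auto
        finally show "h \<in> separated_class W B r s (c * rate r n)"
          using h by (simp add: separated_class_def)
      qed
    qed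
    fix \<eta> :: real assume \<eta>: "\<eta> > 0"
    have "(\<lambda>n::nat. 4 * (2 * real M + 1) * (real n powr \<gamma> * (ln n / n) powr (2 * \<gamma>))) \<longlonglongrightarrow> 0"
      using \<gamma> by real_asymp
    then have "\<forall>\<^sub>F n::nat in sequentially. 4 * (2 * real M + 1) * (real n powr \<gamma> * (ln n / n) powr (2 * \<gamma>)) < \<eta>\<^sup>2"
      by (rule order_tendstoD(2)) (use \<eta> in simp)
    with ev eventually_ge_at_top[of 3]
    show "\<forall>\<^sub>F n in sequentially. \<forall>\<Psi>\<in>borel_measurable (sample_space n).
       (\<forall>X\<in>space (sample_space n). 0 \<le> \<Psi> X \<and> \<Psi> X \<le> 1) \<longrightarrow>
       (\<exists>f\<in>F n. ennreal (1 - \<eta>) \<le> (\<integral>\<^sup>+X. ennreal (\<Psi> X) \<partial>sample_law n (base_bump b j (M + 1)))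
          + (\<integral>\<^sup>+X. ennreal (1 - \<Psi> X) \<partial>sample_law n f))"
    proof eventually_elim
      case (elim n)
      let ?J = "level r n"
      have J: "base_level W \<le> ?J" "j \<noteq> ?J" using elim j by auto
      have J2: "2 * (2 * M + 1) \<le> 2 ^ ?J" using elim(1) by (simp flip: of_nat_le_iff[where 'a=real])
      have P: "P n > 0" unfolding P_def using J2 by (simp add: div_greater_zero_iff)
      have P': "(2 * M + 1) * P n \<le> 2 ^ ?J" unfolding P_def by (rule times_div_less_eq_dividend)
      have "(1 + 2 * (a n)\<^sup>2) ^ n / P n \<le> \<eta>\<^sup>2"
        using order_trans[OF chi_square_bound[OF r(1) elim(2) \<epsilon>2[unfolded \<gamma>_def] J2]
            less_imp_le[OF elim(3)[unfolded \<gamma>_def]]]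
        unfolding a_def P_def .
      with bump_mixture[OF j(1) k J small a_small' P P' \<eta>]
      show ?case by (fastforce simp: F_def f_def)
    qed
  qed
qed

section \<open>Lower bounds for tests and confidence bands\<close>

lemma separated_class_antimono:
  "\<rho> \<le> \<rho>' \<Longrightarrow> separated_class W B r s \<rho>' \<subseteq> separated_class W B r s \<rho>"
  by (auto simp: separated_class_def dest: order_trans[OF ennreal_leI])

text \<open>Eventually \<rho> is below \<open>c * rate r\<close>, and a smaller separation only
  enlarges the alternative, which then contains the indistinguishable family
  \<open>F n\<close>.\<close>

lemma testing_lower_bound:
  assumes r: "0 < r" "r < s" and B: "B \<ge> 1" and \<rho>: "\<rho> \<in> o(rate r)"
  shows "liminf (\<lambda>n. INF \<Psi>\<in>tests n. test_error n (holder_class W B s) (separated_class W B r s (\<rho> n)) \<Psi>) \<ge> 1"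
proof -
  obtain f0 F c where c: "c > 0" and f0: "f0 \<in> holder_class W B s"
    and sub: "\<forall>\<^sub>F n in sequentially. F n \<subseteq> separated_class W B r s (c * rate r n)"
    and ind: "\<And>\<eta>. \<eta> > 0 \<Longrightarrow> \<forall>\<^sub>F n in sequentially. \<forall>\<Psi>\<in>borel_measurable (sample_space n).
       (\<forall>X\<in>space (sample_space n). 0 \<le> \<Psi> X \<and> \<Psi> X \<le> 1) \<longrightarrow>
       (\<exists>f\<in>F n. ennreal (1 - \<eta>) \<le> (\<integral>\<^sup>+X. ennreal (\<Psi> X) \<partial>sample_law n f0) + (\<integral>\<^sup>+X. ennreal (1 - \<Psi> X) \<partial>sample_law n f))"
    \<comment> \<open>Any t above s serves; here it is s + 1.\<close>
    by (rule least_favourable[OF r less_add_one B]) (rule that)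
  have \<rho>_le: "\<forall>\<^sub>F n in sequentially. \<rho> n \<le> c * rate r n"
    using landau_o.smallD[OF \<rho> c] by eventually_elim (use rate_nonneg in \<open>auto simp: abs_le_iff\<close>)
  show ?thesis
  proof (subst le_Liminf_iff, intro allI impI)
    fix y :: ennreal assume "y < 1"
    then obtain y' where y': "y = ennreal y'" "0 \<le> y'" "y' < 1"
      by (cases y) (auto simp: ennreal_less_iff simp flip: ennreal_1)
    define \<eta> where "\<eta> = (1 - y') / 2"
    have \<eta>: "\<eta> > 0" "y' < 1 - \<eta>" using y' by (auto simp: \<eta>_def field_simps)
    show "\<forall>\<^sub>F n in sequentially. y < (INF \<Psi>\<in>tests n. test_error n (holder_class W B s) (separated_class W B r s (\<rho> n)) \<Psi>)"
      using \<rho>_le sub ind[OF \<eta>(1)]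
    proof eventually_elim
      case (elim n)
      have "ennreal (1 - \<eta>) \<le> (INF \<Psi>\<in>tests n. test_error n (holder_class W B s) (separated_class W B r s (\<rho> n)) \<Psi>)"
      proof (rule INF_greatest)
        fix \<Psi> assume \<Psi>: "\<Psi> \<in> tests n"
        then have "\<forall>X\<in>space (sample_space n). 0 \<le> \<Psi> X \<and> \<Psi> X \<le> 1" by (fastforce simp: tests_def)
        with elim(3) \<Psi> obtain f where f: "f \<in> F n"
          and le: "ennreal (1 - \<eta>) \<le> (\<integral>\<^sup>+X. ennreal (\<Psi> X) \<partial>sample_law n f0) + (\<integral>\<^sup>+X. ennreal (1 - \<Psi> X) \<partial>sample_law n f)"
          by (auto simp: tests_def)
        have "f \<in> separated_class W B r s (\<rho> n)"
          using f elim(2) separated_class_antimono[OF elim(1)] by blast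
        then show "ennreal (1 - \<eta>) \<le> test_error n (holder_class W B s) (separated_class W B r s (\<rho> n)) \<Psi>"
          unfolding test_error_def using f0 by (intro order_trans[OF le] add_mono SUP_upper)
      qed
      moreover have "y < ennreal (1 - \<eta>)" using \<eta> y' by (simp add: ennreal_less_iff)
      ultimately show ?case by (rule less_le_trans[rotated])
    qed
  qed
qed

text \<open>Turn the band into a test that rejects when it contains a member of \<open>F n\<close>.
  Honesty makes it reject under the alternatives. Under \<open>f0\<close>, a rejection means that
  the band misses \<open>f0\<close> or has diameter at least \<open>c * rate r n\<close>, which
  Markov's inequality makes improbable since the expected diameter is of the smaller order
  \<open>rate s n\<close>. The errors then sum to less than 1 - \<eta>.\<close>

lemma band_lower_bound:
  fixes \<rho> :: "nat \<Rightarrow> real"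
  assumes r: "0 < r" "r < s" "s < t" and B: "B \<ge> 1" and \<alpha>: "\<alpha> < 1/2" and band: "confidence_band lo up"
  defines "null \<equiv> \<lambda>n. {f \<in> holder_class W B s. (INF g\<in>holder_class W B t. sup_dist g f) \<ge> ennreal (B * rate s n / 2)}"
  assumes honest: "asymp_honest \<alpha> (\<lambda>n. null n \<union> separated_class W B r s (\<rho> n)) lo up"
    and adaptive: "adaptive s r null (\<lambda>n. separated_class W B r s (\<rho> n)) lo up"
  shows "liminf (\<lambda>n. ereal (\<rho> n / rate r n)) > 0"
proof (rule ccontr)
  assume contr: "\<not> ?thesis"
  obtain f0 F c where c: "c > 0" and f0: "f0 \<in> holder_class W B s"
    and sep0: "\<exists>c0>0. (INF g\<in>holder_class W B t. sup_dist g f0) \<ge> ennreal c0"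
    and fin: "\<And>n. finite (F n)"
    and sub: "\<forall>\<^sub>F n in sequentially. F n \<subseteq> separated_class W B r s (c * rate r n)"
    and ind: "\<And>\<eta>. \<eta> > 0 \<Longrightarrow> \<forall>\<^sub>F n in sequentially. \<forall>\<Psi>\<in>borel_measurable (sample_space n).
       (\<forall>X\<in>space (sample_space n). 0 \<le> \<Psi> X \<and> \<Psi> X \<le> 1) \<longrightarrow>
       (\<exists>f\<in>F n. ennreal (1 - \<eta>) \<le> (\<integral>\<^sup>+X. ennreal (\<Psi> X) \<partial>sample_law n f0) + (\<integral>\<^sup>+X. ennreal (1 - \<Psi> X) \<partial>sample_law n f))"
    by (rule least_favourable[OF r B]) (rule that)
  \<comment> \<open>The midpoint between 1/2 and 1 - \<alpha>.\<close>
  define \<beta> where "\<beta> = 3/4 - \<alpha>/2"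
  have \<beta>: "1/2 < \<beta>" "\<beta> < 1 - \<alpha>" using \<alpha> by (auto simp: \<beta>_def)
  \<comment> \<open>Chosen so that 2 (1 - \<beta>) + 2 \<eta> < 1: two coverage failures, Markov's
    bound and the defect of indistinguishability.\<close>
  define \<eta> where "\<eta> = (2 * \<beta> - 1) / 4"
  have \<eta>: "\<eta> > 0" "2 * \<eta> < 2 * \<beta> - 1" using \<beta> by (auto simp: \<eta>_def)
  have s: "0 < s" using r by simp
  have cover: "\<forall>\<^sub>F n in sequentially. ennreal \<beta> <
      (INF f\<in>null n \<union> separated_class W B r s (\<rho> n). emeasure (sample_law n f) (in_band n lo up f))"
  proof (rule less_LiminfD)
    have "ennreal \<beta> < ennreal (1 - \<alpha>)" using \<beta> by (simp add: ennreal_less_iff)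
    with honest show "ennreal \<beta> < Liminf sequentially
      (\<lambda>n. INF f\<in>null n \<union> separated_class W B r s (\<rho> n). emeasure (sample_law n f) (in_band n lo up f))"
      unfolding asymp_honest_def by (rule less_le_trans[rotated])
  qed
  obtain L :: real where L': "\<forall>\<^sub>F n in sequentially.
      (SUP f\<in>null n. expected_diameter n lo up f) \<le> ennreal (L * rate s n) \<and>
      (SUP f\<in>separated_class W B r s (\<rho> n). expected_diameter n lo up f) \<le> ennreal (L * rate r n)"
    using adaptive unfolding adaptive_def by blast
  have L: "\<forall>\<^sub>F n in sequentially. (SUP f\<in>null n. expected_diameter n lo up f) \<le> ennreal (L * rate s n)"
    using L' by eventually_elim (rule conjunct1)
  \<comment> \<open>The definition of \<open>adaptive\<close> does not fix the sign of
    \<open>L\<close>, hence the absolute value.\<close>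
  have small: "\<forall>\<^sub>F n in sequentially. \<bar>L\<bar> * rate s n \<le> \<eta> * (c * rate r n)"
  proof -
    define p where "p = s / (2 * s + 1) - r / (2 * r + 1)"
    have "p > 0" using r by (auto simp: p_def field_simps intro!: divide_pos_pos add_pos_pos mult_pos_pos)
    then have "(\<lambda>n::nat. (ln n / n) powr p) \<longlonglongrightarrow> 0" by real_asymp
    from tendsto_mult_right_zero[OF this, of "\<bar>L\<bar>"]
    have "\<forall>\<^sub>F n::nat in sequentially. \<bar>L\<bar> * (ln n / n) powr p < \<eta> * c"
      by (rule order_tendstoD(2)) (use \<eta> c in simp)
    then show ?thesis
    proof eventually_elim
      case (elim n)
      have "rate s n = (ln n / n) powr p * rate r n"
        by (simp add: rate_def p_def powr_add[symmetric])
      then have "\<bar>L\<bar> * rate s n = (\<bar>L\<bar> * (ln n / n) powr p) * rate r n" by simp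
      also have "\<dots> \<le> (\<eta> * c) * rate r n" using elim by (intro mult_right_mono rate_nonneg) auto
      finally show ?case by simp
    qed
  qed
  have null: "\<forall>\<^sub>F n in sequentially. f0 \<in> null n"
  proof -
    obtain c0 where c0: "c0 > 0" "(INF g\<in>holder_class W B t. sup_dist g f0) \<ge> ennreal c0" using sep0 by auto
    have "(\<lambda>n. B * rate s n / 2) \<longlonglongrightarrow> B * 0 / 2" by (intro tendsto_intros rate_tendsto_0 s) simp
    then have "\<forall>\<^sub>F n in sequentially. B * rate s n / 2 < c0" by (rule order_tendstoD(2)) (use c0 in simp)
    then show ?thesis
    proof eventually_elim
      case (elim n)
      then have "ennreal (B * rate s n / 2) \<le> ennreal c0" by (intro ennreal_leI) simp
      also note c0(2)
      finally show ?case using f0 by (simp add: null_def)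
    qed
  qed
  have not_sep: "\<not> (\<forall>\<^sub>F n in sequentially. ereal c \<le> ereal (\<rho> n / rate r n))"
  proof
    assume "\<forall>\<^sub>F n in sequentially. ereal c \<le> ereal (\<rho> n / rate r n)"
    then have "ereal c \<le> liminf (\<lambda>n. ereal (\<rho> n / rate r n))" by (rule Liminf_bounded)
    moreover have "0 < ereal c" using c by simp
    ultimately have "0 < liminf (\<lambda>n. ereal (\<rho> n / rate r n))" by (rule less_le_trans[rotated])
    then show False using contr by simp
  qed
  \<comment> \<open>The failing liminf gives a separation below \<open>c * rate r n\<close> only for
    infinitely many \<open>n\<close>. A single such \<open>n\<close> at which all eventual
    properties hold yields the contradiction.\<close>
  define Q where "Q n \<longleftrightarrow> n \<ge> 3 \<and> ennreal \<beta> <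
      (INF f\<in>null n \<union> separated_class W B r s (\<rho> n). emeasure (sample_law n f) (in_band n lo up f)) \<and>
      (SUP f\<in>null n. expected_diameter n lo up f) \<le> ennreal (L * rate s n) \<and>
      \<bar>L\<bar> * rate s n \<le> \<eta> * (c * rate r n) \<and> f0 \<in> null n \<and> F n \<subseteq> separated_class W B r s (c * rate r n) \<and>
      (\<forall>\<Psi>\<in>borel_measurable (sample_space n). (\<forall>X\<in>space (sample_space n). 0 \<le> \<Psi> X \<and> \<Psi> X \<le> 1) \<longrightarrow>
       (\<exists>f\<in>F n. ennreal (1 - \<eta>) \<le> (\<integral>\<^sup>+X. ennreal (\<Psi> X) \<partial>sample_law n f0) + (\<integral>\<^sup>+X. ennreal (1 - \<Psi> X) \<partial>sample_law n f)))" for n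
  have "\<forall>\<^sub>F n in sequentially. Q n"
    unfolding Q_def by (intro eventually_conj eventually_ge_at_top cover L small null sub ind[OF \<eta>(1)])
  with not_sep obtain n where \<rho>n: "\<not> (ereal c \<le> ereal (\<rho> n / rate r n))" and "Q n"
    using eventually_mono[of Q sequentially "\<lambda>n. ereal c \<le> ereal (\<rho> n / rate r n)"] by blast
  note Q' = \<open>Q n\<close>[unfolded Q_def]
  note n = conjunct1[OF Q'] and Q' = conjunct2[OF Q']
  note cov = conjunct1[OF Q'] and Q' = conjunct2[OF Q']
  note diam = conjunct1[OF Q'] and Q' = conjunct2[OF Q']
  note Ln = conjunct1[OF Q'] and Q' = conjunct2[OF Q']
  note f0n = conjunct1[OF Q'] and Q' = conjunct2[OF Q']
  note Fn = conjunct1[OF Q'] and tst = conjunct2[OF Q']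
  have cr: "c * rate r n > 0" using c rate_pos[OF n] by simp
  have "\<rho> n < c * rate r n" using \<rho>n rate_pos[OF n, of r] by (simp add: pos_le_divide_eq not_le)
  then have Fn': "F n \<subseteq> separated_class W B r s (\<rho> n)"
    using Fn separated_class_antimono[of "\<rho> n" "c * rate r n"] by force
  have dens: "f \<in> cont_densities" if "f \<in> null n \<union> separated_class W B r s (\<rho> n)" for f
    using that by (auto simp: null_def separated_class_def holder_class_def)
  have sets: "in_band n lo up f \<in> sets (sample_space n)" if "f \<in> null n \<union> separated_class W B r s (\<rho> n)" for f
    using band dens[OF that] by (auto simp: confidence_band_def)
  have miss: "measure (sample_law n f) (space (sample_space n) - in_band n lo up f) \<le> 1 - \<beta>"
    if f: "f \<in> null n \<union> separated_class W B r s (\<rho> n)" for f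
  proof -
    interpret prob_space "sample_law n f" by (rule prob_space_sample_law[OF dens[OF f]])
    have "ennreal \<beta> \<le> emeasure (sample_law n f) (in_band n lo up f)"
      using cov f by (meson INF_lower less_imp_le less_le_trans)
    then have "\<beta> \<le> prob (in_band n lo up f)"
      using \<beta> by (simp add: emeasure_eq_measure)
    then show ?thesis using prob_compl[of "in_band n lo up f"] sets[OF f] by simp
  qed
  define T where "T = (\<Union>f\<in>F n. in_band n lo up f)"
  have T: "T \<in> sets (sample_space n)" unfolding T_def using sets Fn' fin by (intro sets.finite_UN) auto
  have "\<exists>f\<in>F n. ennreal (1 - \<eta>) \<le> (\<integral>\<^sup>+X. ennreal (indicator T X) \<partial>sample_law n f0) + (\<integral>\<^sup>+X. ennreal (1 - indicator T X) \<partial>sample_law n f)"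
    using T by (intro tst[rule_format]) auto
  then obtain f where f: "f \<in> F n"
    and le: "ennreal (1 - \<eta>) \<le> (\<integral>\<^sup>+X. ennreal (indicator T X) \<partial>sample_law n f0) + (\<integral>\<^sup>+X. ennreal (1 - indicator T X) \<partial>sample_law n f)"
    by blast
  have fP: "f \<in> null n \<union> separated_class W B r s (\<rho> n)" using f Fn' by auto
  have f0P: "f0 \<in> null n \<union> separated_class W B r s (\<rho> n)" using f0n by simp
  interpret P0: prob_space "sample_law n f0" by (rule prob_space_sample_law[OF dens[OF f0P]])
  interpret Pf: prob_space "sample_law n f" by (rule prob_space_sample_law[OF dens[OF fP]])
  have "(\<integral>\<^sup>+X. ennreal (indicator T X) \<partial>sample_law n f0) = ennreal (P0.prob T)"
    using T by (simp add: P0.emeasure_eq_measure ennreal_indicator)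
  moreover have "(\<integral>\<^sup>+X. ennreal (1 - indicator T X) \<partial>sample_law n f) = ennreal (Pf.prob (space (sample_space n) - T))"
  proof -
    have "(\<integral>\<^sup>+X. ennreal (1 - indicator T X) \<partial>sample_law n f) = (\<integral>\<^sup>+X. indicator (space (sample_space n) - T) X \<partial>sample_law n f)"
      by (intro nn_integral_cong) (auto simp: indicator_def)
    then show ?thesis using T by (simp add: Pf.emeasure_eq_measure)
  qed
  ultimately have "ennreal (1 - \<eta>) \<le> ennreal (P0.prob T + Pf.prob (space (sample_space n) - T))"
    using le by (simp add: ennreal_plus)
  then have sum_ge: "1 - \<eta> \<le> P0.prob T + Pf.prob (space (sample_space n) - T)"
    by (subst (asm) ennreal_le_iff) auto
  have "Pf.prob (space (sample_space n) - T) \<le> Pf.prob (space (sample_space n) - in_band n lo up f)"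
    using f sets[OF fP] by (intro Pf.finite_measure_mono) (auto simp: T_def)
  then have type2: "Pf.prob (space (sample_space n) - T) \<le> 1 - \<beta>" using miss[OF fP] by linarith
  define A where "A = {X \<in> space (sample_space n). ennreal (c * rate r n) \<le> diameter n lo up X}"
  have diam_meas: "diameter n lo up \<in> borel_measurable (sample_space n)" using band by (simp add: confidence_band_def)
  then have A: "A \<in> sets (sample_space n)" unfolding A_def by measurable
  \<comment> \<open>If the band contains both \<open>f0\<close> and some \<open>h\<close> in
    \<open>F n\<close>, its diameter is at least their distance, and \<open>h\<close> is separated
    from the class of \<open>f0\<close>.\<close>
  have TA: "T \<subseteq> (space (sample_space n) - in_band n lo up f0) \<union> A"
  proof
    fix X assume X: "X \<in> T"
    then obtain h where h: "h \<in> F n" "X \<in> in_band n lo up h" by (auto simp: T_def)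
    have sp: "X \<in> space (sample_space n)" using h by (simp add: in_band_def)
    have "X \<in> A" if in0: "X \<in> in_band n lo up f0"
    proof -
      have "ennreal (c * rate r n) \<le> sup_dist f0 h"
      proof -
        have "ennreal (c * rate r n) \<le> (INF g\<in>holder_class W B s. sup_dist g h)"
          using Fn h(1) by (auto simp: separated_class_def)
        also have "\<dots> \<le> sup_dist f0 h" using f0 by (rule INF_lower)
        finally show ?thesis .
      qed
      also have "\<dots> \<le> diameter n lo up X"
        unfolding sup_dist_def diameter_def
      proof (rule SUP_mono)
        fix y :: real assume y: "y \<in> {0..1}"
        have "h y \<in> {lo n X y..up n X y}" "f0 y \<in> {lo n X y..up n X y}"
          using y h(2) in0 unfolding in_band_def by blast+
        then have "\<bar>f0 y - h y\<bar> \<le> \<bar>up n X y - lo n X y\<bar>" by auto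
        then show "\<exists>z\<in>{0..1}. ennreal \<bar>f0 y - h y\<bar> \<le> ennreal \<bar>up n X z - lo n X z\<bar>"
          using y by (intro bexI[of _ y] ennreal_leI)
      qed
      finally show ?thesis using sp by (simp add: A_def)
    qed
    then show "X \<in> (space (sample_space n) - in_band n lo up f0) \<union> A" using sp by auto
  qed
  have "P0.prob T \<le> P0.prob ((space (sample_space n) - in_band n lo up f0) \<union> A)"
    using TA sets[OF f0P] A by (intro P0.finite_measure_mono) auto
  also have "\<dots> \<le> P0.prob (space (sample_space n) - in_band n lo up f0) + P0.prob A"
    using sets[OF f0P] A by (intro measure_Un_le) auto
  finally have type1: "P0.prob T \<le> (1 - \<beta>) + P0.prob A" using miss[OF f0P] by linarith
  \<comment> \<open>Markov's inequality for the diameter under \<open>f0\<close>.\<close>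
  have "ennreal (c * rate r n * P0.prob A) = (\<integral>\<^sup>+X. ennreal (c * rate r n) * indicator A X \<partial>sample_law n f0)"
    using A cr by (simp add: nn_integral_cmult_indicator P0.emeasure_eq_measure ennreal_mult)
  also have "\<dots> \<le> expected_diameter n lo up f0"
    unfolding expected_diameter_def by (intro nn_integral_mono) (auto simp: A_def indicator_def)
  also have "\<dots> \<le> ennreal (L * rate s n)" by (rule order_trans[OF SUP_upper[OF f0n] diam])
  also have "\<dots> \<le> ennreal (\<eta> * (c * rate r n))"
  proof (rule ennreal_leI)
    have "L * rate s n \<le> \<bar>L\<bar> * rate s n" by (intro mult_right_mono rate_nonneg) auto
    then show "L * rate s n \<le> \<eta> * (c * rate r n)" using Ln by linarith
  qed
  finally have "c * rate r n * P0.prob A \<le> c * rate r n * \<eta>"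
    using cr \<eta> by (subst (asm) ennreal_le_iff) (auto simp: mult.commute)
  then have "P0.prob A \<le> \<eta>" using cr by (rule mult_left_le_imp_le)
  then show False using sum_ge type1 type2 \<eta> by linarith
qed

end

section \<open>Monotonicity in the null class, and assembly of the claims\<close>

lemma asymp_honest_mono:
  assumes "asymp_honest \<alpha> Q lo up" "\<And>n. P n \<subseteq> Q n"
  shows "asymp_honest \<alpha> P lo up"
  using assms(1) unfolding asymp_honest_def
  by (rule order_trans) (intro Liminf_mono always_eventually allI INF_superset_mono assms order_refl)

lemma adaptive_mono:
  assumes "adaptive s r Q0 Q1 lo up" "\<And>n. P0 n \<subseteq> Q0 n"
  shows "adaptive s r P0 Q1 lo up"
proof -
  obtain L :: real where "\<forall>\<^sub>F n in sequentially.
        (SUP f\<in>Q0 n. expected_diameter n lo up f) \<le> ennreal (L * rate s n) \<and>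
        (SUP f\<in>Q1 n. expected_diameter n lo up f) \<le> ennreal (L * rate r n)"
    using assms(1) unfolding adaptive_def by blast
  then have "\<forall>\<^sub>F n in sequentially.
        (SUP f\<in>P0 n. expected_diameter n lo up f) \<le> ennreal (L * rate s n) \<and>
        (SUP f\<in>Q1 n. expected_diameter n lo up f) \<le> ennreal (L * rate r n)"
    by eventually_elim (meson SUP_subset_mono assms(2) order_refl order_trans)
  then show ?thesis unfolding adaptive_def by blast
qed

theorem theorem2:
  fixes W :: wavelet_system and S :: nat and B r s :: real
  assumes "daubechies_basis S W" and "0 < r" and "r < s" and "s < real S" and "1 \<le> B"
  shows
    "minimax_testing_rate (holder_class W B s) (separated_class W B r s) (rate r) \<and>

     (\<forall>\<rho> \<alpha> lo up.
        (\<forall>n. 0 \<le> \<rho> n) \<and> \<alpha> < 1/2 \<and> confidence_band lo up \<and>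
        asymp_honest \<alpha> (\<lambda>n. holder_class W B s \<union> separated_class W B r s (\<rho> n)) lo up \<and>
        adaptive s r (\<lambda>n. holder_class W B s) (\<lambda>n. separated_class W B r s (\<rho> n)) lo up \<longrightarrow>
        liminf (\<lambda>n. ereal (\<rho> n / rate r n)) > 0) \<and>

     (\<forall>\<alpha>. 0 < \<alpha> \<and> \<alpha> < 1 \<longrightarrow>
        (\<exists>\<rho> lo up.
           (\<forall>n. 0 \<le> \<rho> n) \<and> limsup (\<lambda>n. ereal (\<rho> n / rate r n)) < \<infinity> \<and> confidence_band lo up \<and>
           asymp_honest \<alpha> (\<lambda>n. holder_class W B s \<union> separated_class W B r s (\<rho> n)) lo up \<and>
           adaptive s r (\<lambda>n. holder_class W B s) (\<lambda>n. separated_class W B r s (\<rho> n)) lo up)) \<and>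

     (\<forall>t. s < t \<and> t < real S \<longrightarrow>
        (let null = (\<lambda>n. {f \<in> holder_class W B s.
               (INF g\<in>holder_class W B t. sup_dist g f) \<ge> ennreal (B * rate s n / 2)})
         in
           (\<forall>\<rho> \<alpha> lo up.
              (\<forall>n. 0 \<le> \<rho> n) \<and> \<alpha> < 1/2 \<and> confidence_band lo up \<and>
              asymp_honest \<alpha> (\<lambda>n. null n \<union> separated_class W B r s (\<rho> n)) lo up \<and>
              adaptive s r null (\<lambda>n. separated_class W B r s (\<rho> n)) lo up \<longrightarrow>
              liminf (\<lambda>n. ereal (\<rho> n / rate r n)) > 0) \<and>
           (\<forall>\<alpha>. 0 < \<alpha> \<and> \<alpha> < 1 \<longrightarrow>
              (\<exists>\<rho> lo up.
                 (\<forall>n. 0 \<le> \<rho> n) \<and> limsup (\<lambda>n. ereal (\<rho> n / rate r n)) < \<infinity> \<and>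
                 confidence_band lo up \<and>
                 asymp_honest \<alpha> (\<lambda>n. null n \<union> separated_class W B r s (\<rho> n)) lo up \<and>
                 adaptive s r null (\<lambda>n. separated_class W B r s (\<rho> n)) lo up))))"
proof -
  have "S > 0" using assms by (cases S) auto
  then obtain M C where "localized_wavelets W M C"
    using daubechies_basis_localized[OF assms(1)] by blast
  then interpret localized_wavelets W M C .
  note rs = assms(2,3)
  have B: "B \<ge> 0" using assms(5) by simp
  define null where "null t n = {f \<in> holder_class W B s.
    (INF g\<in>holder_class W B t. sup_dist g f) \<ge> ennreal (B * rate s n / 2)}" for t n
  have null_sub: "null t n \<subseteq> holder_class W B s" for t n by (auto simp: null_def)
  note honest_mono = asymp_honest_mono[OF _ Un_mono[OF null_sub subset_refl]]
  note adaptive_mono = adaptive_mono[OF _ null_sub]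
  have testing: "minimax_testing_rate (holder_class W B s) (separated_class W B r s) (rate r)"
    unfolding minimax_testing_rate_def
    using test_achieves_rate[OF rs B] testing_lower_bound[OF rs assms(5)] by blast
  have lower: "liminf (\<lambda>n. ereal (\<rho> n / rate r n)) > 0"
    if "s < t" "\<alpha> < 1/2" "confidence_band lo up"
      "asymp_honest \<alpha> (\<lambda>n. null t n \<union> separated_class W B r s (\<rho> n)) lo up"
      "adaptive s r (null t) (\<lambda>n. separated_class W B r s (\<rho> n)) lo up" for t \<rho> \<alpha> lo up
    using band_lower_bound[OF rs that(1) assms(5) that(2,3), of \<rho>] that(4,5)
    unfolding null_def[abs_def] by blast
  have lower': "liminf (\<lambda>n. ereal (\<rho> n / rate r n)) > 0"
    if "\<alpha> < 1/2" "confidence_band lo up"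
      "asymp_honest \<alpha> (\<lambda>n. holder_class W B s \<union> separated_class W B r s (\<rho> n)) lo up"
      "adaptive s r (\<lambda>n. holder_class W B s) (\<lambda>n. separated_class W B r s (\<rho> n)) lo up" for \<rho> \<alpha> lo up
    \<comment> \<open>Honesty and adaptivity pass to the smaller null class belonging to t = s + 1;
      any t above s would serve.\<close>
    by (rule lower[of "s + 1", OF _ that(1,2) honest_mono[OF that(3)] adaptive_mono[OF that(4)]]) simp
  have upper: "\<exists>\<rho> lo up. (\<forall>n. 0 \<le> \<rho> n) \<and> limsup (\<lambda>n. ereal (\<rho> n / rate r n)) < \<infinity> \<and> confidence_band lo up \<and>
     asymp_honest \<alpha> (\<lambda>n. holder_class W B s \<union> separated_class W B r s (\<rho> n)) lo up \<and>
     adaptive s r (\<lambda>n. holder_class W B s) (\<lambda>n. separated_class W B r s (\<rho> n)) lo up" if "0 < \<alpha>" "\<alpha> < 1" for \<alpha>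
    by (rule adaptive_band_exists[OF rs B that])
  have upper': "\<exists>\<rho> lo up. (\<forall>n. 0 \<le> \<rho> n) \<and> limsup (\<lambda>n. ereal (\<rho> n / rate r n)) < \<infinity> \<and> confidence_band lo up \<and>
     asymp_honest \<alpha> (\<lambda>n. null t n \<union> separated_class W B r s (\<rho> n)) lo up \<and>
     adaptive s r (null t) (\<lambda>n. separated_class W B r s (\<rho> n)) lo up" if "0 < \<alpha>" "\<alpha> < 1" for \<alpha> t
    using upper[OF that] honest_mono adaptive_mono by meson
  show ?thesis
    unfolding Let_def null_def[symmetric]
  proof (intro conjI allI impI, goal_cases)
    case 1
    show ?case by (rule testing)
  next
    case (2 \<rho> \<alpha> lo up)
    then show ?case by (elim conjE) (rule lower')
  next
    case (3 \<alpha>)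
    then show ?case by (elim conjE) (rule upper)
  next
    case (4 t \<rho> \<alpha> lo up)
    then show ?case by (elim conjE) (rule lower)
  next
    case (5 t \<alpha>)
    then show ?case by (elim conjE) (rule upper')
  qed
qed

end
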